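(* Let $p$ be a prime. The functor $\Psi_2:\{2\text{-flat rings}\}\to\{2\text{-wrinkled rings}\}$, $\mathcal A\mapsto(\mathcal A/p,\gamma_p)$, is an equivalence of categories. In particular, every $2$-wrinkled ring admits a unique lift to a $2$-flat ring.
   Context: For a commutative $\mathbb F_p$-algebra $A$, $\mathrm{Frob}_A:A\to A$ is $x\mapsto x^p$. For $0\le i\le p-1$ and $x\in A$, put $\gamma_i(x)=x^i/i!$. A $2$-wrinkled ring (relative to $p$) is a pair $(A,\gamma_p)$, where $A$ is a commutative $\mathbb F_p$-algebra whose Frobenius is surjective and $\gamma_p:\mathrm{Ker}(\mathrm{Frob}_A)\to A$ is a map such that $\gamma_p(ax)=a^p\gamma_p(x)$ and $\gamma_p(x+x')=\sum_{i+i'=p}\gamma_i(x)\gamma_{i'}(x')$ (sum over $i,i'\ge0$) for all $a\in A$ and $x,x'\in\mathrm{Ker}(\mathrm{Frob}_A)$. A morphism $(A,\gamma_p)\to(A',\gamma'_p)$ is a ring homomorphism $\phi:A\to A'$ with $\gamma'_p\circ\phi=\phi\circ\gamma_p$. A $2$-flat ring (relative to $p$) is a commutative $\mathbb Z/p^2\mathbb Z$-algebra $\mathcal A$ which is flat (equivalently free) as a $\mathbb Z/p^2\mathbb Z$-module and such that the Frobenius of $\mathcal A/p$ is surjective. Morphisms are ring homomorphisms. The functor $\Psi_2$: for a $2$-flat ring $\mathcal A$, put $A=\mathcal A/p$. For $x\in\mathrm{Ker}(\mathrm{Frob}_A)$, pick any lift $X\in\mathcal A$ of $x$; then $X^p$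 does not depend on the lift and $X^p=pY$ for some $Y\in\mathcal A$, whose class $y\in A$ is well defined. Put $\gamma_p(x)=\frac1{(p-1)!}y=-y$. Then $(A,\gamma_p)$ is a $2$-wrinkled ring and $\Psi_2(\mathcal A):=(A,\gamma_p)$. A lift of a $2$-wrinkled ring $(A,\gamma_p)$ is a $2$-flat ring $\mathcal A$ with an isomorphism $\Psi_2(\mathcal A)\simeq(A,\gamma_p)$; uniqueness is up to unique isomorphism. *)

theory Defs
  imports
    "HOL-Number_Theory.Residues"
    "HOL-Algebra.Module"
    "HOL-Algebra.QuotRing"
    "HOL-Library.Equipollence"
    "HOL-Library.FuncSet"
begin

section \<open>Categories, functors, equivalences\<close>

text \<open>
  Composition carries the three objects involved, so the hom-sets need not be disjoint:
  \<open>ccomp C a b c g f\<close> is the composite of \<open>f : a \<rightarrow> b\<close> and \<open>g : b \<rightarrow> c\<close>.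
\<close>

record ('o, 'm) cat =
  objs :: "'o set"
  homs :: "'o \<Rightarrow> 'o \<Rightarrow> 'm set"
  cid :: "'o \<Rightarrow> 'm"
  ccomp :: "'o \<Rightarrow> 'o \<Rightarrow> 'o \<Rightarrow> 'm \<Rightarrow> 'm \<Rightarrow> 'm"

definition is_category :: "('o, 'm) cat \<Rightarrow> bool" where
  "is_category C \<longleftrightarrow>
     (\<forall>a\<in>objs C. cid C a \<in> homs C a a) \<and>
     (\<forall>a\<in>objs C. \<forall>b\<in>objs C. \<forall>c\<in>objs C. \<forall>f\<in>homs C a b. \<forall>g\<in>homs C b c.
        ccomp C a b c g f \<in> homs C a c) \<and>
     (\<forall>a\<in>objs C. \<forall>b\<in>objs C. \<forall>f\<in>homs C a b.
        ccomp C a a b f (cid C a) = f \<and> ccomp C a b b (cid C b) f = f) \<and>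
     (\<forall>a\<in>objs C. \<forall>b\<in>objs C. \<forall>c\<in>objs C. \<forall>d\<in>objs C.
      \<forall>f\<in>homs C a b. \<forall>g\<in>homs C b c. \<forall>h\<in>homs C c d.
        ccomp C a c d h (ccomp C a b c g f) = ccomp C a b d (ccomp C b c d h g) f)"

record ('o, 'm, 'o2, 'm2) fctor =
  fobj :: "'o \<Rightarrow> 'o2"
  fmor :: "'o \<Rightarrow> 'o \<Rightarrow> 'm \<Rightarrow> 'm2"

definition is_functor ::
  "('o, 'm) cat \<Rightarrow> ('o2, 'm2) cat \<Rightarrow> ('o, 'm, 'o2, 'm2) fctor \<Rightarrow> bool" where
  "is_functor C D F \<longleftrightarrow>
     (\<forall>a\<in>objs C. fobj F a \<in> objs D) \<and>
     (\<forall>a\<in>objs C. \<forall>b\<in>objs C. \<forall>f\<in>homs C a b. fmor F a b f \<in> homs D (fobj F a) (fobj F b)) \<and>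
     (\<forall>a\<in>objs C. fmor F a a (cid C a) = cid D (fobj F a)) \<and>
     (\<forall>a\<in>objs C. \<forall>b\<in>objs C. \<forall>c\<in>objs C. \<forall>f\<in>homs C a b. \<forall>g\<in>homs C b c.
        fmor F a c (ccomp C a b c g f)
          = ccomp D (fobj F a) (fobj F b) (fobj F c) (fmor F b c g) (fmor F a b f))"

definition id_fctor :: "('o, 'm, 'o, 'm) fctor" where
  "id_fctor = \<lparr>fobj = (\<lambda>a. a), fmor = (\<lambda>a b f. f)\<rparr>"

definition comp_fctor ::
  "('o2, 'm2, 'o3, 'm3) fctor \<Rightarrow> ('o, 'm, 'o2, 'm2) fctor \<Rightarrow> ('o, 'm, 'o3, 'm3) fctor" where
  "comp_fctor G F =
     \<lparr>fobj = (\<lambda>a. fobj G (fobj F a)),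
      fmor = (\<lambda>a b f. fmor G (fobj F a) (fobj F b) (fmor F a b f))\<rparr>"

definition is_iso :: "('o, 'm) cat \<Rightarrow> 'o \<Rightarrow> 'o \<Rightarrow> 'm \<Rightarrow> bool" where
  "is_iso C a b f \<longleftrightarrow> f \<in> homs C a b \<and>
     (\<exists>g\<in>homs C b a. ccomp C a b a g f = cid C a \<and> ccomp C b a b f g = cid C b)"

definition naturally_isomorphic ::
  "('o, 'm) cat \<Rightarrow> ('o2, 'm2) cat \<Rightarrow> ('o, 'm, 'o2, 'm2) fctor \<Rightarrow> ('o, 'm, 'o2, 'm2) fctor \<Rightarrow> bool"
  where
  "naturally_isomorphic C D F G \<longleftrightarrow>
     (\<exists>\<eta>. (\<forall>a\<in>objs C. is_iso D (fobj F a) (fobj G a) (\<eta> a)) \<and>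
          (\<forall>a\<in>objs C. \<forall>b\<in>objs C. \<forall>f\<in>homs C a b.
             ccomp D (fobj F a) (fobj F b) (fobj G b) (\<eta> b) (fmor F a b f)
               = ccomp D (fobj F a) (fobj G a) (fobj G b) (fmor G a b f) (\<eta> a)))"

definition is_equivalence ::
  "('o, 'm) cat \<Rightarrow> ('o2, 'm2) cat \<Rightarrow> ('o, 'm, 'o2, 'm2) fctor \<Rightarrow> bool" where
  "is_equivalence C D F \<longleftrightarrow>
     is_category C \<and> is_category D \<and> is_functor C D F \<and>
     (\<exists>G. is_functor D C G \<and>
          naturally_isomorphic C C (comp_fctor G F) id_fctor \<and>
          naturally_isomorphic D D (comp_fctor F G) id_fctor)"

section \<open>Algebras over \<open>\<int>/n\<close>\<close>

text \<open>
  A \<open>\<int>/n\<close>-algebra structure on a ring is unique if it exists: the class of \<open>k\<close> must act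
  as the \<open>k\<close>-fold sum. Being a \<open>\<int>/n\<close>-algebra is therefore a property of the ring.
\<close>

definition int_scalars :: "'a ring \<Rightarrow> (int, 'a) module" where
  "int_scalars A = ring.extend A (module.fields (\<lambda>k x. [k] \<cdot>\<^bsub>A\<^esub> x))"

definition zmod_algebra :: "nat \<Rightarrow> 'a ring \<Rightarrow> bool" where
  "zmod_algebra n A \<longleftrightarrow> algebra (residue_ring (int n)) (int_scalars A)"

definition is_basis :: "('r, 's) ring_scheme \<Rightarrow> ('r, 'a, 't) module_scheme \<Rightarrow> 'a set \<Rightarrow> bool" where
  "is_basis R M B \<longleftrightarrow> B \<subseteq> carrier M \<and>
     (\<forall>x\<in>carrier M. \<exists>!c. c \<in> B \<rightarrow>\<^sub>E carrier R \<and> finite {b\<in>B. c b \<noteq> \<zero>\<^bsub>R\<^esub>} \<and>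
        x = (\<Oplus>\<^bsub>M\<^esub>b\<in>{b\<in>B. c b \<noteq> \<zero>\<^bsub>R\<^esub>}. c b \<odot>\<^bsub>M\<^esub> b))"

definition free_module :: "('r, 's) ring_scheme \<Rightarrow> ('r, 'a, 't) module_scheme \<Rightarrow> bool" where
  "free_module R M \<longleftrightarrow> module R M \<and> (\<exists>B. is_basis R M B)"

section \<open>Wrinkled rings\<close>

definition frob :: "nat \<Rightarrow> 'a ring \<Rightarrow> 'a \<Rightarrow> 'a" where
  "frob p A x = x [^]\<^bsub>A\<^esub> p"

definition frob_ker :: "nat \<Rightarrow> 'a ring \<Rightarrow> 'a set" where
  "frob_ker p A = a_kernel A A (frob p A)"

text \<open>The maps \<open>\<gamma>\<^sub>i\<close> for \<open>0 \<le> i \<le> p\<close>, where the one for \<open>i = p\<close> is the given \<open>\<gamma>\<close>.\<close>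

definition div_pow :: "nat \<Rightarrow> 'a ring \<Rightarrow> ('a \<Rightarrow> 'a) \<Rightarrow> nat \<Rightarrow> 'a \<Rightarrow> 'a" where
  "div_pow p A \<gamma> i x =
     (if i < p then inv\<^bsub>A\<^esub> ([(fact i :: nat)] \<cdot>\<^bsub>A\<^esub> \<one>\<^bsub>A\<^esub>) \<otimes>\<^bsub>A\<^esub> (x [^]\<^bsub>A\<^esub> i) else \<gamma> x)"

type_synonym 'a wrinkled = "'a ring \<times> ('a \<Rightarrow> 'a)"

definition two_wrinkled :: "nat \<Rightarrow> 'a wrinkled \<Rightarrow> bool" where
  "two_wrinkled p W \<longleftrightarrow> (case W of (A, \<gamma>) \<Rightarrow>
     zmod_algebra p A \<and>
     frob p A ` carrier A = carrier A \<and>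
     \<gamma> \<in> frob_ker p A \<rightarrow> carrier A \<and>
     (\<forall>a\<in>carrier A. \<forall>x\<in>frob_ker p A. \<gamma> (a \<otimes>\<^bsub>A\<^esub> x) = (a [^]\<^bsub>A\<^esub> p) \<otimes>\<^bsub>A\<^esub> \<gamma> x) \<and>
     (\<forall>x\<in>frob_ker p A. \<forall>x'\<in>frob_ker p A.
        \<gamma> (x \<oplus>\<^bsub>A\<^esub> x')
          = (\<Oplus>\<^bsub>A\<^esub>i\<in>{0..p}. div_pow p A \<gamma> i x \<otimes>\<^bsub>A\<^esub> div_pow p A \<gamma> (p - i) x')))"

text \<open>
  Morphisms are required to be undefined outside the carrier of their source, so that
  equality of functions is equality of morphisms.
\<close>

definition wrinkled_hom :: "nat \<Rightarrow> 'a wrinkled \<Rightarrow> 'b wrinkled \<Rightarrow> ('a \<Rightarrow> 'b) set" where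
  "wrinkled_hom p W W' = (case W of (A, \<gamma>) \<Rightarrow> case W' of (A', \<gamma>') \<Rightarrow>
     {\<phi> \<in> ring_hom A A' \<inter> extensional (carrier A). \<forall>x\<in>frob_ker p A. \<gamma>' (\<phi> x) = \<phi> (\<gamma> x)})"

definition wrinkled_iso :: "nat \<Rightarrow> 'a wrinkled \<Rightarrow> 'b wrinkled \<Rightarrow> ('a \<Rightarrow> 'b) set" where
  "wrinkled_iso p W W' = {\<phi> \<in> wrinkled_hom p W W'. \<exists>\<psi>\<in>wrinkled_hom p W' W.
     (\<forall>x\<in>carrier (fst W). \<psi> (\<phi> x) = x) \<and> (\<forall>y\<in>carrier (fst W'). \<phi> (\<psi> y) = y)}"

section \<open>Flat rings and the functor \<open>\<Psi>\<^sub>2\<close>\<close>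

definition p_ideal :: "nat \<Rightarrow> 'a ring \<Rightarrow> 'a set" where
  "p_ideal p R = PIdl\<^bsub>R\<^esub> ([p] \<cdot>\<^bsub>R\<^esub> \<one>\<^bsub>R\<^esub>)"

definition mod_p :: "nat \<Rightarrow> 'a ring \<Rightarrow> 'a set ring" where
  "mod_p p R = R Quot p_ideal p R"

text \<open>Over \<open>\<int>/p\<^sup>2\<close>, flat and free are the same for modules; freeness is used here.\<close>

definition two_flat :: "nat \<Rightarrow> 'a ring \<Rightarrow> bool" where
  "two_flat p R \<longleftrightarrow>
     zmod_algebra (p ^ 2) R \<and>
     free_module (residue_ring (int (p ^ 2))) (int_scalars R) \<and>
     frob p (mod_p p R) ` carrier (mod_p p R) = carrier (mod_p p R)"

definition flat_hom :: "'a ring \<Rightarrow> 'b ring \<Rightarrow> ('a \<Rightarrow> 'b) set" where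
  "flat_hom R S = ring_hom R S \<inter> extensional (carrier R)"

text \<open>
  Here \<open>x\<close> is a coset, so its lifts are its elements \<open>X\<close>; writing \<open>X\<^sup>p = p Y\<close>, the value is
  the class of \<open>Y\<close> divided by \<open>(p - 1)!\<close>. It does not depend on \<open>X\<close> and \<open>Y\<close> if the ring is
  \<open>2\<close>-flat and \<open>x\<close> lies in the kernel of Frobenius.
\<close>

definition Psi_gamma :: "nat \<Rightarrow> 'a ring \<Rightarrow> 'a set \<Rightarrow> 'a set" where
  "Psi_gamma p R x = (THE c. \<exists>X\<in>x. \<exists>Y\<in>carrier R. X [^]\<^bsub>R\<^esub> p = [p] \<cdot>\<^bsub>R\<^esub> Y \<and>
     c = inv\<^bsub>mod_p p R\<^esub> ([(fact (p - 1) :: nat)] \<cdot>\<^bsub>mod_p p R\<^esub> \<one>\<^bsub>mod_p p R\<^esub>)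
           \<otimes>\<^bsub>mod_p p R\<^esub> (p_ideal p R +>\<^bsub>R\<^esub> Y))"

definition Psi_obj :: "nat \<Rightarrow> 'a ring \<Rightarrow> 'a set wrinkled" where
  "Psi_obj p R = (mod_p p R, Psi_gamma p R)"

definition Psi_mor :: "nat \<Rightarrow> 'a ring \<Rightarrow> 'b ring \<Rightarrow> ('a \<Rightarrow> 'b) \<Rightarrow> 'a set \<Rightarrow> 'b set" where
  "Psi_mor p R S f =
     (\<lambda>x\<in>carrier (mod_p p R). THE y. \<exists>X\<in>x. y = p_ideal p S +>\<^bsub>S\<^esub> f X)"

definition Psi :: "nat \<Rightarrow> ('a ring, 'a \<Rightarrow> 'a, 'a set wrinkled, 'a set \<Rightarrow> 'a set) fctor" where
  "Psi p = \<lparr>fobj = Psi_obj p, fmor = Psi_mor p\<rparr>"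

text \<open>
  The categories contain the rings with carrier in a fixed type whose size is bounded by a
  set \<open>U\<close>. The bound plays the role of a universe: \<open>Psi\<close> changes the carrier type from
  \<open>'a\<close> to \<open>'a set\<close>, which is large enough to contain rings that are bigger than any ring
  on \<open>'a\<close>.
\<close>

definition flat_cat :: "'u set \<Rightarrow> nat \<Rightarrow> ('a ring, 'a \<Rightarrow> 'a) cat" where
  "flat_cat U p =
     \<lparr>objs = {R. two_flat p R \<and> carrier R \<lesssim> U},
      homs = flat_hom,
      cid = (\<lambda>R. \<lambda>x\<in>carrier R. x),
      ccomp = (\<lambda>R S T g f. compose (carrier R) g f)\<rparr>"

definition wrinkled_cat :: "'u set \<Rightarrow> nat \<Rightarrow> ('a wrinkled, 'a \<Rightarrow> 'a) cat" where
  "wrinkled_cat U p =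
     \<lparr>objs = {W. two_wrinkled p W \<and> carrier (fst W) \<lesssim> U},
      homs = wrinkled_hom p,
      cid = (\<lambda>W. \<lambda>x\<in>carrier (fst W). x),
      ccomp = (\<lambda>W W' W'' g f. compose (carrier (fst W)) g f)\<rparr>"

definition is_lift :: "nat \<Rightarrow> 'a wrinkled \<Rightarrow> 'b ring \<Rightarrow> ('b set \<Rightarrow> 'a) \<Rightarrow> bool" where
  "is_lift p W R \<alpha> \<longleftrightarrow> two_flat p R \<and> \<alpha> \<in> wrinkled_iso p (Psi_obj p R) W"

end

theory Submission
  imports Defs "HOL-Algebra.UnivPoly" "HOL-Algebra.Weak_Morphisms"
begin

text \<open>
  For a \<open>2\<close>-flat ring \<open>R\<close> with reduction \<open>A = R/p\<close>, the second ghost component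
  \<open>(x, v) \<mapsto> X\<^sup>p + p V\<close>, where \<open>X\<close> and \<open>V\<close> lift \<open>x\<close> and \<open>v\<close>, is a well-defined ring
  homomorphism \<open>W\<^sub>2(A) \<rightarrow> R\<close>. It is surjective because Frobenius is, and its kernel is
  \<open>{(x, \<gamma>\<^sub>p(x)) | x\<^sup>p = 0}\<close>. So \<open>R\<close> is recovered from \<open>(A, \<gamma>\<^sub>p)\<close>, functorially. Conversely, for
  a ring \<open>A\<close> with surjective Frobenius, the axioms of a \<open>2\<close>-wrinkled ring say exactly that this
  subset of \<open>W\<^sub>2(A)\<close> is an ideal, and the quotient is the desired lift: it is flat since
  \<open>p (a, b) = (0, a\<^sup>p)\<close> in \<open>W\<^sub>2(A)\<close>, and \<open>(a, b) \<mapsto> a\<^sup>p\<close> identifies its reduction with \<open>A\<close>.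
\<close>

section \<open>Divided powers and Witt vectors of length two\<close>

text \<open>The Witt vectors are built by hand over \<open>A\<close>, with addition corrected by the
  reduction of \<open>(a^p + c^p - (a + c)^p)/p\<close>. Since \<open>(p-1)! = -1\<close> modulo p,
  this is the sum of \<open>a^i c^(p-i) / (i! (p-i)!)\<close> over \<open>0 < i < p\<close>. The
  same sum measures how far \<open>\<gamma>\<^sub>p\<close> is from additive, and this coincidence
  is why wrinkles are ideals. The same sign enters \<open>\<gamma>\<^sub>p\<close> through
  \<open>1/(p-1)!\<close>, so that \<open>X^p + p V = 0\<close> yields the value of
  \<open>\<gamma>\<^sub>p\<close> and not its negative. Working by hand requires a proof of the
  cocycle identity and a computation of p-fold sums; both are found in coefficients of
  \<open>t^p\<close> of products of truncated exponentials. Freeness over \<open>Z/p^2\<close> acts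
  only through its consequence that \<open>p x = 0\<close> makes \<open>x\<close> a multiple of p;
  the converse, needed for the constructed ring, obtains a basis from Zorn's lemma. Carriers are a
  second obstacle: cosets live in a type of sets, so the lift is formed on representatives, which
  can be moved into any type that is large enough.\<close>

lemma (in cring) binomial_expansion:
  assumes x: "x \<in> carrier R" and y: "y \<in> carrier R"
  shows "(x \<oplus> y) [^] n = (\<Oplus>i\<in>{..n}. [(n choose i)] \<cdot> (x [^] i \<otimes> y [^] (n - i)))"
proof (induction n)
  case 0
  show ?case using x y by simp
next
  case (Suc n)
  define t where "t m i = [(m choose i)] \<cdot> (x [^] i \<otimes> y [^] (m - i))" for m i :: nat
  have t: "t m i \<in> carrier R" for m i using x y by (simp add: t_def)
  have "t m \<in> A \<rightarrow> carrier R" for m A using t by auto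
  note [simp] = t this
  \<comment> \<open>Pascal's rule. For i = n the last summand contains
    \<open>n choose Suc n\<close>, so it is zero whatever the truncated exponent
    \<open>n - Suc n\<close> means.\<close>
  have step: "t (Suc n) (Suc i) = x \<otimes> t n i \<oplus> y \<otimes> t n (Suc i)" if "i \<le> n" for i
  proof -
    have 1: "x \<otimes> t n i = [(n choose i)] \<cdot> (x [^] Suc i \<otimes> y [^] (n - i))"
      using x y by (simp add: t_def add_pow_rdistr m_comm m_lcomm)
    have 2: "y \<otimes> t n (Suc i) = [(n choose Suc i)] \<cdot> (x [^] Suc i \<otimes> y [^] (n - i))"
    proof (cases "i = n")
      case True then show ?thesis using x y by (simp add: t_def binomial_eq_0)
    next
      case False
      then have "n - i = Suc (n - Suc i)" using that by simp
      then have "y [^] (n - i) = y \<otimes> y [^] (n - Suc i)" using y by (simp add: m_comm)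
      then show ?thesis using x y by (simp add: t_def add_pow_rdistr m_comm m_lcomm m_assoc)
    qed
    show ?thesis unfolding 1 2 using x y
      by (simp add: t_def add.nat_pow_mult)
  qed
  have t0: "t (Suc n) 0 = y \<otimes> t n 0" using x y by (simp add: t_def m_comm)
  have tn: "t n (Suc n) = \<zero>" using x y by (simp add: t_def binomial_eq_0)
  have "(\<Oplus>i\<in>{..Suc n}. t (Suc n) i) = (\<Oplus>i\<in>{..n}. t (Suc n) (Suc i)) \<oplus> t (Suc n) 0"
    by (rule finsum_Suc2) simp
  also have "(\<Oplus>i\<in>{..n}. t (Suc n) (Suc i)) = (\<Oplus>i\<in>{..n}. x \<otimes> t n i \<oplus> y \<otimes> t n (Suc i))"
    by (rule add.finprod_cong') (use x y step in auto)
  also have "\<dots> = (\<Oplus>i\<in>{..n}. x \<otimes> t n i) \<oplus> (\<Oplus>i\<in>{..n}. y \<otimes> t n (Suc i))"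
    using x y by (intro finsum_addf) auto
  also have "\<dots> \<oplus> t (Suc n) 0 = (\<Oplus>i\<in>{..n}. x \<otimes> t n i) \<oplus> ((\<Oplus>i\<in>{..n}. y \<otimes> t n (Suc i)) \<oplus> y \<otimes> t n 0)"
    using x y by (simp add: t0 a_assoc)
  also have "(\<Oplus>i\<in>{..n}. y \<otimes> t n (Suc i)) \<oplus> y \<otimes> t n 0 = (\<Oplus>i\<in>{..Suc n}. y \<otimes> t n i)"
    using x y by (subst finsum_Suc2) auto
  also have "\<dots> = (\<Oplus>i\<in>{..n}. y \<otimes> t n i)"
    using x y by (simp add: tn Pi_def)
  also have "(\<Oplus>i\<in>{..n}. x \<otimes> t n i) \<oplus> (\<Oplus>i\<in>{..n}. y \<otimes> t n i) = (x \<oplus> y) \<otimes> (\<Oplus>i\<in>{..n}. t n i)"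
    using x y by (simp add: finsum_rdistr l_distr)
  also have "(\<Oplus>i\<in>{..n}. t n i) = (x \<oplus> y) [^] n" using Suc by (simp add: t_def)
  finally show ?case using x y unfolding t_def by (simp add: m_comm)
qed

text \<open>Stated for any commutative ring in which p = 0, because it is applied to
  \<open>A\<close> and also to the polynomial ring \<open>UP A\<close>.\<close>

lemma (in cring) freshman_dream:
  fixes p :: nat
  assumes prime: "prime p" and char: "[p] \<cdot> \<one> = \<zero>"
    and x: "x \<in> carrier R" and y: "y \<in> carrier R"
  shows "(x \<oplus> y) [^] p = x [^] p \<oplus> y [^] p"
proof -
  have "0 < p" using prime prime_gt_0_nat by blast
  then obtain q where q: "p = Suc q" using gr0_conv_Suc by blast
  define t where "t i = [(p choose i)] \<cdot> (x [^] i \<otimes> y [^] (p - i))" for i :: nat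
  have t: "t \<in> B \<rightarrow> carrier R" for B using x y by (simp add: t_def)
  have z: "t i = \<zero>" if "0 < i" "i < p" for i
  proof -
    have "p dvd p choose i" using that prime dvd_choose_prime by auto
    then obtain k where k: "p choose i = p * k" by blast
    have "[p] \<cdot> u = \<zero>" if "u \<in> carrier R" for u
      using that add_pow_ldistr[of \<one> u p] by (simp add: char)
    then show ?thesis unfolding t_def k using x y by (simp add: add.nat_pow_pow[symmetric] mult.commute[of p])
  qed
  have "(x \<oplus> y) [^] p = (\<Oplus>i\<in>{..Suc q}. t i)"
    using binomial_expansion[OF x y, of p] by (simp add: t_def q)
  also have "\<dots> = t (Suc q) \<oplus> (\<Oplus>i\<in>{..q}. t i)" by (rule finsum_Suc) (rule t)
  also have "(\<Oplus>i\<in>{..q}. t i) = (\<Oplus>i\<in>{0}. t i)"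
    by (rule add.finprod_mono_neutral_cong_right) (use z q t in auto)
  finally show ?thesis using x y by (simp add: t_def q del: nat_pow_Suc)
qed

text \<open>The integral polynomial \<open>(x^p + y^p - (x + y)^p)/p\<close> modulo p, the
  correction term of Witt vector addition. Passing the zero map to \<open>div_pow\<close> kills the
  two end terms and leaves the sum over \<open>0 < i < p\<close>.\<close>

definition witt_cocycle :: "nat \<Rightarrow> 'a ring \<Rightarrow> 'a \<Rightarrow> 'a \<Rightarrow> 'a" where
  "witt_cocycle p A x y =
     (\<Oplus>\<^bsub>A\<^esub>i\<in>{..p}. div_pow p A (\<lambda>_. \<zero>\<^bsub>A\<^esub>) i x \<otimes>\<^bsub>A\<^esub> div_pow p A (\<lambda>_. \<zero>\<^bsub>A\<^esub>) (p - i) y)"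

text \<open>Witt's formulas in characteristic p: the summand \<open>p b d\<close> in the second
  component of a product is zero there and does not appear.\<close>

definition witt :: "nat \<Rightarrow> 'a ring \<Rightarrow> ('a \<times> 'a) ring" where
  "witt p A = \<lparr>carrier = carrier A \<times> carrier A,
     monoid.mult = (\<lambda>(a, b) (c, d).
       (a \<otimes>\<^bsub>A\<^esub> c, (a [^]\<^bsub>A\<^esub> p \<otimes>\<^bsub>A\<^esub> d) \<oplus>\<^bsub>A\<^esub> (c [^]\<^bsub>A\<^esub> p \<otimes>\<^bsub>A\<^esub> b))),
     one = (\<one>\<^bsub>A\<^esub>, \<zero>\<^bsub>A\<^esub>),
     zero = (\<zero>\<^bsub>A\<^esub>, \<zero>\<^bsub>A\<^esub>),
     add = (\<lambda>(a, b) (c, d). (a \<oplus>\<^bsub>A\<^esub> c, b \<oplus>\<^bsub>A\<^esub> d \<oplus>\<^bsub>A\<^esub> witt_cocycle p A a c))\<rparr>"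

locale fp_algebra = cring A for A :: "'a ring" (structure) +
  fixes p :: nat
  assumes prime: "prime p" and char_p: "[p] \<cdot> \<one> = \<zero>"
begin

lemma p_gt_1: "1 < p" and p_gt_0 [simp]: "0 < p" and p_neq_0 [simp]: "p \<noteq> 0"
  using prime prime_gt_1_nat prime_gt_0_nat by auto

lemma nat_mult_eq: "x \<in> carrier A \<Longrightarrow> [(n::nat)] \<cdot> x = ([n] \<cdot> \<one>) \<otimes> x"
  by (simp add: add_pow_ldistr)

lemma nat_smult_mult: "[(m * n :: nat)] \<cdot> \<one> = ([m] \<cdot> \<one>) \<otimes> ([n] \<cdot> \<one>)"
  by (metis add.nat_pow_pow mult.commute nat_mult_eq one_closed add.nat_pow_closed)

lemma dvd_smult: "p dvd n \<Longrightarrow> x \<in> carrier A \<Longrightarrow> [n] \<cdot> x = \<zero>"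
  by (metis add.nat_pow_closed char_p dvd_def l_null nat_mult_eq nat_smult_mult one_closed)

lemma smult_unit:
  assumes "\<not> p dvd n" shows "[n] \<cdot> \<one> \<in> Units A"
proof -
  have "coprime n p" using assms prime by (metis coprime_commute prime_imp_coprime)
  then obtain a b where "n * a = p * b + 1"
    by (metis assms bezout_nat coprime_iff_gcd_eq_1 dvd_0_right gcd.commute)
  then have "[(n * a)] \<cdot> \<one> = [(p * b)] \<cdot> \<one> \<oplus> \<one>"
    by (simp add: add.nat_pow_mult[symmetric])
  then have "([n] \<cdot> \<one>) \<otimes> ([a] \<cdot> \<one>) = \<one>"
    by (simp add: nat_smult_mult char_p)
  then show ?thesis using m_comm[of "[n] \<cdot> \<one>" "[a] \<cdot> \<one>"] by (auto simp: Units_def)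
qed

lemma fact_unit: "i < p \<Longrightarrow> [(fact i :: nat)] \<cdot> \<one> \<in> Units A"
  using smult_unit prime prime_dvd_fact_iff by fastforce

lemma wilson: "[(fact (p - 1) :: nat)] \<cdot> \<one> = \<ominus> \<one>"
proof -
  have "[fact (p - 1) = - 1] (mod int p)" using wilson_theorem[OF prime] by simp
  then have "int p dvd int (fact (p - 1) + 1)"
    by (simp add: cong_iff_dvd_diff add.commute)
  then have "p dvd fact (p - 1) + 1" by presburger
  from dvd_smult[OF this one_closed] have "[(fact (p - 1) :: nat)] \<cdot> \<one> \<oplus> \<one> = \<zero>"
    by (simp add: add.nat_pow_mult[symmetric])
  then show ?thesis by (simp add: minus_equality minus_unique)
qed

lemma frob_add:
  "x \<in> carrier A \<Longrightarrow> y \<in> carrier A \<Longrightarrow> (x \<oplus> y) [^] p = x [^] p \<oplus> y [^] p"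
  using freshman_dream[OF prime char_p] .

abbreviation dpow :: "nat \<Rightarrow> 'a \<Rightarrow> 'a" where
  "dpow \<equiv> div_pow p A (\<lambda>_. \<zero>)"

lemma dpow_eq: "i < p \<Longrightarrow> dpow i x = inv ([(fact i :: nat)] \<cdot> \<one>) \<otimes> x [^] i"
  by (simp add: div_pow_def)

lemma dpow_ge: "p \<le> i \<Longrightarrow> dpow i x = \<zero>"
  by (simp add: div_pow_def)

lemma dpow_closed [simp]: "x \<in> carrier A \<Longrightarrow> dpow i x \<in> carrier A"
  by (simp add: div_pow_def fact_unit)

lemma fact_dpow: "i < p \<Longrightarrow> x \<in> carrier A \<Longrightarrow> ([(fact i :: nat)] \<cdot> \<one>) \<otimes> dpow i x = x [^] i"
  using fact_unit by (simp add: dpow_eq m_assoc[symmetric] Units_r_inv)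

lemma dpow_0: "x \<in> carrier A \<Longrightarrow> dpow 0 x = \<one>"
  using fact_dpow[of 0 x] by simp

lemma dpow_1: "x \<in> carrier A \<Longrightarrow> dpow (Suc 0) x = x"
  using fact_dpow[of "Suc 0" x] p_gt_1 by simp

lemma dpow_zero: "0 < i \<Longrightarrow> dpow i \<zero> = \<zero>"
  by (cases "i < p") (simp_all add: dpow_eq dpow_ge fact_unit nat_pow_zero)

lemma dpow_mult:
  assumes "x \<in> carrier A" "y \<in> carrier A"
  shows "dpow i (x \<otimes> y) = x [^] i \<otimes> dpow i y"
  using assms by (cases "i < p") (simp_all add: dpow_eq dpow_ge fact_unit nat_pow_distrib m_lcomm)

lemma unit_cancel:
  "u \<in> Units A \<Longrightarrow> x \<in> carrier A \<Longrightarrow> y \<in> carrier A \<Longrightarrow> u \<otimes> x = u \<otimes> y \<Longrightarrow> x = y"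
  by (metis Units_l_cancel)

lemma choose_dpow:
  assumes "i \<le> n" "n < p" "x \<in> carrier A" "y \<in> carrier A"
  shows "[(n choose i)] \<cdot> (x [^] i \<otimes> y [^] (n - i))
       = ([(fact n :: nat)] \<cdot> \<one>) \<otimes> (dpow i x \<otimes> dpow (n - i) y)"
proof -
  have "[(n choose i)] \<cdot> (x [^] i \<otimes> y [^] (n - i)) =
    ([(n choose i)] \<cdot> \<one>) \<otimes> ((([(fact i :: nat)] \<cdot> \<one>) \<otimes> dpow i x) \<otimes> (([(fact (n-i) :: nat)] \<cdot> \<one>) \<otimes> dpow (n-i) y))"
    using assms by (subst nat_mult_eq) (simp_all add: fact_dpow)
  also have "\<dots> = ([(fact i * fact (n - i) * (n choose i))] \<cdot> \<one>) \<otimes> (dpow i x \<otimes> dpow (n - i) y)"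
    using assms by (simp add: nat_smult_mult m_ac)
  finally show ?thesis using binomial_fact_lemma[OF assms(1)] by simp
qed

text \<open>The unit n! can be cancelled, which turns the claim into the binomial theorem. At n = p
  this breaks down: the left side is zero by convention and the right side is the cocycle.\<close>

lemma dpow_add:
  assumes n: "n < p" and x: "x \<in> carrier A" and y: "y \<in> carrier A"
  shows "dpow n (x \<oplus> y) = (\<Oplus>i\<in>{..n}. dpow i x \<otimes> dpow (n - i) y)"
proof (rule unit_cancel[OF fact_unit[OF n]])
  have "([(fact n :: nat)] \<cdot> \<one>) \<otimes> dpow n (x \<oplus> y) = (\<Oplus>i\<in>{..n}. [(n choose i)] \<cdot> (x [^] i \<otimes> y [^] (n - i)))"
    using assms by (simp add: fact_dpow binomial_expansion)
  also have "\<dots> = (\<Oplus>i\<in>{..n}. ([(fact n :: nat)] \<cdot> \<one>) \<otimes> (dpow i x \<otimes> dpow (n - i) y))"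
    using assms by (intro add.finprod_cong') (auto simp: choose_dpow)
  also have "\<dots> = ([(fact n :: nat)] \<cdot> \<one>) \<otimes> (\<Oplus>i\<in>{..n}. dpow i x \<otimes> dpow (n - i) y)"
    using assms by (intro finsum_rdistr[symmetric]) auto
  finally show "([(fact n :: nat)] \<cdot> \<one>) \<otimes> dpow n (x \<oplus> y) = ([(fact n :: nat)] \<cdot> \<one>) \<otimes> (\<Oplus>i\<in>{..n}. dpow i x \<otimes> dpow (n - i) y)" .
qed (use assms in \<open>auto intro!: finsum_closed\<close>)

section \<open>The cocycle as a coefficient of truncated exponentials\<close>

abbreviation "cocycle \<equiv> witt_cocycle p A"

lemmas cocycle_def = witt_cocycle_def[of p A]

lemma cocycle_closed [simp]: "x \<in> carrier A \<Longrightarrow> y \<in> carrier A \<Longrightarrow> cocycle x y \<in> carrier A"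
  by (simp add: cocycle_def finsum_closed)

lemma cocycle_mult:
  assumes "x \<in> carrier A" "y \<in> carrier A" "z \<in> carrier A"
  shows "cocycle (z \<otimes> x) (z \<otimes> y) = z [^] p \<otimes> cocycle x y"
proof -
  have "cocycle (z \<otimes> x) (z \<otimes> y) = (\<Oplus>i\<in>{..p}. z [^] p \<otimes> (dpow i x \<otimes> dpow (p - i) y))"
    unfolding cocycle_def
  proof (rule add.finprod_cong')
    fix i assume "i \<in> {..p}"
    then have "z [^] p = z [^] i \<otimes> z [^] (p - i)" using assms by (simp add: nat_pow_mult)
    then show "dpow i (z \<otimes> x) \<otimes> dpow (p - i) (z \<otimes> y) = z [^] p \<otimes> (dpow i x \<otimes> dpow (p - i) y)"
      using assms by (simp only: dpow_mult) (simp add: m_ac)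
  qed (use assms in auto)
  then show ?thesis using assms by (simp add: cocycle_def finsum_rdistr)
qed

lemma dpow_up: "x \<in> carrier A \<Longrightarrow> (\<lambda>i. dpow i x) \<in> up A"
  by (intro mem_upI exI[of _ p]) (auto simp: dpow_ge bound_def)

lemma UP_mult_coeff:
  "f \<in> carrier (UP A) \<Longrightarrow> g \<in> carrier (UP A) \<Longrightarrow>
   (f \<otimes>\<^bsub>UP A\<^esub> g) n = (\<Oplus>i\<in>{..n}. f i \<otimes> g (n - i))"
  by (simp add: UP_def)

lemma dpow_UP: "x \<in> carrier A \<Longrightarrow> (\<lambda>i. dpow i x) \<in> carrier (UP A)"
  by (simp add: UP_def dpow_up)

lemma UP_carrier_closed: "f \<in> carrier (UP A) \<Longrightarrow> f i \<in> carrier A"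
  by (auto simp: UP_def)

definition texp :: "'a \<Rightarrow> nat \<Rightarrow> 'a" where "texp x = (\<lambda>i. dpow i x)"

lemma texp_UP [simp]: "x \<in> carrier A \<Longrightarrow> texp x \<in> carrier (UP A)"
  by (simp add: texp_def dpow_UP)

text \<open>Multiplying the truncated exponentials \<open>\<Sum>i<p. x\<^sup>i/i! t\<^sup>i\<close> modulo \<open>t\<^bsup>p+1\<^esup>\<close> gives the
  cocycle as the coefficient of \<open>t\<^sup>p\<close>, so the cocycle identity is associativity.\<close>

lemma texp_mult_coeff_less:
  assumes F: "F \<in> carrier (UP A)" "\<And>i. i < p \<Longrightarrow> F i = dpow i x"
    and x: "x \<in> carrier A" and y: "y \<in> carrier A" and n: "n < p"
  shows "(F \<otimes>\<^bsub>UP A\<^esub> texp y) n = dpow n (x \<oplus> y)"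
proof -
  have "(F \<otimes>\<^bsub>UP A\<^esub> texp y) n = (\<Oplus>i\<in>{..n}. F i \<otimes> texp y (n - i))"
    using F y by (intro UP_mult_coeff) auto
  also have "\<dots> = (\<Oplus>i\<in>{..n}. dpow i x \<otimes> dpow (n - i) y)"
    using x y n by (intro add.finprod_cong') (auto simp: texp_def F)
  finally show ?thesis using x y n by (simp add: dpow_add)
qed

text \<open>\<open>F\<close> is any polynomial that agrees with the truncated exponential of
  \<open>x\<close> below degree p. Products of several truncated exponentials are of this kind, but
  their coefficient at p need not vanish: each new factor adds one value of the cocycle to
  it.\<close>

lemma texp_mult_coeff_top:
  assumes F: "F \<in> carrier (UP A)" "\<And>i. i < p \<Longrightarrow> F i = dpow i x"
    and x: "x \<in> carrier A" and y: "y \<in> carrier A"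
  shows "(F \<otimes>\<^bsub>UP A\<^esub> texp y) p = F p \<oplus> cocycle x y"
proof -
  obtain q where q: "p = Suc q" using p_gt_0 gr0_conv_Suc by blast
  note Fc = UP_carrier_closed[OF F(1)]
  have "(F \<otimes>\<^bsub>UP A\<^esub> texp y) p = (\<Oplus>i\<in>{..p}. F i \<otimes> texp y (p - i))"
    using F y by (intro UP_mult_coeff) auto
  also have "\<dots> = F p \<oplus> (\<Oplus>i\<in>{..q}. F i \<otimes> dpow (p - i) y)"
    using finsum_Suc[of "\<lambda>i. F i \<otimes> dpow (p - i) y" q] y Fc
    by (simp add: q[symmetric] dpow_0 texp_def)
  also have "(\<Oplus>i\<in>{..q}. F i \<otimes> dpow (p - i) y) = (\<Oplus>i\<in>{..q}. dpow i x \<otimes> dpow (p - i) y)"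
    using x y by (intro add.finprod_cong') (auto simp: F, use q F in force)
  also have "\<dots> = cocycle x y"
    using finsum_Suc[of "\<lambda>i. dpow i x \<otimes> dpow (p - i) y" q] x y
    by (simp add: cocycle_def q[symmetric] dpow_ge)
  finally show ?thesis .
qed

lemma texp_mult_top:
  "x \<in> carrier A \<Longrightarrow> y \<in> carrier A \<Longrightarrow> (texp x \<otimes>\<^bsub>UP A\<^esub> texp y) p = cocycle x y"
  using texp_mult_coeff_top[of "texp x" x y] by (simp add: texp_def[of x] dpow_ge dpow_UP)

sublocale U: UP_cring A "UP A" by unfold_locales

lemma cocycle_comm:
  "x \<in> carrier A \<Longrightarrow> y \<in> carrier A \<Longrightarrow> cocycle x y = cocycle y x"
  using U.P.m_comm[of "texp x" "texp y"] by (simp flip: texp_mult_top)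

lemma cocycle_zero:
  assumes "x \<in> carrier A" shows "cocycle x \<zero> = \<zero>" "cocycle \<zero> x = \<zero>"
proof -
  have "cocycle \<zero> x = (\<Oplus>i\<in>{..p}. \<zero>)"
    unfolding cocycle_def using assms
    by (intro add.finprod_cong') (auto simp: dpow_ge dpow_zero gr0_conv_Suc split: nat.splits, metis dpow_ge dpow_zero l_null r_null diff_zero gr_zeroI dpow_closed order_refl zero_closed)
  then show "cocycle \<zero> x = \<zero>" by simp
  then show "cocycle x \<zero> = \<zero>" using assms by (simp add: cocycle_comm)
qed

lemma cocycle_assoc:
  assumes "x \<in> carrier A" "y \<in> carrier A" "z \<in> carrier A"
  shows "cocycle x y \<oplus> cocycle (x \<oplus> y) z = cocycle y z \<oplus> cocycle x (y \<oplus> z)"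
proof -
  have main: "((texp x \<otimes>\<^bsub>UP A\<^esub> texp y) \<otimes>\<^bsub>UP A\<^esub> texp z) p = cocycle x y \<oplus> cocycle (x \<oplus> y) z"
    if xyz: "x \<in> carrier A" "y \<in> carrier A" "z \<in> carrier A" for x y z
  proof -
    have "(texp x \<otimes>\<^bsub>UP A\<^esub> texp y) i = dpow i (x \<oplus> y)" if "i < p" for i
      by (rule texp_mult_coeff_less) (use xyz that in \<open>auto simp: texp_def dpow_UP\<close>)
    then show ?thesis
      using xyz by (subst texp_mult_coeff_top[of _ "x \<oplus> y"]) (auto simp: texp_mult_top)
  qed
  have "cocycle x y \<oplus> cocycle (x \<oplus> y) z = (texp x \<otimes>\<^bsub>UP A\<^esub> (texp y \<otimes>\<^bsub>UP A\<^esub> texp z)) p"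
    using main[OF assms] assms by (simp add: U.P.m_assoc)
  \<comment> \<open>Commutativity moves \<open>texp x\<close> to the end, so that the evaluation of
    left-bracketed products also covers this bracketing.\<close>
  also have "\<dots> = ((texp y \<otimes>\<^bsub>UP A\<^esub> texp z) \<otimes>\<^bsub>UP A\<^esub> texp x) p"
    using assms by (simp add: U.P.m_comm)
  also have "\<dots> = cocycle y z \<oplus> cocycle (y \<oplus> z) x" using main[OF assms(2,3,1)] .
  finally show ?thesis using assms by (simp add: cocycle_comm)
qed

text \<open>In the convolution of the n-th power with \<open>g\<close>, indices below n are killed
  by the induction hypothesis and the last index by \<open>g 0 = \<zero>\<close>; in degree n + 1
  this leaves the index n alone.\<close>

lemma UP_pow_low:
  assumes g: "g \<in> carrier (UP A)" "g 0 = \<zero>"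
  shows "(\<forall>i<n. (g [^]\<^bsub>UP A\<^esub> n) i = \<zero>) \<and> (g [^]\<^bsub>UP A\<^esub> n) n = g 1 [^] n"
proof (induction n)
  case 0
  show ?case by (simp add: UP_def)
next
  case (Suc n)
  define h where "h = g [^]\<^bsub>UP A\<^esub> n"
  have h: "h \<in> carrier (UP A)" using g by (simp add: h_def)
  note c = UP_carrier_closed[OF h] UP_carrier_closed[OF g(1)]
  have IH: "h i = \<zero>" if "i < n" for i using Suc that by (simp add: h_def)
  have eq: "(g [^]\<^bsub>UP A\<^esub> Suc n) i = (\<Oplus>j\<in>{..i}. h j \<otimes> g (i - j))" for i
    using UP_mult_coeff[OF h g(1)] by (simp add: h_def)
  have "(\<Oplus>j\<in>{..i}. h j \<otimes> g (i - j)) = (\<Oplus>j\<in>{..i}. \<zero>)" if "i < Suc n" for i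
  proof (rule add.finprod_cong')
    fix j assume "j \<in> {..i}"
    then show "h j \<otimes> g (i - j) = \<zero>"
      using that IH c g(2) by (cases "j = n") auto
  qed auto
  moreover have "(\<Oplus>j\<in>{..Suc n}. h j \<otimes> g (Suc n - j)) = (\<Oplus>j\<in>{n}. h j \<otimes> g (Suc n - j))"
  proof (rule add.finprod_mono_neutral_cong_right)
    fix j assume "j \<in> {..Suc n} - {n}"
    then show "h j \<otimes> g (Suc n - j) = \<zero>"
      using IH c g(2) by (cases "j = Suc n") auto
  qed (use c in auto)
  ultimately have "\<forall>i<Suc n. (g [^]\<^bsub>UP A\<^esub> Suc n) i = \<zero>"
    and "(g [^]\<^bsub>UP A\<^esub> Suc n) (Suc n) = h n \<otimes> g 1"
    unfolding eq using c by auto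
  then show ?case using Suc by (simp add: h_def)
qed

lemma UP_char_p: "[p] \<cdot>\<^bsub>UP A\<^esub> \<one>\<^bsub>UP A\<^esub> = \<zero>\<^bsub>UP A\<^esub>"
proof -
  have add: "(f \<oplus>\<^bsub>UP A\<^esub> g) = (\<lambda>i. f i \<oplus> g i)" if "f \<in> carrier (UP A)" "g \<in> carrier (UP A)" for f g
    using that by (simp add: UP_def)
  have "[n] \<cdot>\<^bsub>UP A\<^esub> \<one>\<^bsub>UP A\<^esub> = (\<lambda>i. [n] \<cdot> (if i = 0 then \<one> else \<zero>))" for n :: nat
  proof (induction n)
    case 0
    have "[(0::nat)] \<cdot>\<^bsub>UP A\<^esub> \<one>\<^bsub>UP A\<^esub> = \<zero>\<^bsub>UP A\<^esub>" by simp
    then show ?case by (simp add: UP_def)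
  next
    case (Suc n)
    have "[Suc n] \<cdot>\<^bsub>UP A\<^esub> \<one>\<^bsub>UP A\<^esub> = (\<lambda>i. ([n] \<cdot>\<^bsub>UP A\<^esub> \<one>\<^bsub>UP A\<^esub>) i \<oplus> \<one>\<^bsub>UP A\<^esub> i)"
      by (simp add: add)
    then show ?case unfolding Suc by (simp add: UP_def)
  qed
  then show ?thesis by (simp add: UP_def fun_eq_iff char_p)
qed

text \<open>A direct summation of the cocycles of \<open>k x\<close> and \<open>x\<close> is
  avoided: Frobenius is additive on \<open>UP A\<close>, so the p-th power of \<open>1 + g\<close>
  is \<open>1 + g^p\<close>, and \<open>g = x t + ...\<close> contributes \<open>x^p\<close> in
  degree p. This becomes the second component of \<open>p (x, y)\<close>.\<close>

lemma texp_pow_top: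
  assumes x: "x \<in> carrier A"
  shows "(texp x [^]\<^bsub>UP A\<^esub> p) p = x [^] p"
proof -
  define g where "g = (\<lambda>i. if i = 0 then \<zero> else dpow i x)"
  have g: "g \<in> carrier (UP A)"
    using x by (auto simp: g_def UP_def bound_def dpow_ge intro!: mem_upI exI[of _ p])
  have "texp x = \<one>\<^bsub>UP A\<^esub> \<oplus>\<^bsub>UP A\<^esub> g"
    using g x U.P.one_closed by (auto simp: texp_def UP_def g_def dpow_0 fun_eq_iff)
  then have "texp x [^]\<^bsub>UP A\<^esub> p = \<one>\<^bsub>UP A\<^esub> \<oplus>\<^bsub>UP A\<^esub> g [^]\<^bsub>UP A\<^esub> p"
    using U.P.freshman_dream[OF prime UP_char_p U.P.one_closed g] by simp
  moreover have "(\<one>\<^bsub>UP A\<^esub> \<oplus>\<^bsub>UP A\<^esub> h) p = h p" if "h \<in> carrier (UP A)" for h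
    using that U.P.one_closed UP_carrier_closed[OF that] by (simp add: UP_def)
  ultimately have "(texp x [^]\<^bsub>UP A\<^esub> p) p = (g [^]\<^bsub>UP A\<^esub> p) p" using g by simp
  also have "\<dots> = x [^] p" using UP_pow_low[OF g, of p] x by (simp add: g_def dpow_1)
  finally show ?thesis .
qed

section \<open>Ring structure and multiples of Witt vectors\<close>

lemma witt_simps:
  "carrier (witt p A) = carrier A \<times> carrier A"
  "(a, b) \<otimes>\<^bsub>witt p A\<^esub> (c, d) = (a \<otimes> c, (a [^] p \<otimes> d) \<oplus> (c [^] p \<otimes> b))"
  "(a, b) \<oplus>\<^bsub>witt p A\<^esub> (c, d) = (a \<oplus> c, b \<oplus> d \<oplus> cocycle a c)"
  "\<one>\<^bsub>witt p A\<^esub> = (\<one>, \<zero>)" "\<zero>\<^bsub>witt p A\<^esub> = (\<zero>, \<zero>)"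
  by (simp_all add: witt_def)

text \<open>Additively this is the extension of \<open>A\<close> by itself given by a symmetric
  normalised 2-cocycle. Distributivity rests on the homogeneity of the cocycle in degree p and on
  the additivity of Frobenius.\<close>

lemma witt_cring: "cring (witt p A)"
proof (rule cringI)
  show "abelian_group (witt p A)"
  proof (rule abelian_groupI)
    fix x y z assume "x \<in> carrier (witt p A)" "y \<in> carrier (witt p A)" "z \<in> carrier (witt p A)"
    then obtain a b c d e f where [simp]: "x = (a, b)" "y = (c, d)" "z = (e, f)"
      and [simp]: "a \<in> carrier A" "b \<in> carrier A" "c \<in> carrier A" "d \<in> carrier A" "e \<in> carrier A" "f \<in> carrier A"
      by (auto simp: witt_simps)
    have "b \<oplus> d \<oplus> cocycle a c \<oplus> f \<oplus> cocycle (a \<oplus> c) e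
        = (b \<oplus> d \<oplus> f) \<oplus> (cocycle a c \<oplus> cocycle (a \<oplus> c) e)" by (simp add: a_ac)
    also have "\<dots> = b \<oplus> (d \<oplus> f \<oplus> cocycle c e) \<oplus> cocycle a (c \<oplus> e)"
      unfolding cocycle_assoc[of a c e, simplified] by (simp add: a_ac)
    finally show "x \<oplus>\<^bsub>witt p A\<^esub> y \<oplus>\<^bsub>witt p A\<^esub> z = x \<oplus>\<^bsub>witt p A\<^esub> (y \<oplus>\<^bsub>witt p A\<^esub> z)"
      by (simp add: witt_simps a_assoc)
    show "x \<oplus>\<^bsub>witt p A\<^esub> y = y \<oplus>\<^bsub>witt p A\<^esub> x"
      by (simp add: witt_simps a_comm cocycle_comm)
    show "x \<oplus>\<^bsub>witt p A\<^esub> y \<in> carrier (witt p A)" by (simp add: witt_simps)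
    show "\<zero>\<^bsub>witt p A\<^esub> \<oplus>\<^bsub>witt p A\<^esub> x = x" by (simp add: witt_simps cocycle_zero)
    \<comment> \<open>The correction \<open>cocycle a (\<ominus> a)\<close> cannot be dropped: for p
      = 2 it is \<open>a^2\<close>.\<close>
    have "b \<oplus> cocycle a (\<ominus> a) \<in> carrier A" by simp
    then have "(\<ominus> a, \<ominus> (b \<oplus> cocycle a (\<ominus> a))) \<oplus>\<^bsub>witt p A\<^esub> x = \<zero>\<^bsub>witt p A\<^esub>"
      by (simp add: witt_simps l_neg a_assoc cocycle_comm)
    then show "\<exists>y\<in>carrier (witt p A). y \<oplus>\<^bsub>witt p A\<^esub> x = \<zero>\<^bsub>witt p A\<^esub>"
      by (intro bexI[of _ "(\<ominus> a, \<ominus> (b \<oplus> cocycle a (\<ominus> a)))"]) (auto simp: witt_simps)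
  qed (auto simp: witt_simps)
  show "comm_monoid (witt p A)"
  proof (rule comm_monoidI)
    fix x y z assume "x \<in> carrier (witt p A)" "y \<in> carrier (witt p A)" "z \<in> carrier (witt p A)"
    then obtain a b c d e f where [simp]: "x = (a, b)" "y = (c, d)" "z = (e, f)"
      and [simp]: "a \<in> carrier A" "b \<in> carrier A" "c \<in> carrier A" "d \<in> carrier A" "e \<in> carrier A" "f \<in> carrier A"
      by (auto simp: witt_simps)
    show "x \<otimes>\<^bsub>witt p A\<^esub> y \<otimes>\<^bsub>witt p A\<^esub> z = x \<otimes>\<^bsub>witt p A\<^esub> (y \<otimes>\<^bsub>witt p A\<^esub> z)"
      by (simp add: witt_simps m_assoc nat_pow_distrib r_distr a_ac m_ac)
    show "x \<otimes>\<^bsub>witt p A\<^esub> y = y \<otimes>\<^bsub>witt p A\<^esub> x" by (simp add: witt_simps m_comm a_comm)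
    show "x \<otimes>\<^bsub>witt p A\<^esub> y \<in> carrier (witt p A)" by (simp add: witt_simps)
    show "\<one>\<^bsub>witt p A\<^esub> \<otimes>\<^bsub>witt p A\<^esub> x = x" by (simp add: witt_simps)
  qed (auto simp: witt_simps)
  fix x y z assume "x \<in> carrier (witt p A)" "y \<in> carrier (witt p A)" "z \<in> carrier (witt p A)"
  then obtain a b c d e f where [simp]: "x = (a, b)" "y = (c, d)" "z = (e, f)"
    and [simp]: "a \<in> carrier A" "b \<in> carrier A" "c \<in> carrier A" "d \<in> carrier A" "e \<in> carrier A" "f \<in> carrier A"
    by (auto simp: witt_simps)
  have "cocycle (a \<otimes> e) (c \<otimes> e) = e [^] p \<otimes> cocycle a c"
    using cocycle_mult[of a c e] by (simp add: m_comm)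
  then show "(x \<oplus>\<^bsub>witt p A\<^esub> y) \<otimes>\<^bsub>witt p A\<^esub> z = x \<otimes>\<^bsub>witt p A\<^esub> z \<oplus>\<^bsub>witt p A\<^esub> y \<otimes>\<^bsub>witt p A\<^esub> z"
    by (simp add: witt_simps l_distr r_distr frob_add a_ac)
qed

text \<open>Adding \<open>(x, y)\<close> once more adds \<open>cocycle ([n] \<cdot> x) x\<close> to
  the second component, which is how the coefficient of \<open>t^p\<close> in the powers of
  \<open>texp x\<close> grows. The conjunct on coefficients below p serves the induction: the step
  needs the power to look like a truncated exponential there.\<close>

lemma witt_smult:
  fixes n :: nat
  assumes x: "x \<in> carrier A" and y: "y \<in> carrier A"
  shows "[n] \<cdot>\<^bsub>witt p A\<^esub> (x, y) = ([n] \<cdot> x, [n] \<cdot> y \<oplus> (if n = 0 then \<zero> else (texp x [^]\<^bsub>UP A\<^esub> n) p))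
     \<and> (\<forall>i<p. (texp x [^]\<^bsub>UP A\<^esub> n) i = dpow i ([n] \<cdot> x))"
proof (induction n)
  case 0
  have "add_pow (witt p A) (0::nat) (x, y) = (\<zero>, \<zero>)"
    using abelian_group.a_group[OF ring.is_abelian_group[OF cring.axioms(1)[OF witt_cring]]]
    by (simp add: add_pow_def nat_pow_def witt_simps)
  then show ?case by (auto simp: UP_def dpow_0 dpow_zero)
next
  case (Suc n)
  interpret W: cring "witt p A" by (rule witt_cring)
  define F where "F = texp x [^]\<^bsub>UP A\<^esub> n"
  have F: "F \<in> carrier (UP A)" "\<And>i. i < p \<Longrightarrow> F i = dpow i ([n] \<cdot> x)"
    using x Suc by (auto simp: F_def)
  note Fc = UP_carrier_closed[OF F(1)]
  have F0: "F p = \<zero>" if "n = 0" using that by (simp add: F_def UP_def)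
  have "[Suc n] \<cdot>\<^bsub>witt p A\<^esub> (x, y) = ([n] \<cdot>\<^bsub>witt p A\<^esub> (x, y)) \<oplus>\<^bsub>witt p A\<^esub> (x, y)"
    by simp
  also have "\<dots> = ([n] \<cdot> x, [n] \<cdot> y \<oplus> F p) \<oplus>\<^bsub>witt p A\<^esub> (x, y)"
    using Suc F0 by (auto simp: F_def)
  also have "\<dots> = ([Suc n] \<cdot> x, [Suc n] \<cdot> y \<oplus> (F p \<oplus> cocycle ([n] \<cdot> x) x))"
    using x y Fc by (simp add: witt_simps a_ac)
  also have "F p \<oplus> cocycle ([n] \<cdot> x) x = (texp x [^]\<^bsub>UP A\<^esub> Suc n) p"
    using texp_mult_coeff_top[OF F, of x] x by (simp add: F_def)
  finally have "[Suc n] \<cdot>\<^bsub>witt p A\<^esub> (x, y) = ([Suc n] \<cdot> x, [Suc n] \<cdot> y \<oplus> (texp x [^]\<^bsub>UP A\<^esub> Suc n) p)" .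
  moreover have "(texp x [^]\<^bsub>UP A\<^esub> Suc n) i = dpow i ([Suc n] \<cdot> x)" if "i < p" for i
    using texp_mult_coeff_less[OF F, of x i] x that by (simp add: F_def)
  ultimately show ?case by simp
qed

lemma witt_smult_p:
  assumes "x \<in> carrier A" "y \<in> carrier A"
  shows "[p] \<cdot>\<^bsub>witt p A\<^esub> (x, y) = (\<zero>, x [^] p)"
  using witt_smult[OF assms, of p] texp_pow_top[of x] dvd_smult[of p] assms by simp

lemma witt_teichmueller_pow:
  assumes "x \<in> carrier A" shows "(x, \<zero>) [^]\<^bsub>witt p A\<^esub> (n::nat) = (x [^] n, \<zero>)"
proof -
  interpret W: cring "witt p A" by (rule witt_cring)
  show ?thesis using assms by (induction n) (auto simp: witt_simps)
qed

end

section \<open>Freeness over \<open>\<int>/p\<^sup>2\<close>\<close>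

lemma int_scalars_eq:
  "int_scalars A = \<lparr>carrier = carrier A, monoid.mult = monoid.mult A, one = one A, zero = zero A,
     add = add A, smult = (\<lambda>k x. [k] \<cdot>\<^bsub>A\<^esub> x)\<rparr>"
  unfolding int_scalars_def ring.extend_def module.fields_def by (rule refl)

lemma int_scalars_simps [simp]:
  "carrier (int_scalars A) = carrier A" "\<zero>\<^bsub>int_scalars A\<^esub> = \<zero>\<^bsub>A\<^esub>" "\<one>\<^bsub>int_scalars A\<^esub> = \<one>\<^bsub>A\<^esub>"
  "x \<oplus>\<^bsub>int_scalars A\<^esub> y = x \<oplus>\<^bsub>A\<^esub> y" "x \<otimes>\<^bsub>int_scalars A\<^esub> y = x \<otimes>\<^bsub>A\<^esub> y"
  "k \<odot>\<^bsub>int_scalars A\<^esub> x = [k] \<cdot>\<^bsub>A\<^esub> x"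
  by (simp_all add: int_scalars_eq)

lemma finsum_int_scalars [simp]: "finsum (int_scalars A) f B = finsum A f B"
  by (simp add: int_scalars_eq finsum_def finprod_def)

lemma cring_cong:
  assumes "cring R" "carrier S = carrier R" "monoid.mult S = monoid.mult R" "one S = one R"
    "zero S = zero R" "add S = add R"
  shows "cring S"
proof -
  interpret cring R by fact
  show ?thesis
  proof (rule cringI)
    show "abelian_group S"
      by (rule abelian_groupI, unfold assms(2-)) (auto simp: a_ac intro: l_neg)
    show "comm_monoid S"
      by (rule comm_monoidI, unfold assms(2-)) (auto simp: m_ac)
  qed (unfold assms(2-), simp add: l_distr)
qed

lemma cring_int_scalars: "cring (int_scalars A) \<longleftrightarrow> cring A"
  by (rule iffI; erule cring_cong) (simp_all add: int_scalars_eq)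

lemma (in abelian_group) int_smult_mod:
  assumes "[n] \<cdot> x = \<zero>" "x \<in> carrier G"
  shows "[(k mod int n)] \<cdot> x = [k] \<cdot> x"
proof -
  have "[(int n)] \<cdot> x = \<zero>" using assms by (simp add: add_pow_int_ge)
  then have "[(int n * (k div int n))] \<cdot> x = \<zero>"
    using assms by (metis add.int_pow_one add.int_pow_pow)
  then have "[(int n * (k div int n) + k mod int n)] \<cdot> x = [(k mod int n)] \<cdot> x"
    using assms by (simp only: add.int_pow_mult) simp
  then show ?thesis by simp
qed

lemma residue_ring_cring: "1 < n \<Longrightarrow> cring (residue_ring (int n))"
  using residues.cring[of "int n"] by (simp add: residues_def)

lemma zmod_algebraI:
  assumes A: "cring A" and n: "1 < n" "[n] \<cdot>\<^bsub>A\<^esub> \<one>\<^bsub>A\<^esub> = \<zero>\<^bsub>A\<^esub>"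
  shows "zmod_algebra n A"
proof -
  interpret cring A by fact
  interpret I: cring "int_scalars A" using A by (simp add: cring_int_scalars)
  have z: "[n] \<cdot>\<^bsub>A\<^esub> x = \<zero>\<^bsub>A\<^esub>" if "x \<in> carrier A" for x
    using that n add_pow_ldistr[of "\<one>\<^bsub>A\<^esub>" x n] by simp
  show ?thesis unfolding zmod_algebra_def
  proof (rule algebraI)
    show "cring (residue_ring (int n))" using n by (intro residue_ring_cring)
    show "cring (int_scalars A)" by unfold_locales
  qed (auto simp: residue_ring_def int_smult_mod z add.int_pow_mult add.int_pow_distrib
        add.int_pow_pow mult.commute add_pow_ldistr_int)
qed

lemma zmod_algebraD:
  assumes "zmod_algebra n A" "1 < n"
  shows "cring A" "[n] \<cdot>\<^bsub>A\<^esub> \<one>\<^bsub>A\<^esub> = \<zero>\<^bsub>A\<^esub>"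
proof -
  interpret I: algebra "residue_ring (int n)" "int_scalars A"
    using assms by (simp add: zmod_algebra_def)
  show "cring A" using assms(1) by (simp add: zmod_algebra_def algebra_def cring_int_scalars)
  then interpret cring A .
  \<comment> \<open>The scalar ring adds modulo n, so the scalars n - 1 and 1 add up to zero;
    distributivity over this sum is what forces n to vanish in \<open>A\<close>.\<close>
  have "[((int n - 1 + 1) mod int n)] \<cdot>\<^bsub>A\<^esub> \<one>\<^bsub>A\<^esub> = [(int n - 1)] \<cdot>\<^bsub>A\<^esub> \<one>\<^bsub>A\<^esub> \<oplus>\<^bsub>A\<^esub> [(1::int)] \<cdot>\<^bsub>A\<^esub> \<one>\<^bsub>A\<^esub>"
    using I.smult_l_distr[of "int n - 1" 1 "\<one>\<^bsub>A\<^esub>"] assms(2) by (simp add: residue_ring_def)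
  also have "\<dots> = [(int n)] \<cdot>\<^bsub>A\<^esub> \<one>\<^bsub>A\<^esub>" using add.int_pow_mult[of "\<one>\<^bsub>A\<^esub>" "int n - 1" 1] by simp
  finally show "[n] \<cdot>\<^bsub>A\<^esub> \<one>\<^bsub>A\<^esub> = \<zero>\<^bsub>A\<^esub>" by (simp add: add_pow_int_ge)
qed

section \<open>Bases from independence modulo p\<close>

text \<open>Coefficients are arbitrary integers and not residues, so combinations can be added,
  scaled and divided by p before anything is reduced modulo \<open>p^2\<close>.\<close>

definition lincomb :: "'a ring \<Rightarrow> 'a set \<Rightarrow> ('a \<Rightarrow> int) \<Rightarrow> 'a" where
  "lincomb A F c = (\<Oplus>\<^bsub>A\<^esub>b\<in>F. [c b] \<cdot>\<^bsub>A\<^esub> b)"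

locale abelian_p2_group = abelian_group A for A :: "'a ring" (structure) +
  fixes p :: nat
  assumes prime: "prime p" and p2: "x \<in> carrier A \<Longrightarrow> [(p ^ 2)] \<cdot> x = \<zero>"
begin

abbreviation "lc \<equiv> lincomb A"

lemma int_smult_0 [simp]: "[(0::int)] \<cdot> x = \<zero>"
  by (simp add: add_pow_int_ge)

lemma lc_closed [simp]: "F \<subseteq> carrier A \<Longrightarrow> lc F c \<in> carrier A"
  by (auto simp: lincomb_def intro!: finsum_closed)

lemma lc_add:
  assumes "F \<subseteq> carrier A"
  shows "lc F (\<lambda>b. c b + d b) = lc F c \<oplus> lc F d"
proof -
  have "lc F (\<lambda>b. c b + d b) = (\<Oplus>b\<in>F. [c b] \<cdot> b \<oplus> [d b] \<cdot> b)"
    unfolding lincomb_def using assms by (intro add.finprod_cong') (auto simp: add.int_pow_mult)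
  also have "\<dots> = lc F c \<oplus> lc F d"
    unfolding lincomb_def using assms by (intro finsum_addf) auto
  finally show ?thesis .
qed

lemma lc_smult:
  assumes "finite F" "F \<subseteq> carrier A"
  shows "lc F (\<lambda>b. k * c b) = [k] \<cdot> lc F c"
  using assms
proof (induction F)
  case empty then show ?case by (simp add: lincomb_def)
next
  case (insert x F)
  then have "(\<lambda>b. [f b] \<cdot> b) \<in> F \<rightarrow> carrier A" for f :: "'a \<Rightarrow> int" by auto
  then show ?case using insert lc_closed[of F]
    by (simp add: lincomb_def add.int_pow_distrib add.int_pow_pow mult.commute[of k])
qed

lemma lc_cong:
  assumes "F \<subseteq> carrier A" "\<And>b. b \<in> F \<Longrightarrow> [c b] \<cdot> b = [d b] \<cdot> b" 
  shows "lc F c = lc F d"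
  unfolding lincomb_def using assms by (intro add.finprod_cong') auto

lemma lc_mono:
  assumes "finite G" "F \<subseteq> G" "G \<subseteq> carrier A" "\<And>b. b \<in> G - F \<Longrightarrow> c b = 0"
  shows "lc F c = lc G c"
  unfolding lincomb_def using assms by (intro add.finprod_mono_neutral_cong_left) auto

lemma lc_insert:
  assumes "finite F" "F \<subseteq> carrier A" "x \<in> carrier A" "x \<notin> F"
  shows "lc (insert x F) c = [c x] \<cdot> x \<oplus> lc F c"
  unfolding lincomb_def using assms by (intro finsum_insert) auto

lemma int_p2: "x \<in> carrier A \<Longrightarrow> [(k mod (int p)\<^sup>2)] \<cdot> x = [k] \<cdot> x"
  using int_smult_mod[of "p ^ 2" x k] p2 by simp

text \<open>Linear independence over the field with p elements of the classes of \<open>B\<close> in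
  \<open>A/pA\<close>, phrased with lifts so that the quotient need not be formed.\<close>

definition indep :: "'a set \<Rightarrow> bool" where
  "indep B \<longleftrightarrow> B \<subseteq> carrier A \<and> (\<forall>F c y. finite F \<and> F \<subseteq> B \<and> y \<in> carrier A \<and> lc F c = [(int p)] \<cdot> y
      \<longrightarrow> (\<forall>b\<in>F. int p dvd c b))"

lemma indepD:
  "indep B \<Longrightarrow> finite F \<Longrightarrow> F \<subseteq> B \<Longrightarrow> y \<in> carrier A \<Longrightarrow> lc F c = [(int p)] \<cdot> y \<Longrightarrow> b \<in> F \<Longrightarrow> int p dvd c b"
  unfolding indep_def by blast

lemma maximal_indep: "\<exists>B. indep B \<and> (\<forall>C. indep C \<and> B \<subseteq> C \<longrightarrow> C = B)"
proof -
  have "\<exists>B\<in>Collect indep. \<forall>X\<in>Collect indep. B \<subseteq> X \<longrightarrow> X = B"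
  proof (rule subset_Zorn_nonempty)
    show "Collect indep \<noteq> {}" by (auto simp: indep_def intro!: exI[of _ "{}"])
    fix C assume C: "C \<noteq> {}" "subset.chain (Collect indep) C"
    have "indep (\<Union>C)" unfolding indep_def
    proof (intro conjI allI impI)
      have "indep X" if "X \<in> C" for X using that C by (auto simp: subset_chain_def)
      then have "X \<subseteq> carrier A" if "X \<in> C" for X using that by (simp add: indep_def)
      then show "\<Union>C \<subseteq> carrier A" by blast
      fix F c y assume F: "finite F \<and> F \<subseteq> \<Union>C \<and> y \<in> carrier A \<and> lc F c = [(int p)] \<cdot> y"
      then obtain X where "X \<in> C" "F \<subseteq> X"
        using finite_subset_Union_chain[of F C "Collect indep"] C by blast
      then show "\<forall>b\<in>F. int p dvd c b" using indepD[of X F y c] C F by (auto simp: subset_chain_def)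
    qed
    then show "\<Union>C \<in> Collect indep" by simp
  qed
  then show ?thesis by auto
qed

text \<open>Exchange argument in the vector space \<open>A/pA\<close>: if \<open>x\<close> is not in
  \<open>B\<close>, maximality puts it into a nontrivial relation modulo p, where its coefficient is
  prime to p, so the relation can be solved for \<open>x\<close>.\<close>

lemma indep_span:
  assumes B: "indep B" and max: "\<And>C. indep C \<Longrightarrow> B \<subseteq> C \<Longrightarrow> C = B" and x: "x \<in> carrier A"
  shows "\<exists>F c y. finite F \<and> F \<subseteq> B \<and> y \<in> carrier A \<and> x = lc F c \<oplus> [(int p)] \<cdot> y"
proof (cases "x \<in> B")
  case True
  then show ?thesis using x
    by (intro exI[of _ "{x}"] exI[of _ "\<lambda>_. 1"] exI[of _ \<zero>]) (simp add: lincomb_def)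
next
  case False
  then have "\<not> indep (insert x B)" using max by blast
  then obtain F c y b where F: "finite F" "F \<subseteq> insert x B" and y: "y \<in> carrier A"
    and eq: "lc F c = [(int p)] \<cdot> y" and b: "b \<in> F" "\<not> int p dvd c b"
    using x B by (auto simp: indep_def)
  define F' where "F' = F - {x}"
  have F': "finite F'" "F' \<subseteq> B" "x \<notin> F'" using F by (auto simp: F'_def)
  have Bc: "B \<subseteq> carrier A" using B by (simp add: indep_def)
  then have F'c: "F' \<subseteq> carrier A" using F' by auto
  have xF: "x \<in> F" using indepD[OF B F(1) _ y eq b(1)] F b(2) by blast
  then have FF: "F = insert x F'" by (auto simp: F'_def)
  have eq2: "[c x] \<cdot> x \<oplus> lc F' c = [(int p)] \<cdot> y"
    using eq lc_insert[OF F'(1) F'c x F'(3), of c] FF by simp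
  \<comment> \<open>Otherwise the term of \<open>x\<close> moves into the multiple of p, and what
    remains is a relation inside \<open>B\<close> that contradicts independence.\<close>
  have "\<not> int p dvd c x"
  proof
    assume dvd: "int p dvd c x"
    then obtain k where k: "c x = k * int p" by (metis dvdE mult.commute)
    have "lc F' c = [(int p)] \<cdot> y \<ominus> [c x] \<cdot> x"
      using eq2 F'c x y by (metis a_minus_def add.int_pow_closed add.inv_solve_left' a_comm lc_closed minus_closed a_inv_closed)
    also have "\<dots> = [(int p)] \<cdot> (y \<ominus> [k] \<cdot> x)"
      using x y by (simp add: k a_minus_def add.int_pow_distrib add.int_pow_inv add.int_pow_pow)
    finally have "\<forall>b\<in>F'. int p dvd c b"
      using indepD[OF B F'(1,2)] x y by (metis add.int_pow_closed minus_closed)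
    then show False using b dvd FF by auto
  qed
  then have "coprime (c x) (int p)"
    using prime by (metis coprime_commute prime_imp_coprime prime_nat_int_transfer)
  then obtain a k where ak: "a * c x + k * int p = 1"
    by (metis bezout_int coprime_imp_gcd_eq_1)
  \<comment> \<open>Here \<open>a\<close> inverts \<open>c x\<close> modulo p; replacing
    \<open>[c x] \<cdot> x\<close> by means of the relation expresses \<open>x\<close> through
    \<open>F'\<close> up to a multiple of p.\<close>
  have "x = [(c x * a + k * int p)] \<cdot> x" using ak x by (simp add: mult.commute)
  also have "\<dots> = [a] \<cdot> ([c x] \<cdot> x) \<oplus> [(int p)] \<cdot> ([k] \<cdot> x)"
    using x by (simp add: add.int_pow_mult add.int_pow_pow)
  also have "[c x] \<cdot> x = [(int p)] \<cdot> y \<ominus> lc F' c"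
    using eq2 F'c x y by (metis a_minus_def add.int_pow_closed add.inv_solve_right lc_closed)
  also have "[a] \<cdot> ([(int p)] \<cdot> y \<ominus> lc F' c) \<oplus> [(int p)] \<cdot> ([k] \<cdot> x)
     = lc F' (\<lambda>b. (- a) * c b) \<oplus> [(int p)] \<cdot> ([a] \<cdot> y \<oplus> [k] \<cdot> x)"
    unfolding lc_smult[OF F'(1) F'c] using x y F'c
    by (simp add: a_minus_def add.int_pow_distrib add.int_pow_inv add.int_pow_pow add.int_pow_neg mult.commute a_ac)
  finally show ?thesis using F' x y
    by (intro exI[of _ F'] exI[of _ "\<lambda>b. (- a) * c b"] exI[of _ "[a] \<cdot> y \<oplus> [k] \<cdot> x"]) auto
qed

text \<open>Nakayama's argument for the nilpotent ideal generated by p: expanding the remainder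
  \<open>y\<close> once more leaves \<open>p^2 z\<close>, which is zero.\<close>

lemma indep_span_lc:
  assumes B: "indep B" and max: "\<And>C. indep C \<Longrightarrow> B \<subseteq> C \<Longrightarrow> C = B" and x: "x \<in> carrier A"
  shows "\<exists>F c. finite F \<and> F \<subseteq> B \<and> x = lc F c"
proof -
  have Bc: "B \<subseteq> carrier A" using B by (simp add: indep_def)
  obtain F c y where 1: "finite F" "F \<subseteq> B" "y \<in> carrier A" "x = lc F c \<oplus> [(int p)] \<cdot> y"
    using indep_span[OF assms] by blast
  obtain G d z where 2: "finite G" "G \<subseteq> B" "z \<in> carrier A" "y = lc G d \<oplus> [(int p)] \<cdot> z"
    using indep_span[OF B max 1(3)] by blast
  define H where "H = F \<union> G"
  have H: "finite H" "H \<subseteq> B" "H \<subseteq> carrier A" using 1 2 Bc by (auto simp: H_def)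
  define c' where "c' b = (if b \<in> F then c b else 0)" for b
  define d' where "d' b = (if b \<in> G then d b else 0)" for b
  have c': "lc F c = lc H c'"
  proof -
    have "lc F c = lc F c'" using 1 Bc by (intro lc_cong) (auto simp: c'_def)
    also have "\<dots> = lc H c'" using H by (intro lc_mono) (auto simp: H_def c'_def)
    finally show ?thesis .
  qed
  have d': "lc G d = lc H d'"
  proof -
    have "lc G d = lc G d'" using 2 Bc by (intro lc_cong) (auto simp: d'_def)
    also have "\<dots> = lc H d'" using H by (intro lc_mono) (auto simp: H_def d'_def)
    finally show ?thesis .
  qed
  have "[(int p)] \<cdot> ([(int p)] \<cdot> z) = \<zero>"
    using p2[OF 2(3)] 2(3) by (simp add: add.nat_pow_pow power2_eq_square add_pow_int_ge)
  then have "[(int p)] \<cdot> y = lc H (\<lambda>b. int p * d' b)"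
    using 2 H by (simp add: d' lc_smult add.int_pow_distrib)
  then have "x = lc H (\<lambda>b. c' b + int p * d' b)"
    using 1 H by (simp add: c' lc_add)
  then show ?thesis using H by blast
qed

text \<open>Existence reduces integer coefficients modulo \<open>p^2\<close>. For uniqueness,
  independence is applied twice: differences of coefficients are divisible by p; flatness then turns
  the vanishing of p times the combination of quotients into a relation modulo p, and so the
  quotients are divisible by p as well.\<close>

lemma basis_if_indep:
  assumes flat: "\<And>x. x \<in> carrier A \<Longrightarrow> [(int p)] \<cdot> x = \<zero> \<Longrightarrow> \<exists>y\<in>carrier A. x = [(int p)] \<cdot> y"
    and B: "indep B" and max: "\<And>C. indep C \<Longrightarrow> B \<subseteq> C \<Longrightarrow> C = B"
  shows "is_basis (residue_ring (int (p ^ 2))) (int_scalars A) B"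
proof -
  have Bc: "B \<subseteq> carrier A" using B by (simp add: indep_def)
  have p0: "0 < p" using prime prime_gt_0_nat by blast
  let ?q = "int (p ^ 2)"
  have q0: "0 < ?q" using p0 by simp
  define P where "P x c \<longleftrightarrow> c \<in> B \<rightarrow>\<^sub>E {0..?q - 1} \<and> finite {b\<in>B. c b \<noteq> 0} \<and> x = lc {b\<in>B. c b \<noteq> 0} c" for x c
  have ex: "\<exists>c. P x c" if x: "x \<in> carrier A" for x
  proof -
    obtain F c where F: "finite F" "F \<subseteq> B" "x = lc F c" using indep_span_lc[OF B max x] by blast
    define d where "d = (\<lambda>b\<in>B. if b \<in> F then c b mod ?q else 0)"
    have Fc: "F \<subseteq> carrier A" using F Bc by auto
    have sub: "{b\<in>B. d b \<noteq> 0} \<subseteq> F" by (auto simp: d_def)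
    have "x = lc F d" unfolding F(3)
      by (rule lc_cong) (use F Fc in \<open>auto simp: d_def int_p2 subset_iff\<close>)
    also have "\<dots> = lc {b\<in>B. d b \<noteq> 0} d"
      by (rule lc_mono[symmetric]) (use F Fc sub in auto)
    finally have "x = lc {b\<in>B. d b \<noteq> 0} d" .
    moreover have "d \<in> B \<rightarrow>\<^sub>E {0..?q - 1}" using q0 by (auto simp: d_def)
    ultimately show ?thesis using sub F(1) finite_subset unfolding P_def by blast
  qed
  have uniq: "c = d" if "P x c" "P x d" for x c d
  proof -
    define H where "H = {b\<in>B. c b \<noteq> 0} \<union> {b\<in>B. d b \<noteq> 0}"
    have H: "finite H" "H \<subseteq> B" "H \<subseteq> carrier A" using that Bc by (auto simp: H_def P_def)
    have "lc {b\<in>B. c b \<noteq> 0} c = lc H c" "lc {b\<in>B. d b \<noteq> 0} d = lc H d"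
      by (rule lc_mono; use H(1,3) H(2) in \<open>force simp: H_def\<close>)+
    moreover have "x = lc {b\<in>B. c b \<noteq> 0} c" "x = lc {b\<in>B. d b \<noteq> 0} d"
      using that unfolding P_def by blast+
    ultimately have xx: "lc H c = lc H d" by simp
    have "lc H (\<lambda>b. c b + (- 1) * d b) = lc H c \<oplus> [(-1::int)] \<cdot> lc H d"
      using H lc_add[OF H(3), of c "\<lambda>b. (- 1) * d b"] lc_smult[OF H(1,3), of "-1" d] by simp
    also have "\<dots> = \<zero>" using H by (simp add: xx add.int_pow_neg r_neg)
    finally have eq0: "lc H (\<lambda>b. c b + (- 1) * d b) = \<zero>" .
    then have dvd: "int p dvd c b + (- 1) * d b" if "b \<in> H" for b
      using indepD[OF B H(1,2) zero_closed, of "\<lambda>b. c b + (- 1) * d b"] that by simp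
    define e where "e b = (c b + (- 1) * d b) div int p" for b
    have e: "c b + (- 1) * d b = int p * e b" if "b \<in> H" for b
      using dvd[OF that] by (simp add: e_def)
    have "[(int p)] \<cdot> lc H e = lc H (\<lambda>b. int p * e b)" using H by (simp add: lc_smult)
    also have "\<dots> = lc H (\<lambda>b. c b + (- 1) * d b)" using H e by (intro lc_cong) auto
    finally have "[(int p)] \<cdot> lc H e = \<zero>" using eq0 by simp
    then obtain y where "y \<in> carrier A" "lc H e = [(int p)] \<cdot> y" using flat H by (meson lc_closed)
    from indepD[OF B H(1,2) this] have "int p dvd e b" if "b \<in> H" for b using that by blast
    then have dvd: "?q dvd c b - d b" if "b \<in> H" for b
      using e[OF that] that by (auto simp: power2_eq_square)
    show "c = d"
    proof
      fix b
      consider "b \<notin> B" | "b \<in> H" | "b \<in> B - H" by blast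
      then show "c b = d b"
      proof cases
        case 1 then show ?thesis using that by (auto simp: P_def PiE_def extensional_def)
      next
        case 2
        then have "c b \<in> {0..?q - 1}" "d b \<in> {0..?q - 1}" using that H unfolding P_def by auto
        then show ?thesis using dvd[OF 2] by (auto simp: mod_eq_dvd_iff[symmetric])
      next
        case 3 then show ?thesis by (auto simp: H_def)
      qed
    qed
  qed
  show ?thesis unfolding is_basis_def
  proof (intro conjI ballI)
    fix x assume "x \<in> carrier (int_scalars A)"
    then have "\<exists>!c. P x c" using ex uniq by (metis int_scalars_simps(1))
    then show "\<exists>!c. c \<in> B \<rightarrow>\<^sub>E carrier (residue_ring ?q) \<and> finite {b \<in> B. c b \<noteq> \<zero>\<^bsub>residue_ring ?q\<^esub>} \<and>
        x = (\<Oplus>\<^bsub>int_scalars A\<^esub>b\<in>{b \<in> B. c b \<noteq> \<zero>\<^bsub>residue_ring ?q\<^esub>}. c b \<odot>\<^bsub>int_scalars A\<^esub> b)"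
      by (simp add: P_def residue_ring_def lincomb_def)
  qed (use Bc in simp)
qed

text \<open>Multiplying the coordinates of \<open>x\<close> by p gives an expansion of zero, which
  uniqueness identifies with the trivial one. So \<open>p^2\<close> divides p times each coordinate,
  and p divides the coordinate.\<close>

lemma flat_if_basis:
  assumes "is_basis (residue_ring (int (p ^ 2))) (int_scalars A) B"
    and x: "x \<in> carrier A" and px: "[(int p)] \<cdot> x = \<zero>"
  shows "\<exists>y\<in>carrier A. x = [(int p)] \<cdot> y"
proof -
  have p0: "0 < p" using prime prime_gt_0_nat by blast
  let ?q = "int (p ^ 2)"
  have q0: "0 < ?q" using p0 by simp
  have Bc: "B \<subseteq> carrier A" using assms by (simp add: is_basis_def)
  define P where "P x c \<longleftrightarrow> c \<in> B \<rightarrow>\<^sub>E {0..?q - 1} \<and> finite {b\<in>B. c b \<noteq> 0} \<and> x = lc {b\<in>B. c b \<noteq> 0} c" for x c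
  have P: "\<exists>!c. P x c" if "x \<in> carrier A" for x
    using that assms(1) by (simp add: is_basis_def P_def residue_ring_def lincomb_def)
  obtain c where c: "P x c" using P[OF x] by blast
  define S where "S = {b\<in>B. c b \<noteq> 0}"
  have S: "finite S" "S \<subseteq> B" "S \<subseteq> carrier A" "x = lc S c" using c Bc by (auto simp: P_def S_def)
  define d where "d = (\<lambda>b\<in>B. (int p * c b) mod ?q)"
  have sub: "{b\<in>B. d b \<noteq> 0} \<subseteq> S" by (auto simp: d_def S_def)
  have "\<zero> = lc S (\<lambda>b. int p * c b)" using S px by (simp add: lc_smult)
  also have "\<dots> = lc S d"
    by (rule lc_cong) (use S in \<open>auto simp: d_def int_p2 subset_iff\<close>)
  also have "\<dots> = lc {b\<in>B. d b \<noteq> 0} d"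
    by (rule lc_mono[symmetric]) (use S sub in auto)
  finally have lcd: "\<zero> = lc {b\<in>B. d b \<noteq> 0} d" .
  have "d \<in> B \<rightarrow>\<^sub>E {0..?q - 1}" using q0 by (auto simp: d_def)
  moreover have "finite {b\<in>B. d b \<noteq> 0}" using finite_subset[OF sub S(1)] .
  ultimately have "P \<zero> d" using lcd unfolding P_def by blast
  moreover have "P \<zero> (\<lambda>b\<in>B. 0)"
  proof -
    have "{b \<in> B. (\<lambda>b\<in>B. 0::int) b \<noteq> 0} = {}" by auto
    then show ?thesis unfolding P_def using q0 by (simp add: lincomb_def)
  qed
  ultimately have d0: "d = (\<lambda>b\<in>B. 0)" using P[OF zero_closed] by blast
  have "int p dvd c b" if "b \<in> S" for b
  proof -
    have "(int p * c b) mod ?q = 0" using d0 that S by (auto simp: d_def fun_eq_iff split: if_splits)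
    then have "int p * int p dvd int p * c b" by (simp add: power2_eq_square mod_eq_0_iff_dvd)
    then show ?thesis using p0 by simp
  qed
  then have "lc S c = lc S (\<lambda>b. int p * (c b div int p))"
    using S by (intro lc_cong) auto
  then have "x = [(int p)] \<cdot> lc S (\<lambda>b. c b div int p)" using S by (simp add: lc_smult)
  with S(3) show ?thesis by (intro bexI[of _ "lc S (\<lambda>b. c b div int p)"]) auto
qed

text \<open>The right side is the ideal criterion for flatness over \<open>Z/p^2\<close>, whose only
  ideal besides zero and the whole ring is generated by p. It replaces bases in all later
  arguments.\<close>

lemma free_iff_flat:
  "(\<exists>B. is_basis (residue_ring (int (p ^ 2))) (int_scalars A) B) \<longleftrightarrow>
   (\<forall>x\<in>carrier A. [p] \<cdot> x = \<zero> \<longrightarrow> (\<exists>y\<in>carrier A. x = [p] \<cdot> y))"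
proof -
  have int: "[(int p)] \<cdot> x = [p] \<cdot> x" for x by (simp add: add_pow_int_ge)
  show ?thesis
  proof (intro iffI ballI impI; (elim exE)?)
    fix B x assume "is_basis (residue_ring (int (p ^ 2))) (int_scalars A) B" "x \<in> carrier A" "[p] \<cdot> x = \<zero>"
    from flat_if_basis[OF this(1,2)] this(3) show "\<exists>y\<in>carrier A. x = [p] \<cdot> y" by (simp add: int)
  next
    assume flat: "\<forall>x\<in>carrier A. [p] \<cdot> x = \<zero> \<longrightarrow> (\<exists>y\<in>carrier A. x = [p] \<cdot> y)"
    obtain B where "indep B" "\<And>C. indep C \<Longrightarrow> B \<subseteq> C \<Longrightarrow> C = B" using maximal_indep by blast
    from basis_if_indep[OF _ this] flat
    show "\<exists>B. is_basis (residue_ring (int (p ^ 2))) (int_scalars A) B" unfolding int by blast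
  qed
qed

end

section \<open>Wrinkled rings as ideals of Witt vectors\<close>

context fp_algebra
begin

lemma frob_ker_iff: "x \<in> frob_ker p A \<longleftrightarrow> x \<in> carrier A \<and> x [^] p = \<zero>"
  by (simp add: frob_ker_def a_kernel_def kernel_def frob_def)

text \<open>The end indices give the two values of \<gamma> and the middle ones the cocycle. In this
  form the sum axiom says that the graph of \<gamma> is closed under Witt addition.\<close>

lemma sum_div_pow:
  assumes "\<gamma> x \<in> carrier A" "\<gamma> y \<in> carrier A" "x \<in> carrier A" "y \<in> carrier A"
  shows "(\<Oplus>i\<in>{0..p}. div_pow p A \<gamma> i x \<otimes> div_pow p A \<gamma> (p - i) y) = \<gamma> x \<oplus> \<gamma> y \<oplus> cocycle x y"
proof -
  have S: "{0..p} = insert 0 (insert p {0<..<p})" by auto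
  have D: "div_pow p A g 0 u = \<one>" "div_pow p A g p u = g u" if "u \<in> carrier A" for g u
    using dpow_0[OF that] by (simp_all add: div_pow_def)
  have mid: "div_pow p A \<gamma> i u = dpow i u" if "i \<in> {0<..<p}" for i u
    using that by (simp add: div_pow_def)
  define M where "M = (\<Oplus>i\<in>{0<..<p}. dpow i x \<otimes> dpow (p - i) y)"
  have M: "M \<in> carrier A" using assms by (auto simp: M_def intro!: finsum_closed)
  \<comment> \<open>Proved for a variable map \<open>g\<close>: the zero map evaluates the cocycle
    and \<gamma> evaluates the axiom, with the same middle sum \<open>M\<close>.\<close>
  have eq: "(\<Oplus>i\<in>{0..p}. div_pow p A g i x \<otimes> div_pow p A g (p - i) y) = g y \<oplus> (g x \<oplus> M)"
    if g: "g x \<in> carrier A" "g y \<in> carrier A" and gm: "\<And>i u. i \<in> {0<..<p} \<Longrightarrow> div_pow p A g i u = dpow i u" for g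
  proof -
    have "(\<Oplus>i\<in>{0<..<p}. div_pow p A g i x \<otimes> div_pow p A g (p - i) y) = M"
      unfolding M_def using assms by (intro add.finprod_cong') (auto simp: gm)
    moreover have "(\<lambda>i. div_pow p A g i x \<otimes> div_pow p A g (p - i) y) \<in> {0<..<p} \<rightarrow> carrier A"
      using assms by (auto simp: gm)
    ultimately show ?thesis unfolding S using assms g M by (simp add: D)
  qed
  have "cocycle x y = M"
    using eq[of "\<lambda>_. \<zero>"] M by (simp add: cocycle_def atLeast0AtMost div_pow_def)
  then show ?thesis using eq[of \<gamma>, OF _ _ mid] assms M by (simp add: a_ac)
qed

end

definition wrinkle_ideal :: "nat \<Rightarrow> 'a ring \<Rightarrow> ('a \<Rightarrow> 'a) \<Rightarrow> ('a \<times> 'a) set" where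
  "wrinkle_ideal p A \<gamma> = (\<lambda>x. (x, \<gamma> x)) ` frob_ker p A"

context fp_algebra
begin

lemma wrinkle_ideal_iff:
  "(x, y) \<in> wrinkle_ideal p A \<gamma> \<longleftrightarrow> x \<in> carrier A \<and> x [^] p = \<zero> \<and> y = \<gamma> x"
  by (auto simp: wrinkle_ideal_def frob_ker_iff)

text \<open>Closure of the graph under addition is the sum axiom. Closure under multiplication is
  the scaling axiom, because the product of \<open>(a, b)\<close> and \<open>(x, \<gamma> x)\<close>
  has second component \<open>a^p \<gamma>(x) + x^p b\<close>, and \<open>x^p = 0\<close>.\<close>

lemma two_wrinkled_iff:
  assumes "zmod_algebra p A"
  shows "two_wrinkled p (A, \<gamma>) \<longleftrightarrow> (\<forall>y\<in>carrier A. \<exists>x\<in>carrier A. x [^] p = y) \<and>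
    ideal (wrinkle_ideal p A \<gamma>) (witt p A)"
    (is "_ \<longleftrightarrow> ?frob \<and> ?ideal")
proof -
  interpret W: cring "witt p A" by (rule witt_cring)
  have frob: "frob p A ` carrier A = carrier A \<longleftrightarrow> ?frob"
  proof -
    have "frob p A ` carrier A \<subseteq> carrier A" by (auto simp: frob_def)
    then have "frob p A ` carrier A = carrier A \<longleftrightarrow> carrier A \<subseteq> frob p A ` carrier A" by blast
    also have "\<dots> \<longleftrightarrow> (\<forall>y\<in>carrier A. \<exists>x\<in>carrier A. y = x [^] p)" by (auto simp: subset_iff frob_def)
    finally show ?thesis by (simp only: eq_commute)
  qed
  have kernel: "x \<in> frob_ker p A \<Longrightarrow> x \<in> carrier A" for x by (simp add: frob_ker_iff)
  have closed: "a \<otimes> x \<in> frob_ker p A" if "a \<in> carrier A" "x \<in> frob_ker p A" for a x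
    using that by (simp add: frob_ker_iff nat_pow_distrib)
  have sum: "x \<oplus> y \<in> frob_ker p A" if "x \<in> frob_ker p A" "y \<in> frob_ker p A" for x y
    using that by (simp add: frob_ker_iff frob_add)
  have z: "\<zero> \<in> frob_ker p A" by (simp add: frob_ker_iff nat_pow_zero)
  define g1 where "g1 \<longleftrightarrow> \<gamma> \<in> frob_ker p A \<rightarrow> carrier A"
  define g2 where "g2 \<longleftrightarrow> (\<forall>a\<in>carrier A. \<forall>x\<in>frob_ker p A. \<gamma> (a \<otimes> x) = (a [^] p) \<otimes> \<gamma> x)"
  define g3 where "g3 \<longleftrightarrow> (\<forall>x\<in>frob_ker p A. \<forall>x'\<in>frob_ker p A. \<gamma> (x \<oplus> x') = \<gamma> x \<oplus> \<gamma> x' \<oplus> cocycle x x')"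
  have "two_wrinkled p (A, \<gamma>) \<longleftrightarrow> ?frob \<and> g1 \<and> g2 \<and> g3"
  \<comment> \<open>\<open>sum_div_pow\<close> applies only when \<gamma> takes values in the
    carrier; if it does not, both sides fail at that very condition.\<close>
  proof (cases g1)
    case True
    then have "\<gamma> x \<in> carrier A" if "x \<in> frob_ker p A" for x using that by (auto simp: g1_def)
    then show ?thesis
      using assms frob kernel True by (simp add: two_wrinkled_def g1_def[symmetric] g2_def g3_def sum_div_pow)
  next
    case False then show ?thesis by (simp add: two_wrinkled_def g1_def)
  qed
  also have "\<dots> \<longleftrightarrow> ?frob \<and> ?ideal"
  proof (intro conj_cong refl iffI)
    assume g: "g1 \<and> g2 \<and> g3"
    have \<gamma>: "\<gamma> x \<in> carrier A" if "x \<in> frob_ker p A" for x using that g by (auto simp: g1_def)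
    let ?I = "wrinkle_ideal p A \<gamma>"
    have mult: "u \<otimes>\<^bsub>witt p A\<^esub> v \<in> ?I" if u: "u \<in> ?I" and v: "v \<in> carrier (witt p A)" for u v
    proof -
      obtain x where x: "x \<in> frob_ker p A" "u = (x, \<gamma> x)" using u by (auto simp: wrinkle_ideal_def)
      obtain a b where ab: "v = (a, b)" "a \<in> carrier A" "b \<in> carrier A" using v by (auto simp: witt_simps)
      have "u \<otimes>\<^bsub>witt p A\<^esub> v = (a \<otimes> x, \<gamma> (a \<otimes> x))"
        using x ab g \<gamma>[OF x(1)] by (simp add: witt_simps g2_def frob_ker_iff m_comm)
      then show ?thesis using closed[OF ab(2) x(1)] by (simp add: wrinkle_ideal_def)
    qed
    have carr: "?I \<subseteq> carrier (witt p A)" using \<gamma> kernel by (auto simp: wrinkle_ideal_def witt_simps)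
    show ?ideal
    proof (rule idealI)
      show "ring (witt p A)" by unfold_locales
      show "subgroup ?I (add_monoid (witt p A))"
      proof (rule W.add.subgroupI)
        show "?I \<subseteq> carrier (witt p A)" by (rule carr)
        show "?I \<noteq> {}" using z by (auto simp: wrinkle_ideal_def)
        fix u v assume uv: "u \<in> ?I" "v \<in> ?I"
        \<comment> \<open>A negative is a product with minus one, so the closure under
          multiplication shown above covers it.\<close>
        have "\<ominus>\<^bsub>witt p A\<^esub> u = u \<otimes>\<^bsub>witt p A\<^esub> (\<ominus>\<^bsub>witt p A\<^esub> \<one>\<^bsub>witt p A\<^esub>)"
          using uv carr by (auto simp: W.r_minus)
        then show "\<ominus>\<^bsub>witt p A\<^esub> u \<in> ?I" using mult[OF uv(1)] by simp
        show "u \<oplus>\<^bsub>witt p A\<^esub> v \<in> ?I"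
        proof -
          obtain x y where "x \<in> frob_ker p A" "u = (x, \<gamma> x)" "y \<in> frob_ker p A" "v = (y, \<gamma> y)"
            using uv by (auto simp: wrinkle_ideal_def)
          moreover from this have "u \<oplus>\<^bsub>witt p A\<^esub> v = (x \<oplus> y, \<gamma> (x \<oplus> y))"
            using g by (simp add: witt_simps g3_def)
          ultimately show ?thesis using sum by (simp add: wrinkle_ideal_def)
        qed
      qed
      fix u v assume uv: "u \<in> ?I" "v \<in> carrier (witt p A)"
      show "u \<otimes>\<^bsub>witt p A\<^esub> v \<in> ?I" using mult[OF uv] .
      then show "v \<otimes>\<^bsub>witt p A\<^esub> u \<in> ?I" using uv carr W.m_comm[of v u] by auto
    qed
  next
    assume ?ideal
    then interpret I: ideal "wrinkle_ideal p A \<gamma>" "witt p A" .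
    have mem: "(x, \<gamma> x) \<in> wrinkle_ideal p A \<gamma>" if "x \<in> frob_ker p A" for x
      using that by (auto simp: wrinkle_ideal_def)
    have \<gamma>: "\<gamma> x \<in> carrier A" if "x \<in> frob_ker p A" for x
      using I.Icarr[OF mem[OF that]] by (simp add: witt_simps)
    have g1 using \<gamma> by (auto simp: g1_def)
    moreover have g2 unfolding g2_def
    proof (intro ballI)
      fix a x assume ax: "a \<in> carrier A" "x \<in> frob_ker p A"
      have "(a, \<zero>) \<otimes>\<^bsub>witt p A\<^esub> (x, \<gamma> x) \<in> wrinkle_ideal p A \<gamma>"
        by (rule I.I_l_closed[OF mem]) (use ax in \<open>auto simp: witt_simps\<close>)
      then show "\<gamma> (a \<otimes> x) = a [^] p \<otimes> \<gamma> x"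
        using ax \<gamma>[OF ax(2)] by (simp add: witt_simps wrinkle_ideal_iff frob_ker_iff)
    qed
    moreover have g3 unfolding g3_def
    proof (intro ballI)
      fix x y assume xy: "x \<in> frob_ker p A" "y \<in> frob_ker p A"
      have "(x, \<gamma> x) \<oplus>\<^bsub>witt p A\<^esub> (y, \<gamma> y) \<in> wrinkle_ideal p A \<gamma>"
        by (rule I.a_closed[OF mem mem]) (use xy in auto)
      then show "\<gamma> (x \<oplus> y) = \<gamma> x \<oplus> \<gamma> y \<oplus> cocycle x y"
        by (simp add: witt_simps wrinkle_ideal_iff)
    qed
    ultimately show "g1 \<and> g2 \<and> g3" by blast
  qed
  finally show ?thesis .
qed

end

lemma (in ring_hom_cring) hom_nat_smult:
  "x \<in> carrier R \<Longrightarrow> h ([(n::nat)] \<cdot>\<^bsub>R\<^esub> x) = [n] \<cdot>\<^bsub>S\<^esub> h x"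
  by (induction n) simp_all

text \<open>The cocycle is a formula with denominators prime to p, and \<open>h\<close> respects it:
  inverses of factorials are compared after multiplication by the unit i! of
  \<open>B\<close>.\<close>

lemma witt_map_hom:
  assumes A: "fp_algebra A p" and B: "fp_algebra B p" and h: "h \<in> ring_hom A B"
  shows "map_prod h h \<in> ring_hom (witt p A) (witt p B)"
proof -
  interpret A: fp_algebra A p by fact
  interpret B: fp_algebra B p by fact
  interpret h: ring_hom_cring A B h using h by (unfold_locales) auto
  have dpow: "h (A.dpow i x) = B.dpow i (h x)" if x: "x \<in> carrier A" for i x
  proof (cases "i < p")
    case True
    have "([(fact i :: nat)] \<cdot>\<^bsub>B\<^esub> \<one>\<^bsub>B\<^esub>) \<otimes>\<^bsub>B\<^esub> h (A.dpow i x) = h (([(fact i :: nat)] \<cdot>\<^bsub>A\<^esub> \<one>\<^bsub>A\<^esub>) \<otimes>\<^bsub>A\<^esub> A.dpow i x)"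
      using x by (simp add: h.hom_nat_smult)
    also have "\<dots> = ([(fact i :: nat)] \<cdot>\<^bsub>B\<^esub> \<one>\<^bsub>B\<^esub>) \<otimes>\<^bsub>B\<^esub> B.dpow i (h x)"
      using x True by (simp only: A.fact_dpow B.fact_dpow h.hom_closed h.ring.hom_nat_pow)
    finally show ?thesis using x True B.fact_unit by (intro B.unit_cancel[of _ "h (A.dpow i x)"]) auto
  qed (simp add: A.dpow_ge B.dpow_ge)
  have cocycle: "h (A.cocycle x y) = B.cocycle (h x) (h y)" if "x \<in> carrier A" "y \<in> carrier A" for x y
  proof -
    have "h (A.cocycle x y) = (\<Oplus>\<^bsub>B\<^esub>i\<in>{..p}. h (A.dpow i x \<otimes>\<^bsub>A\<^esub> A.dpow (p - i) y))"
      unfolding A.cocycle_def using that by (simp add: h.hom_finsum o_def Pi_def)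
    also have "\<dots> = B.cocycle (h x) (h y)"
      unfolding B.cocycle_def using that by (intro B.add.finprod_cong') (auto simp: dpow)
    finally show ?thesis .
  qed
  show ?thesis
    by (rule ring_hom_memI) (auto simp: A.witt_simps B.witt_simps cocycle h.ring.hom_nat_pow)
qed

section \<open>The ghost map of a \<open>2\<close>-flat ring\<close>

text \<open>From \<open>(p choose i)/p = (p-1)!/(i! (p-i)!)\<close> and Wilson's theorem, which
  supplies the sign. Only integer coefficients remain, so this form can be compared with a binomial
  expansion carried out in a lift of \<open>A\<close>.\<close>

lemma (in fp_algebra) cocycle_eq_choose:
  assumes x: "x \<in> carrier A" and y: "y \<in> carrier A"
  shows "cocycle x y = \<ominus> (\<Oplus>i\<in>{0<..<p}. [((p choose i) div p)] \<cdot> (x [^] i \<otimes> y [^] (p - i)))"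
proof -
  define D where "D i = [((p choose i) div p)] \<cdot> (x [^] i \<otimes> y [^] (p - i))" for i
  have D: "D i \<in> carrier A" for i using assms by (simp add: D_def)
  have "D i = (\<ominus> \<one>) \<otimes> (dpow i x \<otimes> dpow (p - i) y)" if i: "i \<in> {0<..<p}" for i
  proof -
    have "p dvd p choose i" using i prime by (intro dvd_choose_prime) auto
    then have "p * (fact i * fact (p - i) * ((p choose i) div p)) = p * fact (p - 1)"
      using binomial_fact_lemma[of i p] i fact_reduce[OF p_gt_0, where 'a=nat]
      by (metis (no_types, lifting) dvd_mult_div_cancel greaterThanLessThan_iff less_or_eq_imp_le mult.left_commute of_nat_id)
    then have nat: "fact i * fact (p - i) * ((p choose i) div p) = (fact (p - 1) :: nat)"
      by (simp only: mult_cancel1) simp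
    have "D i = ([((p choose i) div p)] \<cdot> \<one>) \<otimes>
        ((([(fact i :: nat)] \<cdot> \<one>) \<otimes> dpow i x) \<otimes> (([(fact (p - i) :: nat)] \<cdot> \<one>) \<otimes> dpow (p - i) y))"
      unfolding D_def using i assms by (subst nat_mult_eq) (simp_all add: fact_dpow)
    also have "\<dots> = ([(fact i * fact (p - i) * ((p choose i) div p))] \<cdot> \<one>) \<otimes> (dpow i x \<otimes> dpow (p - i) y)"
      using assms by (simp add: nat_smult_mult m_ac)
    finally show ?thesis by (simp only: nat wilson)
  qed
  then have eq: "(\<Oplus>i\<in>{0<..<p}. D i) = (\<Oplus>i\<in>{0<..<p}. (\<ominus> \<one>) \<otimes> (dpow i x \<otimes> dpow (p - i) y))"
    using assms by (intro add.finprod_cong') auto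
  have "cocycle x y = (\<Oplus>i\<in>{0<..<p}. dpow i x \<otimes> dpow (p - i) y)"
    unfolding cocycle_def using assms
    by (intro add.finprod_mono_neutral_cong_right) (auto simp: dpow_ge not_less)
  moreover have "(\<Oplus>i\<in>{0<..<p}. (\<ominus> \<one>) \<otimes> (dpow i x \<otimes> dpow (p - i) y))
      = (\<ominus> \<one>) \<otimes> (\<Oplus>i\<in>{0<..<p}. dpow i x \<otimes> dpow (p - i) y)"
    using assms by (intro finsum_rdistr[symmetric]) auto
  ultimately show ?thesis unfolding D_def[symmetric] eq using assms by (simp add: l_minus)
qed

lemma (in abelian_group) minus_eq_iff:
  assumes "x \<in> carrier G" "y \<in> carrier G" "z \<in> carrier G"
  shows "x \<ominus> y = z \<longleftrightarrow> x = y \<oplus> z"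
proof -
  have "y \<oplus> (x \<ominus> y) = x \<oplus> (y \<oplus> \<ominus> y)" "(y \<oplus> z) \<ominus> y = z \<oplus> (y \<oplus> \<ominus> y)"
    using assms by (simp_all only: a_minus_def a_ac a_inv_closed a_closed)
  then show ?thesis using assms r_neg[of y] by auto
qed

section \<open>The quotient by p and the working form of flatness\<close>

locale p_quotient = R?: cring R for R :: "'a ring" (structure) +
  fixes p :: nat
begin

abbreviation "Q \<equiv> mod_p p R"
abbreviation "proj X \<equiv> p_ideal p R +> X"

lemma p_ideal_ideal: "ideal (p_ideal p R) R"
  unfolding p_ideal_def by (rule cgenideal_ideal) simp

lemma p_ideal_eq: "p_ideal p R = {[p] \<cdot> y | y. y \<in> carrier R}"
proof -
  have "x \<otimes> ([p] \<cdot> \<one>) = [p] \<cdot> x" if "x \<in> carrier R" for x using that by (simp add: add_pow_rdistr)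
  then have "{x \<otimes> ([p] \<cdot> \<one>) | x. x \<in> carrier R} = {[p] \<cdot> y | y. y \<in> carrier R}"
    by (metis (lifting))
  then show ?thesis unfolding p_ideal_def cgenideal_def .
qed

lemma Q_cring: "cring Q"
  unfolding mod_p_def using is_cring by (rule ideal.quotient_is_cring[OF p_ideal_ideal])

sublocale Q: cring Q by (rule Q_cring)

lemma proj_hom: "(\<lambda>X. proj X) \<in> ring_hom R Q"
  unfolding mod_p_def using ideal.rcos_ring_hom[OF p_ideal_ideal] .

sublocale proj: ring_hom_cring R Q "\<lambda>X. proj X"
  by unfold_locales (rule proj_hom)

lemma carrier_Q: "carrier Q = (\<lambda>X. proj X) ` carrier R"
  unfolding mod_p_def FactRing_def A_RCOSETS_def' by (simp only: partial_object.simps) blast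

lemma proj_eq_iff:
  assumes "X \<in> carrier R" "Y \<in> carrier R"
  shows "proj X = proj Y \<longleftrightarrow> (\<exists>Z\<in>carrier R. X = Y \<oplus> [p] \<cdot> Z)"
proof -
  have "proj X = proj Y \<longleftrightarrow> X \<ominus> Y \<in> p_ideal p R"
    using quotient_eq_iff_same_a_r_cos[OF p_ideal_ideal assms] by simp
  also have "\<dots> \<longleftrightarrow> (\<exists>Z\<in>carrier R. X \<ominus> Y = [p] \<cdot> Z)" by (auto simp: p_ideal_eq)
  also have "\<dots> \<longleftrightarrow> (\<exists>Z\<in>carrier R. X = Y \<oplus> [p] \<cdot> Z)"
    using assms by (intro bex_cong refl) (rule minus_eq_iff, auto)
  finally show ?thesis .
qed

lemma proj_eq_zero_iff:
  "X \<in> carrier R \<Longrightarrow> proj X = \<zero>\<^bsub>Q\<^esub> \<longleftrightarrow> (\<exists>Z\<in>carrier R. X = [p] \<cdot> Z)"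
  using proj_eq_iff[of X \<zero>] by (simp add: proj.hom_zero cong: bex_cong)

lemma mem_proj: "X \<in> carrier R \<Longrightarrow> X \<in> proj X"
proof -
  interpret J: ideal "p_ideal p R" R by (rule p_ideal_ideal)
  show "X \<in> carrier R \<Longrightarrow> X \<in> proj X" by (rule J.a_rcos_self)
qed

lemma proj_mem:
  assumes "x \<in> carrier Q" "X \<in> x"
  shows "X \<in> carrier R" "x = proj X"
proof -
  interpret J: ideal "p_ideal p R" R by (rule p_ideal_ideal)
  obtain Y where Y: "Y \<in> carrier R" "x = proj Y" "X \<in> proj Y" using assms unfolding carrier_Q by blast
  show "x = proj X" unfolding Y(2) by (rule J.a_repr_independence'[OF Y(3,1)])
  show "X \<in> carrier R" using subsetD[OF a_r_coset_subset_G[OF J.a_subset Y(1)] Y(3)] .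
qed

lemma Q_smult_p: "[p] \<cdot>\<^bsub>Q\<^esub> \<one>\<^bsub>Q\<^esub> = \<zero>\<^bsub>Q\<^esub>"
proof -
  have "proj ([p] \<cdot> \<one>) = \<zero>\<^bsub>Q\<^esub>" by (subst proj_eq_zero_iff) auto
  then show ?thesis by (simp add: proj.hom_nat_smult)
qed

end

text \<open>Working form of \<open>two_flat\<close>: freeness is replaced by the divisibility
  criterion, and surjectivity of Frobenius on the quotient is spelled out in elements of the ring
  itself.\<close>

locale two_flat_ring = p_quotient +
  assumes prime: "prime p" and p2: "[(p ^ 2)] \<cdot> \<one> = \<zero>"
    and flat: "x \<in> carrier R \<Longrightarrow> [p] \<cdot> x = \<zero> \<Longrightarrow> \<exists>y\<in>carrier R. x = [p] \<cdot> y"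
    and frob_surj: "x \<in> carrier R \<Longrightarrow> \<exists>u\<in>carrier R. \<exists>v\<in>carrier R. x = u [^] p \<oplus> [p] \<cdot> v"

lemma (in p_quotient) frob_surj_iff:
  "frob p Q ` carrier Q = carrier Q \<longleftrightarrow>
   (\<forall>x\<in>carrier R. \<exists>u\<in>carrier R. \<exists>v\<in>carrier R. x = u [^] p \<oplus> [p] \<cdot> v)"
proof -
  have "frob p Q ` carrier Q \<subseteq> carrier Q" by (auto simp: frob_def)
  then have "frob p Q ` carrier Q = carrier Q \<longleftrightarrow> carrier Q \<subseteq> frob p Q ` carrier Q" by blast
  also have "\<dots> \<longleftrightarrow> (\<forall>x\<in>carrier R. \<exists>u\<in>carrier R. proj x = proj (u [^] p))"
    by (auto simp: carrier_Q subset_iff image_iff frob_def proj.ring.hom_nat_pow)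
  also have "\<dots> \<longleftrightarrow> (\<forall>x\<in>carrier R. \<exists>u\<in>carrier R. \<exists>v\<in>carrier R. x = u [^] p \<oplus> [p] \<cdot> v)"
    by (intro ball_cong bex_cong refl proj_eq_iff) auto
  finally show ?thesis .
qed

lemma two_flat_iff:
  assumes "prime p"
  shows "two_flat p R \<longleftrightarrow> two_flat_ring R p"
proof -
  have p: "1 < p ^ 2" by (rule one_less_power) (use prime_gt_1_nat[OF assms] in auto)
  \<comment> \<open>Either side forces a commutative ring in which \<open>p^2 = 0\<close>. This is
    settled before the equivalence because the locales can be interpreted only under that
    condition.\<close>
  have char: "cring R \<and> [(p ^ 2)] \<cdot>\<^bsub>R\<^esub> \<one>\<^bsub>R\<^esub> = \<zero>\<^bsub>R\<^esub>" if "two_flat p R \<or> two_flat_ring R p"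
    using that zmod_algebraD[OF _ p, of R]
    by (auto simp: two_flat_def two_flat_ring_def p_quotient_def two_flat_ring_axioms_def)
  show ?thesis
  proof (cases "cring R \<and> [(p ^ 2)] \<cdot>\<^bsub>R\<^esub> \<one>\<^bsub>R\<^esub> = \<zero>\<^bsub>R\<^esub>")
    case False
    then show ?thesis using char by blast
  next
    case True
    then interpret p_quotient R p by (simp add: p_quotient_def)
    have z: "[(p ^ 2)] \<cdot>\<^bsub>R\<^esub> x = \<zero>\<^bsub>R\<^esub>" if "x \<in> carrier R" for x
      using that True add_pow_ldistr[of "\<one>\<^bsub>R\<^esub>" x "p ^ 2"] by simp
    interpret P: abelian_p2_group R p
      by unfold_locales (use z assms in auto)
    have alg: "zmod_algebra (p ^ 2) R" using True p by (intro zmod_algebraI) auto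
    then have "module (residue_ring (int (p ^ 2))) (int_scalars R)"
      by (simp add: zmod_algebra_def algebra_def)
    then have "two_flat p R \<longleftrightarrow> (\<forall>x\<in>carrier R. [p] \<cdot>\<^bsub>R\<^esub> x = \<zero>\<^bsub>R\<^esub> \<longrightarrow> (\<exists>y\<in>carrier R. x = [p] \<cdot>\<^bsub>R\<^esub> y)) \<and>
       (\<forall>x\<in>carrier R. \<exists>u\<in>carrier R. \<exists>v\<in>carrier R. x = u [^]\<^bsub>R\<^esub> p \<oplus>\<^bsub>R\<^esub> [p] \<cdot>\<^bsub>R\<^esub> v)"
      unfolding two_flat_def free_module_def frob_surj_iff P.free_iff_flat using alg by simp
    also have "\<dots> \<longleftrightarrow> two_flat_ring R p"
      unfolding two_flat_ring_def two_flat_ring_axioms_def using True assms p_quotient_axioms by blast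
    finally show ?thesis .
  qed
qed

context two_flat_ring
begin

sublocale Q: fp_algebra Q p
  by unfold_locales (use prime Q_smult_p in auto)

lemma smult_p2: "x \<in> carrier R \<Longrightarrow> [p] \<cdot> ([p] \<cdot> x) = \<zero>"
  using p2 add_pow_ldistr[of \<one> x "p ^ 2"] by (simp add: add.nat_pow_pow power2_eq_square)

text \<open>Multiplication by p identifies the quotient by p with the multiples of p: injectivity is
  flatness, well-definedness is \<open>p^2 = 0\<close>. This is why the class of \<open>Y\<close> in
  \<open>X^p = p Y\<close> is determined.\<close>

lemma smult_p_eq_iff:
  assumes "X \<in> carrier R" "Y \<in> carrier R"
  shows "[p] \<cdot> X = [p] \<cdot> Y \<longleftrightarrow> proj X = proj Y"
proof
  assume eq: "[p] \<cdot> X = [p] \<cdot> Y"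
  have "[p] \<cdot> (X \<ominus> Y) = \<zero>"
    using assms eq by (simp add: a_minus_def add.nat_pow_distrib add.nat_pow_inv r_neg)
  then obtain Z where "Z \<in> carrier R" "X \<ominus> Y = [p] \<cdot> Z" using flat assms by blast
  then show "proj X = proj Y" unfolding proj_eq_iff[OF assms]
    using minus_eq_iff assms by auto
next
  assume "proj X = proj Y"
  then obtain Z where "Z \<in> carrier R" "X = Y \<oplus> [p] \<cdot> Z" using assms proj_eq_iff by blast
  then show "[p] \<cdot> X = [p] \<cdot> Y" using assms by (simp add: add.nat_pow_distrib smult_p2)
qed

text \<open>For \<open>X = Y + p Z\<close> all terms of degree two or more in \<open>p Z\<close>
  vanish, and the linear term gets a second factor p from the exponent.\<close>

lemma pow_p_cong:
  assumes X: "X \<in> carrier R" and Y: "Y \<in> carrier R" and eq: "proj X = proj Y"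
  shows "X [^] p = Y [^] p"
proof -
  obtain Z where Z: "Z \<in> carrier R" "X = Y \<oplus> [p] \<cdot> Z" using assms proj_eq_iff by blast
  have sq: "([p] \<cdot> Z) \<otimes> ([p] \<cdot> W) = \<zero>" if "W \<in> carrier R" for W
    using Z that by (simp add: add_pow_ldistr add_pow_rdistr smult_p2)
  have "X [^] Suc n = Y [^] Suc n \<oplus> [(Suc n)] \<cdot> (([p] \<cdot> Z) \<otimes> Y [^] n)" for n
  proof (induction n)
    case 0 then show ?case using Z Y by simp
  next
    case (Suc n)
    define W where "W = ([p] \<cdot> Z) \<otimes> Y [^] n"
    have W: "W \<in> carrier R" "W \<otimes> ([p] \<cdot> Z) = \<zero>"
      using Z Y sq[of "Z \<otimes> Y [^] n"] by (simp_all add: W_def m_ac add_pow_ldistr add_pow_rdistr)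
    have "X [^] Suc (Suc n) = (Y [^] Suc n \<oplus> [(Suc n)] \<cdot> W) \<otimes> (Y \<oplus> [p] \<cdot> Z)"
      using Suc Z by (simp add: W_def)
    also have "\<dots> = Y [^] Suc (Suc n) \<oplus> ([(Suc n)] \<cdot> (W \<otimes> Y) \<oplus> Y [^] Suc n \<otimes> ([p] \<cdot> Z))"
      using W Y Z by (simp add: l_distr r_distr add_pow_ldistr[of W] a_assoc del: add.nat_pow_Suc)
    also have "W \<otimes> Y = ([p] \<cdot> Z) \<otimes> Y [^] Suc n" using Y Z by (simp add: W_def m_assoc)
    also have "Y [^] Suc n \<otimes> ([p] \<cdot> Z) = ([p] \<cdot> Z) \<otimes> Y [^] Suc n" using Y Z by (simp add: m_comm)
    finally show ?case using Y Z by simp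
  qed
  from this[of "p - 1"] have "X [^] p = Y [^] p \<oplus> [p] \<cdot> (([p] \<cdot> Z) \<otimes> Y [^] (p - 1))"
    by (simp del: add.nat_pow_Suc nat_pow_Suc)
  then show ?thesis using Y Z by (simp add: add_pow_ldistr smult_p2)
qed

definition lft :: "'a set \<Rightarrow> 'a" where "lft x = (SOME X. X \<in> carrier R \<and> proj X = x)"

lemma lft: assumes "x \<in> carrier Q" shows "lft x \<in> carrier R" "proj (lft x) = x"
  using someI_ex[of "\<lambda>X. X \<in> carrier R \<and> proj X = x"] assms by (auto simp: lft_def carrier_Q)

text \<open>The second ghost component \<open>X\<^sup>p + p V\<close> depends only on \<open>X\<close> and \<open>V\<close> modulo \<open>p\<close>.\<close>

definition ghost :: "'a set \<times> 'a set \<Rightarrow> 'a" where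
  "ghost = (\<lambda>(x, v). lft x [^] p \<oplus> [p] \<cdot> lft v)"

lemma ghost_proj:
  assumes "X \<in> carrier R" "V \<in> carrier R"
  shows "ghost (proj X, proj V) = X [^] p \<oplus> [p] \<cdot> V"
proof -
  have "lft (proj X) [^] p = X [^] p" by (rule pow_p_cong) (use assms lft in auto)
  moreover have "[p] \<cdot> lft (proj V) = [p] \<cdot> V" by (subst smult_p_eq_iff) (use assms lft in auto)
  ultimately show ?thesis by (simp add: ghost_def)
qed

text \<open>The binomial coefficients are divided by p as integers, before they act on the ring; the
  reduction of the resulting sum is then known from \<open>cocycle_eq_choose\<close>.\<close>

lemma pow_p_add:
  assumes X: "X \<in> carrier R" and Y: "Y \<in> carrier R"
  shows "\<exists>D\<in>carrier R. proj D = \<ominus>\<^bsub>Q\<^esub> Q.cocycle (proj X) (proj Y) \<and>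
    (X \<oplus> Y) [^] p = X [^] p \<oplus> Y [^] p \<oplus> [p] \<cdot> D"
proof -
  define t where "t i = [(p choose i)] \<cdot> (X [^] i \<otimes> Y [^] (p - i))" for i
  define s where "s i = [((p choose i) div p)] \<cdot> (X [^] i \<otimes> Y [^] (p - i))" for i
  have t: "t i \<in> carrier R" and s: "s i \<in> carrier R" for i using X Y by (simp_all add: t_def s_def)
  define D where "D = (\<Oplus>i\<in>{0<..<p}. s i)"
  have D: "D \<in> carrier R" using s by (auto simp: D_def intro!: finsum_closed)
  have "t i = ([p] \<cdot> \<one>) \<otimes> s i" if i: "i \<in> {0<..<p}" for i
  proof -
    have "p dvd p choose i" using i prime by (intro dvd_choose_prime) auto
    then have "(p choose i) = (p choose i) div p * p" by simp
    then have "t i = [((p choose i) div p * p)] \<cdot> (X [^] i \<otimes> Y [^] (p - i))" unfolding t_def by argo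
    then show ?thesis using X Y s by (simp add: s_def add.nat_pow_pow add_pow_ldistr)
  qed
  then have "(\<Oplus>i\<in>{0<..<p}. t i) = (\<Oplus>i\<in>{0<..<p}. ([p] \<cdot> \<one>) \<otimes> s i)"
    using s by (intro add.finprod_cong') auto
  also have "\<dots> = ([p] \<cdot> \<one>) \<otimes> D" unfolding D_def using s by (intro finsum_rdistr[symmetric]) auto
  also have "\<dots> = [p] \<cdot> D" using D by (simp add: add_pow_ldistr)
  finally have mid: "(\<Oplus>i\<in>{0<..<p}. t i) = [p] \<cdot> D" .
  have S: "{..p} = insert 0 (insert p {0<..<p})" by auto
  have "(X \<oplus> Y) [^] p = (\<Oplus>i\<in>{..p}. t i)" using binomial_expansion[OF X Y] by (simp add: t_def)
  also have "\<dots> = t 0 \<oplus> (t p \<oplus> [p] \<cdot> D)"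
    unfolding S mid[symmetric] using t by (simp add: Pi_def finsum_closed)
  also have "\<dots> = X [^] p \<oplus> Y [^] p \<oplus> [p] \<cdot> D"
    using X Y D by (simp add: t_def a_ac)
  finally have 1: "(X \<oplus> Y) [^] p = X [^] p \<oplus> Y [^] p \<oplus> [p] \<cdot> D" .
  have "proj D = (\<Oplus>\<^bsub>Q\<^esub>i\<in>{0<..<p}. proj (s i))"
    unfolding D_def using s by (simp add: proj.hom_finsum o_def Pi_def)
  also have "\<dots> = (\<Oplus>\<^bsub>Q\<^esub>i\<in>{0<..<p}. [((p choose i) div p)] \<cdot>\<^bsub>Q\<^esub> (proj X [^]\<^bsub>Q\<^esub> i \<otimes>\<^bsub>Q\<^esub> proj Y [^]\<^bsub>Q\<^esub> (p - i)))"
    using X Y by (intro Q.add.finprod_cong') (auto simp: s_def proj.hom_nat_smult proj.ring.hom_nat_pow)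
  also have "\<dots> = \<ominus>\<^bsub>Q\<^esub> Q.cocycle (proj X) (proj Y)"
    using X Y by (subst Q.cocycle_eq_choose) (auto intro!: Q.finsum_closed)
  finally show ?thesis using D 1 by blast
qed

sublocale W: cring "witt p Q" by (rule Q.witt_cring)

lemma carrier_wittE:
  assumes "w \<in> carrier (witt p Q)"
  obtains X V where "X \<in> carrier R" "V \<in> carrier R" "w = (proj X, proj V)"
  using assms by (auto simp: Q.witt_simps carrier_Q)

lemma ghost_hom: "ghost \<in> ring_hom (witt p Q) R"
proof (rule ring_hom_memI)
  fix w w' assume "w \<in> carrier (witt p Q)" "w' \<in> carrier (witt p Q)"
  then obtain X V Y U where w: "w = (proj X, proj V)" "w' = (proj Y, proj U)"
    and [simp]: "X \<in> carrier R" "V \<in> carrier R" "Y \<in> carrier R" "U \<in> carrier R"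
    by (metis carrier_wittE)
  show "ghost w \<in> carrier R" by (simp add: w ghost_proj)
  have "ghost (w \<otimes>\<^bsub>witt p Q\<^esub> w') = ghost (proj (X \<otimes> Y), proj (X [^] p \<otimes> U \<oplus> Y [^] p \<otimes> V))"
    by (simp add: w Q.witt_simps proj.ring.hom_nat_pow)
  also have "\<dots> = (X \<otimes> Y) [^] p \<oplus> [p] \<cdot> (X [^] p \<otimes> U \<oplus> Y [^] p \<otimes> V)"
    by (rule ghost_proj) auto
  also have "\<dots> = (X [^] p \<oplus> [p] \<cdot> V) \<otimes> (Y [^] p \<oplus> [p] \<cdot> U)"
    by (simp add: l_distr r_distr nat_pow_distrib add_pow_ldistr add_pow_rdistr smult_p2
        add.nat_pow_distrib m_comm a_ac)
  finally show "ghost (w \<otimes>\<^bsub>witt p Q\<^esub> w') = ghost w \<otimes> ghost w'" by (simp add: w ghost_proj)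
  obtain D where D: "D \<in> carrier R" "proj D = \<ominus>\<^bsub>Q\<^esub> Q.cocycle (proj X) (proj Y)"
    "(X \<oplus> Y) [^] p = X [^] p \<oplus> Y [^] p \<oplus> [p] \<cdot> D" using pow_p_add[of X Y] by auto
  \<comment> \<open>Witt addition puts the cocycle, lifted by \<open>\<ominus> D\<close>, into the
    second component; multiplied by p it cancels the cross terms of
    \<open>(X + Y)^p\<close>.\<close>
  have "proj (\<ominus> D) = Q.cocycle (proj X) (proj Y)" using D by (simp add: proj.hom_a_inv)
  then have "w \<oplus>\<^bsub>witt p Q\<^esub> w' = (proj (X \<oplus> Y), proj (V \<oplus> U \<oplus> \<ominus> D))"
    using D(1) by (simp add: w Q.witt_simps)
  then have "ghost (w \<oplus>\<^bsub>witt p Q\<^esub> w') = (X \<oplus> Y) [^] p \<oplus> [p] \<cdot> (V \<oplus> U \<oplus> \<ominus> D)"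
    using D(1) by (simp add: ghost_proj del: proj.hom_add)
  also have "\<dots> = X [^] p \<oplus> Y [^] p \<oplus> [p] \<cdot> D \<oplus> ([p] \<cdot> V \<oplus> [p] \<cdot> U \<oplus> \<ominus> ([p] \<cdot> D))"
    using D by (simp add: add.nat_pow_distrib add.nat_pow_inv)
  also have "\<dots> = (X [^] p \<oplus> Y [^] p \<oplus> ([p] \<cdot> V \<oplus> [p] \<cdot> U)) \<oplus> ([p] \<cdot> D \<oplus> \<ominus> ([p] \<cdot> D))"
    using D(1) by (simp add: a_ac)
  also have "\<dots> = X [^] p \<oplus> Y [^] p \<oplus> ([p] \<cdot> V \<oplus> [p] \<cdot> U)" using D(1) by (simp add: r_neg)
  also have "\<dots> = ghost w \<oplus> ghost w'" by (simp add: w ghost_proj a_ac)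
  finally show "ghost (w \<oplus>\<^bsub>witt p Q\<^esub> w') = ghost w \<oplus> ghost w'" .
next
  have "\<one>\<^bsub>witt p Q\<^esub> = (proj \<one>, proj \<zero>)" by (simp add: Q.witt_simps proj.hom_zero)
  then show "ghost \<one>\<^bsub>witt p Q\<^esub> = \<one>" by (simp only: ghost_proj one_closed zero_closed) simp
qed

lemma ghost_surj:
  assumes "X \<in> carrier R" obtains w where "w \<in> carrier (witt p Q)" "ghost w = X"
proof -
  obtain u v where "u \<in> carrier R" "v \<in> carrier R" "X = u [^] p \<oplus> [p] \<cdot> v" using frob_surj assms by blast
  then show ?thesis using that[of "(proj u, proj v)"] by (simp add: ghost_proj Q.witt_simps)
qed

text \<open>The summand \<open>p V\<close> dies modulo p, so the ghost map reduces to Frobenius of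
  the first component. Together with \<open>ghost_surj\<close> this exhibits every element of the
  quotient as a p-th power.\<close>

lemma proj_ghost: "w \<in> carrier (witt p Q) \<Longrightarrow> proj (ghost w) = fst w [^]\<^bsub>Q\<^esub> p"
  by (erule carrier_wittE) (simp add: ghost_proj proj.hom_nat_smult proj.ring.hom_nat_pow Q.dvd_smult)

text \<open>Wilson's theorem turns \<open>1/(p-1)!\<close> into the sign. The description by
  \<open>THE\<close> is justified by \<open>pow_p_cong\<close> for the choice of \<open>X\<close>
  and by \<open>smult_p_eq_iff\<close> for the choice of \<open>Y\<close>.\<close>

lemma Psi_gamma_eq:
  assumes X: "X \<in> carrier R" and Y: "Y \<in> carrier R" and eq: "X [^] p = [p] \<cdot> Y"
  shows "Psi_gamma p R (proj X) = \<ominus>\<^bsub>Q\<^esub> proj Y"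
proof -
  have inv: "inv\<^bsub>Q\<^esub> ([(fact (p - 1) :: nat)] \<cdot>\<^bsub>Q\<^esub> \<one>\<^bsub>Q\<^esub>) = \<ominus>\<^bsub>Q\<^esub> \<one>\<^bsub>Q\<^esub>"
    unfolding Q.wilson by (rule Q.comm_inv_char) (simp_all add: Q.l_minus Q.r_minus)
  show ?thesis unfolding Psi_gamma_def inv
  proof (rule the_equality)
    show "\<exists>X'\<in>proj X. \<exists>Y'\<in>carrier R. X' [^] p = [p] \<cdot> Y' \<and> \<ominus>\<^bsub>Q\<^esub> proj Y = \<ominus>\<^bsub>Q\<^esub> \<one>\<^bsub>Q\<^esub> \<otimes>\<^bsub>Q\<^esub> proj Y'"
      using mem_proj[OF X] Y eq by (intro bexI[of _ X] bexI[of _ Y]) (auto simp: Q.l_minus)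
    fix c assume "\<exists>X'\<in>proj X. \<exists>Y'\<in>carrier R. X' [^] p = [p] \<cdot> Y' \<and> c = \<ominus>\<^bsub>Q\<^esub> \<one>\<^bsub>Q\<^esub> \<otimes>\<^bsub>Q\<^esub> proj Y'"
    then obtain X' Y' where *: "X' \<in> proj X" "Y' \<in> carrier R" "X' [^] p = [p] \<cdot> Y'"
      "c = \<ominus>\<^bsub>Q\<^esub> \<one>\<^bsub>Q\<^esub> \<otimes>\<^bsub>Q\<^esub> proj Y'" by blast
    have "X' \<in> carrier R" "proj X = proj X'" using proj_mem[OF proj.hom_closed[OF X] *(1)] by auto
    then have "[p] \<cdot> Y = [p] \<cdot> Y'" using pow_p_cong[of X X'] X eq *(3) by simp
    then have "proj Y = proj Y'" using smult_p_eq_iff Y *(2) by blast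
    then show "c = \<ominus>\<^bsub>Q\<^esub> proj Y" using *(2,4) by (simp add: Q.l_minus)
  qed
qed

lemma frob_kerE:
  assumes "x \<in> frob_ker p Q"
  obtains X Y where "X \<in> carrier R" "Y \<in> carrier R" "x = proj X" "X [^] p = [p] \<cdot> Y"
proof -
  obtain X where X: "X \<in> carrier R" "x = proj X" using assms by (auto simp: Q.frob_ker_iff carrier_Q)
  then have "proj (X [^] p) = \<zero>\<^bsub>Q\<^esub>" using assms by (simp add: Q.frob_ker_iff proj.ring.hom_nat_pow)
  then show ?thesis using that X proj_eq_zero_iff[of "X [^] p"] by auto
qed

text \<open>\<open>X^p + p V = 0\<close> means \<open>X^p = p Y\<close> with \<open>Y = -V\<close>,
  and the sign in \<open>Psi_gamma_eq\<close> undoes this one: the value at the class of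
  \<open>X\<close> is the class of \<open>V\<close>.\<close>

lemma ghost_kernel: "a_kernel (witt p Q) R ghost = wrinkle_ideal p Q (Psi_gamma p R)"
proof (rule subset_antisym; rule subsetI)
  fix w
    assume "w \<in> a_kernel (witt p Q) R ghost"
    then have w: "w \<in> carrier (witt p Q)" "ghost w = \<zero>" by (auto simp: a_kernel_def')
    obtain X V where XV: "X \<in> carrier R" "V \<in> carrier R" "w = (proj X, proj V)" by (rule carrier_wittE[OF w(1)])
    then have "X [^] p = \<ominus> ([p] \<cdot> V)" using w(2) by (simp add: ghost_proj minus_equality)
    then have eq: "X [^] p = [p] \<cdot> (\<ominus> V)" using XV by (simp add: add.nat_pow_inv)
    then have "Psi_gamma p R (proj X) = proj V" using Psi_gamma_eq[OF XV(1) _ eq] XV(2) by (simp add: proj.hom_a_inv)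
    moreover have "proj X [^]\<^bsub>Q\<^esub> p = \<zero>\<^bsub>Q\<^esub>"
      using XV eq by (simp flip: proj.ring.hom_nat_pow) (auto simp: proj_eq_zero_iff)
    ultimately show "w \<in> wrinkle_ideal p Q (Psi_gamma p R)" using XV by (simp add: Q.wrinkle_ideal_iff)
next
  fix w
    assume "w \<in> wrinkle_ideal p Q (Psi_gamma p R)"
    then obtain x where x: "x \<in> frob_ker p Q" "w = (x, Psi_gamma p R x)" by (auto simp: wrinkle_ideal_def)
    from x(1) obtain X Y where XY: "X \<in> carrier R" "Y \<in> carrier R" "x = proj X" "X [^] p = [p] \<cdot> Y"
      by (rule frob_kerE)
    have w: "w = (proj X, proj (\<ominus> Y))" using x XY by (simp add: Psi_gamma_eq proj.hom_a_inv)
    then have "ghost w = [p] \<cdot> Y \<oplus> [p] \<cdot> (\<ominus> Y)" using XY by (simp add: ghost_proj del: proj.hom_a_inv)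
    also have "\<dots> = \<zero>" using XY by (simp add: add.nat_pow_inv r_neg)
    finally have "ghost w = \<zero>" .
    moreover have "w \<in> carrier (witt p Q)" unfolding w using XY(1,2) by (simp add: Q.witt_simps)
    ultimately show "w \<in> a_kernel (witt p Q) R ghost" by (simp add: a_kernel_def')
qed

sublocale ghost: ring_hom_cring "witt p Q" R ghost
  by unfold_locales (rule ghost_hom)

text \<open>The axioms for \<open>Psi_gamma\<close> need no computation of their own: its graph is
  the kernel of the ghost homomorphism, hence an ideal, and \<open>two_wrinkled_iff\<close>
  applies.\<close>

lemma Psi_wrinkled: "two_wrinkled p (Psi_obj p R)"
proof -
  have alg: "zmod_algebra p Q" using Q.p_gt_1 Q.char_p Q_cring by (intro zmod_algebraI) auto
  have "\<exists>x\<in>carrier Q. x [^]\<^bsub>Q\<^esub> p = y" if y: "y \<in> carrier Q" for y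
  proof -
    obtain Y where Y: "Y \<in> carrier R" "y = proj Y" using y by (auto simp: carrier_Q)
    obtain w where "w \<in> carrier (witt p Q)" "ghost w = Y" by (rule ghost_surj[OF Y(1)])
    then show ?thesis using proj_ghost[of w] Y by (auto simp: Q.witt_simps intro!: bexI[of _ "fst w"])
  qed
  then show ?thesis unfolding Psi_obj_def Q.two_wrinkled_iff[OF alg]
    using ghost.ring.kernel_is_ideal ghost_kernel by auto
qed

end

section \<open>Full faithfulness\<close>

lemma mem_wrinkled_hom_iff:
  "\<phi> \<in> wrinkled_hom p (A, \<gamma>) (A', \<gamma>') \<longleftrightarrow> \<phi> \<in> ring_hom A A' \<and> \<phi> \<in> extensional (carrier A) \<and>
    (\<forall>x\<in>frob_ker p A. \<gamma>' (\<phi> x) = \<phi> (\<gamma> x))"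
  by (simp add: wrinkled_hom_def)

lemma ring_hom_factor:
  assumes W: "ring W" and R: "ring R" and S: "ring S" and g: "g \<in> ring_hom W R" and h: "h \<in> ring_hom W S"
    and surj: "g ` carrier W = carrier R"
    and ker: "\<And>w. w \<in> carrier W \<Longrightarrow> g w = \<zero>\<^bsub>R\<^esub> \<Longrightarrow> h w = \<zero>\<^bsub>S\<^esub>"
  obtains f where "f \<in> ring_hom R S" "f \<in> extensional (carrier R)" "\<And>w. w \<in> carrier W \<Longrightarrow> f (g w) = h w"
proof -
  interpret g: ring_hom_ring W R g using W R g by (intro ring_hom_ringI2)
  interpret h: ring_hom_ring W S h using W S h by (intro ring_hom_ringI2)
  define f where "f = (\<lambda>x\<in>carrier R. h (inv_into (carrier W) g x))"
  have eq: "f (g w) = h w" if w: "w \<in> carrier W" for w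
  proof -
    define v where "v = inv_into (carrier W) g (g w)"
    have v: "v \<in> carrier W" "g v = g w" using w by (simp_all add: v_def inv_into_into f_inv_into_f)
    then have "h (v \<ominus>\<^bsub>W\<^esub> w) = \<zero>\<^bsub>S\<^esub>" using w by (intro ker) (simp_all add: a_minus_def g.S.r_neg)
    then have "h v \<ominus>\<^bsub>S\<^esub> h w = \<zero>\<^bsub>S\<^esub>" using v w by (simp add: a_minus_def)
    then have "h v = h w" using v w by simp
    then show ?thesis using w by (simp add: f_def v_def)
  qed
  have "f \<in> ring_hom R S"
  proof (rule ring_hom_memI)
    fix x y assume "x \<in> carrier R" "y \<in> carrier R"
    then obtain v w where vw: "v \<in> carrier W" "w \<in> carrier W" "x = g v" "y = g w"
      using surj by (metis imageE)
    show "f x \<in> carrier S" using vw eq by simp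
    show "f (x \<otimes>\<^bsub>R\<^esub> y) = f x \<otimes>\<^bsub>S\<^esub> f y" using vw eq[of "v \<otimes>\<^bsub>W\<^esub> w"] by (simp add: eq)
    show "f (x \<oplus>\<^bsub>R\<^esub> y) = f x \<oplus>\<^bsub>S\<^esub> f y" using vw eq[of "v \<oplus>\<^bsub>W\<^esub> w"] by (simp add: eq)
  next
    show "f \<one>\<^bsub>R\<^esub> = \<one>\<^bsub>S\<^esub>" using eq[of "\<one>\<^bsub>W\<^esub>"] by simp
  qed
  then show ?thesis using that[of f] eq by (simp add: f_def)
qed

locale two_flat_pair = R: two_flat_ring R p + S: two_flat_ring S p
  for R :: "'a ring" and S :: "'b ring" and p
begin

lemma hom_smult:
  assumes "f \<in> ring_hom R S" "x \<in> carrier R"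
  shows "f ([(n::nat)] \<cdot>\<^bsub>R\<^esub> x) = [n] \<cdot>\<^bsub>S\<^esub> f x"
proof -
  interpret f: ring_hom_cring R S f using assms(1) by unfold_locales
  show ?thesis using assms(2) by (rule f.hom_nat_smult)
qed

lemma hom_pow:
  assumes "f \<in> ring_hom R S" "x \<in> carrier R"
  shows "f (x [^]\<^bsub>R\<^esub> (n::nat)) = f x [^]\<^bsub>S\<^esub> n"
proof -
  interpret f: ring_hom_cring R S f using assms(1) by unfold_locales
  show ?thesis using assms(2) by (rule f.ring.hom_nat_pow)
qed

lemma Psi_mor_proj:
  assumes f: "f \<in> ring_hom R S" and X: "X \<in> carrier R"
  shows "Psi_mor p R S f (R.proj X) = S.proj (f X)"
proof -
  have "(THE y. \<exists>X'\<in>R.proj X. y = S.proj (f X')) = S.proj (f X)"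
  proof (rule the_equality)
    show "\<exists>X'\<in>R.proj X. S.proj (f X) = S.proj (f X')" using R.mem_proj[OF X] by blast
    fix y assume "\<exists>X'\<in>R.proj X. y = S.proj (f X')"
    then obtain X' where X': "X' \<in> R.proj X" "y = S.proj (f X')" by blast
    have "X' \<in> carrier R" "R.proj X = R.proj X'" using R.proj_mem[OF R.proj.hom_closed[OF X] X'(1)] by auto
    then obtain Z where Z: "Z \<in> carrier R" "X' = X \<oplus>\<^bsub>R\<^esub> [p] \<cdot>\<^bsub>R\<^esub> Z" using R.proj_eq_iff[of X' X] X by auto
    then have "f X' = f X \<oplus>\<^bsub>S\<^esub> [p] \<cdot>\<^bsub>S\<^esub> f Z" using f X by (simp add: ring_hom_add hom_smult)
    then show "y = S.proj (f X)"
      using X'(2) S.proj_eq_iff[of "f X'" "f X"] ring_hom_closed[OF f] X Z by auto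
  qed
  then show ?thesis using X by (simp add: Psi_mor_def)
qed

lemma Psi_mor_ring_hom:
  assumes f: "f \<in> ring_hom R S"
  shows "Psi_mor p R S f \<in> ring_hom R.Q S.Q"
proof (rule ring_hom_memI)
  fix x y assume "x \<in> carrier R.Q" "y \<in> carrier R.Q"
  then obtain X Y where XY: "X \<in> carrier R" "x = R.proj X" "Y \<in> carrier R" "y = R.proj Y"
    unfolding R.carrier_Q by blast
  note [simp] = ring_hom_closed[OF f] Psi_mor_proj[OF f]
  show "Psi_mor p R S f x \<in> carrier S.Q" using XY by simp
  show "Psi_mor p R S f (x \<otimes>\<^bsub>R.Q\<^esub> y) = Psi_mor p R S f x \<otimes>\<^bsub>S.Q\<^esub> Psi_mor p R S f y"
    using XY Psi_mor_proj[OF f, of "X \<otimes>\<^bsub>R\<^esub> Y"] by (simp add: ring_hom_mult[OF f])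
  show "Psi_mor p R S f (x \<oplus>\<^bsub>R.Q\<^esub> y) = Psi_mor p R S f x \<oplus>\<^bsub>S.Q\<^esub> Psi_mor p R S f y"
    using XY Psi_mor_proj[OF f, of "X \<oplus>\<^bsub>R\<^esub> Y"] by (simp add: ring_hom_add[OF f])
next
  show "Psi_mor p R S f \<one>\<^bsub>R.Q\<^esub> = \<one>\<^bsub>S.Q\<^esub>"
    using Psi_mor_proj[OF f, of "\<one>\<^bsub>R\<^esub>"] by (simp add: ring_hom_one[OF f])
qed

lemma Psi_mor_wrinkled_hom:
  assumes f: "f \<in> ring_hom R S"
  shows "Psi_mor p R S f \<in> wrinkled_hom p (Psi_obj p R) (Psi_obj p S)"
proof -
  have "Psi_gamma p S (Psi_mor p R S f x) = Psi_mor p R S f (Psi_gamma p R x)" if x: "x \<in> frob_ker p R.Q" for x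
  proof -
    obtain X Y where XY: "X \<in> carrier R" "Y \<in> carrier R" "x = R.proj X" "X [^]\<^bsub>R\<^esub> p = [p] \<cdot>\<^bsub>R\<^esub> Y"
      using x by (rule R.frob_kerE)
    note fc = ring_hom_closed[OF f]
    have "f X [^]\<^bsub>S\<^esub> p = [p] \<cdot>\<^bsub>S\<^esub> f Y"
      using XY f by (simp flip: hom_pow) (simp add: hom_smult)
    then have "Psi_gamma p S (S.proj (f X)) = \<ominus>\<^bsub>S.Q\<^esub> S.proj (f Y)"
      using XY fc by (intro S.Psi_gamma_eq) auto
    moreover interpret f: ring_hom_cring R.Q S.Q "Psi_mor p R S f"
      using Psi_mor_ring_hom[OF f] by unfold_locales
    have "Psi_mor p R S f (\<ominus>\<^bsub>R.Q\<^esub> R.proj Y) = \<ominus>\<^bsub>S.Q\<^esub> S.proj (f Y)"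
      using XY by (simp add: f.hom_a_inv Psi_mor_proj[OF f])
    ultimately show ?thesis using XY by (simp add: R.Psi_gamma_eq Psi_mor_proj[OF f])
  qed
  then show ?thesis unfolding Psi_obj_def mem_wrinkled_hom_iff
    using Psi_mor_ring_hom[OF f] by (simp add: Psi_mor_def)
qed

text \<open>Naturality of the ghost map. As the ghost map is onto, \<open>f\<close> is determined by
  its reduction, and the formula dictates how to define \<open>f\<close> from a given map of
  quotients.\<close>

lemma hom_ghost:
  assumes f: "f \<in> ring_hom R S" and w: "w \<in> carrier (witt p R.Q)"
  shows "f (R.ghost w) = S.ghost (map_prod (Psi_mor p R S f) (Psi_mor p R S f) w)"
proof -
  obtain X V where "X \<in> carrier R" "V \<in> carrier R" "w = (R.proj X, R.proj V)"
    using w by (rule R.carrier_wittE)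
  then show ?thesis
    using f ring_hom_closed[OF f]
    by (simp add: R.ghost_proj S.ghost_proj Psi_mor_proj ring_hom_add hom_smult hom_pow)
qed

lemma Psi_mor_inj:
  assumes f: "f \<in> flat_hom R S" and g: "g \<in> flat_hom R S" and eq: "Psi_mor p R S f = Psi_mor p R S g"
  shows "f = g"
proof (rule extensionalityI)
  show "f \<in> extensional (carrier R)" "g \<in> extensional (carrier R)" using f g by (auto simp: flat_hom_def)
  fix X assume "X \<in> carrier R"
  then obtain w where "w \<in> carrier (witt p R.Q)" "R.ghost w = X" by (rule R.ghost_surj)
  then show "f X = g X" using hom_ghost f g eq unfolding flat_hom_def by (metis IntD1)
qed

lemma Psi_mor_surj:
  assumes \<phi>: "\<phi> \<in> wrinkled_hom p (Psi_obj p R) (Psi_obj p S)"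
  shows "\<exists>f\<in>flat_hom R S. Psi_mor p R S f = \<phi>"
proof -
  have hom: "\<phi> \<in> ring_hom R.Q S.Q" and ext: "\<phi> \<in> extensional (carrier R.Q)"
    and \<gamma>: "\<And>x. x \<in> frob_ker p R.Q \<Longrightarrow> Psi_gamma p S (\<phi> x) = \<phi> (Psi_gamma p R x)"
    using \<phi> by (auto simp: Psi_obj_def mem_wrinkled_hom_iff)
  interpret \<phi>: ring_hom_cring R.Q S.Q \<phi> using hom by unfold_locales
  define h where "h = S.ghost \<circ> map_prod \<phi> \<phi>"
  have h: "h \<in> ring_hom (witt p R.Q) S"
    unfolding h_def
    by (rule ring_hom_trans[OF witt_map_hom[OF R.Q.fp_algebra_axioms S.Q.fp_algebra_axioms hom] S.ghost_hom])
  obtain f where f: "f \<in> ring_hom R S" "f \<in> extensional (carrier R)"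
    "\<And>w. w \<in> carrier (witt p R.Q) \<Longrightarrow> f (R.ghost w) = h w"
  proof (rule ring_hom_factor[OF _ _ _ R.ghost_hom h])
    show "R.ghost ` carrier (witt p R.Q) = carrier R"
      using R.ghost_surj ring_hom_closed[OF R.ghost_hom] by (auto simp: image_iff)
    \<comment> \<open>Compatibility of \<phi> with the two maps \<gamma> is exactly what carries the
      graph for \<open>R\<close> into the graph for \<open>S\<close>, that is, kernel into
      kernel.\<close>
    fix w assume w: "w \<in> carrier (witt p R.Q)" "R.ghost w = \<zero>\<^bsub>R\<^esub>"
    then have "w \<in> wrinkle_ideal p R.Q (Psi_gamma p R)"
      unfolding R.ghost_kernel[symmetric] a_kernel_def' by blast
    then obtain x where x: "x \<in> frob_ker p R.Q" "w = (x, Psi_gamma p R x)" by (auto simp: wrinkle_ideal_def)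
    have "\<phi> x [^]\<^bsub>S.Q\<^esub> p = \<phi> (x [^]\<^bsub>R.Q\<^esub> p)"
      by (rule \<phi>.ring.hom_nat_pow[symmetric]) (use x R.Q.frob_ker_iff in blast)
    also have "\<dots> = \<zero>\<^bsub>S.Q\<^esub>" using x by (simp only: R.Q.frob_ker_iff \<phi>.hom_zero)
    finally have "\<phi> x [^]\<^bsub>S.Q\<^esub> p = \<zero>\<^bsub>S.Q\<^esub>" .
    then have "\<phi> x \<in> frob_ker p S.Q"
      using x by (simp add: R.Q.frob_ker_iff S.Q.frob_ker_iff)
    then have "map_prod \<phi> \<phi> w \<in> wrinkle_ideal p S.Q (Psi_gamma p S)"
      using x \<gamma>[OF x(1)] by (auto simp: wrinkle_ideal_def)
    then show "h w = \<zero>\<^bsub>S\<^esub>" unfolding S.ghost_kernel[symmetric] a_kernel_def' h_def o_def by blast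
  qed (use R.W.ring_axioms R.ring_axioms S.ring_axioms in auto)
  have "Psi_mor p R S f = \<phi>"
  proof (rule extensionalityI)
    show "Psi_mor p R S f \<in> extensional (carrier R.Q)" "\<phi> \<in> extensional (carrier R.Q)"
      using ext by (auto simp: Psi_mor_def)
    fix x assume "x \<in> carrier R.Q"
    then obtain X where X: "X \<in> carrier R" "x = R.proj X" unfolding R.carrier_Q by blast
    \<comment> \<open>The values of \<open>f\<close> are known through ghost images only. Modulo p
      these are p-th powers of first components, and \<phi> commutes with p-th powers.\<close>
    then obtain w where w: "w \<in> carrier (witt p R.Q)" "R.ghost w = X" using R.ghost_surj by blast
    have fw: "fst w \<in> carrier R.Q" using w by (auto simp: R.Q.witt_simps)
    have "map_prod \<phi> \<phi> w \<in> carrier (witt p S.Q)" using w by (auto simp: R.Q.witt_simps S.Q.witt_simps)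
    then have "S.proj (f X) = fst (map_prod \<phi> \<phi> w) [^]\<^bsub>S.Q\<^esub> p"
      using f(3)[OF w(1)] w(2) by (simp add: h_def S.proj_ghost)
    also have "\<dots> = \<phi> (fst w [^]\<^bsub>R.Q\<^esub> p)" using fw by (simp add: \<phi>.ring.hom_nat_pow)
    also have "\<dots> = \<phi> x" using R.proj_ghost[OF w(1)] w(2) X by simp
    finally show "Psi_mor p R S f x = \<phi> x" using X by (simp add: Psi_mor_proj[OF f(1)])
  qed
  then show ?thesis using f by (auto simp: flat_hom_def)
qed

end

lemma Psi_mor_id:
  assumes "two_flat_ring R p"
  shows "Psi_mor p R R (\<lambda>x\<in>carrier R. x) = (\<lambda>x\<in>carrier (mod_p p R). x)"
proof -
  interpret two_flat_pair R R p using assms by (simp add: two_flat_pair_def)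
  have hom: "(\<lambda>x\<in>carrier R. x) \<in> ring_hom R R" by (rule ring_hom_memI) auto
  show ?thesis
  proof (rule extensionalityI[where A="carrier (mod_p p R)"])
    fix x assume "x \<in> carrier (mod_p p R)"
    then obtain X where X: "X \<in> carrier R" "x = R.proj X" unfolding R.carrier_Q by blast
    then show "Psi_mor p R R (\<lambda>x\<in>carrier R. x) x = (\<lambda>x\<in>carrier (mod_p p R). x) x"
      using Psi_mor_proj[OF hom X(1)] by simp
  qed (auto simp: Psi_mor_def)
qed

lemma ring_hom_compose:
  assumes f: "f \<in> ring_hom R S" and g: "g \<in> ring_hom S T" and R: "ring R"
  shows "compose (carrier R) g f \<in> ring_hom R T"
proof -
  interpret ring R by fact
  show ?thesis
    using ring_hom_closed[OF f] ring_hom_mult[OF f] ring_hom_add[OF f] ring_hom_one[OF f]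
      ring_hom_closed[OF g] ring_hom_mult[OF g] ring_hom_add[OF g] ring_hom_one[OF g]
    by (intro ring_hom_memI) (simp_all add: compose_def)
qed

lemma Psi_mor_compose:
  assumes "two_flat_ring R p" "two_flat_ring S p" "two_flat_ring T p"
    and f: "f \<in> ring_hom R S" and g: "g \<in> ring_hom S T"
  shows "Psi_mor p R T (compose (carrier R) g f) =
    compose (carrier (mod_p p R)) (Psi_mor p S T g) (Psi_mor p R S f)"
proof -
  interpret RS: two_flat_pair R S p using assms by (simp add: two_flat_pair_def)
  interpret ST: two_flat_pair S T p using assms by (simp add: two_flat_pair_def)
  interpret RT: two_flat_pair R T p using assms by (simp add: two_flat_pair_def)
  have hom: "compose (carrier R) g f \<in> ring_hom R T" using f g RS.R.ring_axioms by (rule ring_hom_compose)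
  show ?thesis
  proof (rule extensionalityI[where A="carrier (mod_p p R)"])
    fix x assume "x \<in> carrier (mod_p p R)"
    then obtain X where X: "X \<in> carrier R" "x = RS.R.proj X" unfolding RS.R.carrier_Q by blast
    then show "Psi_mor p R T (compose (carrier R) g f) x =
        compose (carrier (mod_p p R)) (Psi_mor p S T g) (Psi_mor p R S f) x"
      using RT.Psi_mor_proj[OF hom X(1)] RS.Psi_mor_proj[OF f X(1)] ST.Psi_mor_proj[OF g ring_hom_closed[OF f X(1)]]
      by (simp add: compose_def)
  qed (auto simp: Psi_mor_def)
qed

section \<open>Construction of the lift\<close>

lemma two_wrinkled_fp_algebra:
  assumes "prime p" "two_wrinkled p (A, \<gamma>)"
  shows "fp_algebra A p"
proof -
  have "zmod_algebra p A" using assms(2) by (simp add: two_wrinkled_def)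
  from zmod_algebraD[OF this prime_gt_1_nat[OF assms(1)]] show ?thesis
    using assms(1) by (simp add: fp_algebra_def fp_algebra_axioms_def)
qed

text \<open>For the inverse to commute with \<gamma>, it must first map the kernel of Frobenius into
  itself's counterpart; this follows from injectivity of \<phi>, and the rest is the relation for
  \<phi> read backwards.\<close>

lemma wrinkled_isoI:
  assumes p: "prime p" and W: "two_wrinkled p (A, \<gamma>)" "two_wrinkled p (A', \<gamma>')"
    and \<phi>: "\<phi> \<in> wrinkled_hom p (A, \<gamma>) (A', \<gamma>')" and bij: "bij_betw \<phi> (carrier A) (carrier A')"
  shows "\<phi> \<in> wrinkled_iso p (A, \<gamma>) (A', \<gamma>')"
proof -
  interpret A: fp_algebra A p using two_wrinkled_fp_algebra[OF p W(1)] .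
  interpret A': fp_algebra A' p using two_wrinkled_fp_algebra[OF p W(2)] .
  have hom: "\<phi> \<in> ring_hom A A'" and \<gamma>: "\<And>x. x \<in> frob_ker p A \<Longrightarrow> \<gamma>' (\<phi> x) = \<phi> (\<gamma> x)"
    using \<phi> by (auto simp: mem_wrinkled_hom_iff)
  interpret \<phi>: ring_hom_cring A A' \<phi> using hom by unfold_locales
  have "\<phi> \<in> ring_iso A A'" using hom bij by (simp add: ring_iso_def)
  then have iso: "inv_into (carrier A) \<phi> \<in> ring_iso A' A" using A.ring_axioms by (rule ring_iso_set_sym[rotated])
  define \<psi> where "\<psi> = restrict (inv_into (carrier A) \<phi>) (carrier A')"
  have l: "\<psi> (\<phi> x) = x" if "x \<in> carrier A" for x
    using that bij by (simp add: \<psi>_def bij_betw_inv_into_left)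
  have r: "\<phi> (\<psi> y) = y" and c: "\<psi> y \<in> carrier A" if "y \<in> carrier A'" for y
    using that bij by (simp_all add: \<psi>_def bij_betw_inv_into_right bij_betw_apply[OF bij_betw_inv_into])
  have "\<psi> \<in> ring_hom A' A"
    using A'.ring_hom_restrict[of "inv_into (carrier A) \<phi>" A \<psi>] iso by (simp add: ring_iso_def \<psi>_def)
  moreover have "\<gamma> (\<psi> y) = \<psi> (\<gamma>' y)" if y: "y \<in> frob_ker p A'" for y
  proof -
    have yc: "y \<in> carrier A'" and y0: "y [^]\<^bsub>A'\<^esub> p = \<zero>\<^bsub>A'\<^esub>" using y by (auto simp: A'.frob_ker_iff)
    have "\<phi> (\<psi> y [^]\<^bsub>A\<^esub> p) = \<phi> \<zero>\<^bsub>A\<^esub>" using yc y0 c r by (simp add: \<phi>.ring.hom_nat_pow)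
    then have "\<psi> y [^]\<^bsub>A\<^esub> p = \<zero>\<^bsub>A\<^esub>" using l[of "\<psi> y [^]\<^bsub>A\<^esub> p"] l[of "\<zero>\<^bsub>A\<^esub>"] c[OF yc] by simp
    then have k: "\<psi> y \<in> frob_ker p A" using c yc by (simp add: A.frob_ker_iff)
    then have "\<gamma> (\<psi> y) \<in> carrier A" using W(1) by (auto simp: two_wrinkled_def)
    then show ?thesis using \<gamma>[OF k] l r[OF yc] by metis
  qed
  ultimately have "\<psi> \<in> wrinkled_hom p (A', \<gamma>') (A, \<gamma>)"
    by (simp add: mem_wrinkled_hom_iff \<psi>_def)
  then show ?thesis using \<phi> l r by (auto simp: wrinkled_iso_def)
qed

text \<open>Representatives in place of cosets keep the quotient on the type of the ring, so that
  the lift of a ring on \<open>'a\<close> can live on \<open>'a \<times> 'a\<close> and can be moved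
  on along an injection.\<close>

lemma (in ring) ideal_representatives:
  assumes "ideal I R"
  obtains h where "h ` carrier R \<subseteq> carrier R"
    "\<And>a b. a \<in> carrier R \<Longrightarrow> b \<in> carrier R \<Longrightarrow> h a = h b \<longleftrightarrow> a \<ominus> b \<in> I"
proof -
  interpret I: ideal I R by fact
  \<comment> \<open>The choice depends on the coset as a set and not on \<open>a\<close>, so equal
    cosets receive equal representatives.\<close>
  define h where "h a = (SOME b. b \<in> I +> a)" for a
  have h: "h a \<in> I +> a" if "a \<in> carrier R" for a
    unfolding h_def using I.a_rcos_self[OF that] by (rule someI)
  have "h ` carrier R \<subseteq> carrier R"
    using h a_r_coset_subset_G[OF I.a_subset] by blast
  moreover have "h a = h b \<longleftrightarrow> a \<ominus> b \<in> I" if ab: "a \<in> carrier R" "b \<in> carrier R" for a b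
  proof -
    have "h a = h b \<longleftrightarrow> I +> a = I +> b"
    proof
      assume "h a = h b"
      then show "I +> a = I +> b"
        using I.a_repr_independence'[OF h[OF ab(1)] ab(1)] I.a_repr_independence'[OF h[OF ab(2)] ab(2)] by metis
    next
      assume "I +> a = I +> b" then show "h a = h b" unfolding h_def by metis
    qed
    then show ?thesis using quotient_eq_iff_same_a_r_cos[OF assms ab] by metis
  qed
  ultimately show ?thesis by (rule that)
qed

text \<open>\<open>h\<close> is any map whose fibres are the classes modulo the wrinkle ideal. Its
  target type is left open, so that one construction serves every type into which the lift has to be
  placed.\<close>

locale witt_quotient = A: fp_algebra A p for A :: "'a ring" and p +
  fixes \<gamma> :: "'a \<Rightarrow> 'a" and h :: "'a \<times> 'a \<Rightarrow> 'b"
  assumes wrinkled: "two_wrinkled p (A, \<gamma>)"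
    and h_eq_iff: "u \<in> carrier (witt p A) \<Longrightarrow> v \<in> carrier (witt p A) \<Longrightarrow>
      h u = h v \<longleftrightarrow> u \<ominus>\<^bsub>witt p A\<^esub> v \<in> wrinkle_ideal p A \<gamma>"
begin

lemma frob_surj: "a \<in> carrier A \<Longrightarrow> \<exists>u\<in>carrier A. u [^]\<^bsub>A\<^esub> p = a"
  and ideal: "ideal (wrinkle_ideal p A \<gamma>) (witt p A)"
proof -
  have "zmod_algebra p A" using wrinkled by (simp add: two_wrinkled_def)
  note iff = A.two_wrinkled_iff[OF this, THEN iffD1, OF wrinkled]
  show "a \<in> carrier A \<Longrightarrow> \<exists>u\<in>carrier A. u [^]\<^bsub>A\<^esub> p = a" using iff by blast
  show "ideal (wrinkle_ideal p A \<gamma>) (witt p A)" using iff by blast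
qed

sublocale W: cring "witt p A" by (rule A.witt_cring)

definition lift :: "'b ring" where "lift = image_ring h (witt p A)"

lemma weak: "weak_ring_morphism h (wrinkle_ideal p A \<gamma>) (witt p A)"
  by (rule weak_ring_morphismI[OF ideal h_eq_iff])

lemma lift_carrier: "carrier lift = h ` carrier (witt p A)"
  by (simp add: lift_def image_ring_carrier)

lemma h_hom: "h \<in> ring_hom (witt p A) lift"
  unfolding lift_def by (rule W.weak_ring_morphism_is_hom[OF weak])

lemma lift_cring: "cring lift"
proof -
  interpret R: ring lift unfolding lift_def by (rule W.image_ring_is_ring[OF weak])
  show ?thesis
  proof
    fix x y assume "x \<in> carrier lift" "y \<in> carrier lift"
    then obtain u v where "u \<in> carrier (witt p A)" "v \<in> carrier (witt p A)" "x = h u" "y = h v"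
      unfolding lift_carrier by blast
    then show "x \<otimes>\<^bsub>lift\<^esub> y = y \<otimes>\<^bsub>lift\<^esub> x"
      using ring_hom_mult[OF h_hom] W.m_comm[of u v] by metis
  qed
qed

sublocale R: p_quotient lift p using lift_cring by (simp add: p_quotient_def)

sublocale h: ring_hom_cring "witt p A" lift h
  by unfold_locales (rule h_hom)

lemma lift_cases:
  assumes "X \<in> carrier lift"
  obtains a b where "a \<in> carrier A" "b \<in> carrier A" "X = h (a, b)"
  using assms by (auto simp: lift_carrier A.witt_simps)

lemma witt_mem [simp]: "a \<in> carrier A \<Longrightarrow> b \<in> carrier A \<Longrightarrow> (a, b) \<in> carrier (witt p A)"
  by (simp add: A.witt_simps)

lemma h_zero_iff:
  assumes "a \<in> carrier A" "b \<in> carrier A"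
  shows "h (a, b) = \<zero>\<^bsub>lift\<^esub> \<longleftrightarrow> a [^]\<^bsub>A\<^esub> p = \<zero>\<^bsub>A\<^esub> \<and> b = \<gamma> a"
proof -
  have "h (a, b) = \<zero>\<^bsub>lift\<^esub> \<longleftrightarrow> (a, b) \<in> wrinkle_ideal p A \<gamma>"
    using h_eq_iff[of "(a, b)" "\<zero>\<^bsub>witt p A\<^esub>"] assms by (simp add: a_minus_def)
  then show ?thesis using assms by (simp add: A.wrinkle_ideal_iff)
qed

lemma gamma_closed: "a \<in> carrier A \<Longrightarrow> a [^]\<^bsub>A\<^esub> p = \<zero>\<^bsub>A\<^esub> \<Longrightarrow> \<gamma> a \<in> carrier A"
  using wrinkled A.frob_ker_iff by (auto simp: two_wrinkled_def)

lemma gamma_zero: "\<gamma> \<zero>\<^bsub>A\<^esub> = \<zero>\<^bsub>A\<^esub>"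
  using h_zero_iff[of "\<zero>\<^bsub>A\<^esub>" "\<zero>\<^bsub>A\<^esub>"] h.hom_zero by (simp add: A.witt_simps)

lemma h_add: "a \<in> carrier A \<Longrightarrow> b \<in> carrier A \<Longrightarrow> c \<in> carrier A \<Longrightarrow> d \<in> carrier A \<Longrightarrow>
    h (a, b) \<oplus>\<^bsub>lift\<^esub> h (c, d) = h (a \<oplus>\<^bsub>A\<^esub> c, b \<oplus>\<^bsub>A\<^esub> d \<oplus>\<^bsub>A\<^esub> A.cocycle a c)"
  by (simp flip: h.hom_add) (simp add: A.witt_simps)

lemma h_split: "a \<in> carrier A \<Longrightarrow> b \<in> carrier A \<Longrightarrow> h (a, b) = h (a, \<zero>\<^bsub>A\<^esub>) \<oplus>\<^bsub>lift\<^esub> h (\<zero>\<^bsub>A\<^esub>, b)"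
  by (simp add: h_add A.cocycle_zero)

lemma h_smult_p: "a \<in> carrier A \<Longrightarrow> b \<in> carrier A \<Longrightarrow> [p] \<cdot>\<^bsub>lift\<^esub> h (a, b) = h (\<zero>\<^bsub>A\<^esub>, a [^]\<^bsub>A\<^esub> p)"
  by (simp flip: h.hom_nat_smult) (simp add: A.witt_smult_p)

lemma h_pow: "a \<in> carrier A \<Longrightarrow> h (a, \<zero>\<^bsub>A\<^esub>) [^]\<^bsub>lift\<^esub> (n::nat) = h (a [^]\<^bsub>A\<^esub> n, \<zero>\<^bsub>A\<^esub>)"
  by (simp flip: h.ring.hom_nat_pow) (simp add: A.witt_teichmueller_pow)

text \<open>A p-th root \<open>u\<close> of \<open>b\<close> gives \<open>p (u, 0) = (0, b)\<close>;
  surjectivity of Frobenius is what provides it.\<close>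

lemma h_p_multiple:
  assumes "b \<in> carrier A" shows "\<exists>Y\<in>carrier lift. h (\<zero>\<^bsub>A\<^esub>, b) = [p] \<cdot>\<^bsub>lift\<^esub> Y"
proof -
  obtain u where "u \<in> carrier A" "u [^]\<^bsub>A\<^esub> p = b" using frob_surj assms by blast
  then show ?thesis using h_smult_p[of u "\<zero>\<^bsub>A\<^esub>"] by (intro bexI[of _ "h (u, \<zero>\<^bsub>A\<^esub>)"]) auto
qed

text \<open>Split \<open>(a, b)\<close> as \<open>(a, \<gamma> a) + (0, b - \<gamma> a)\<close>: the
  first summand lies in the ideal and the second is a multiple of p. Flatness of the lift and
  injectivity of its reduction both come down to this.\<close>

lemma h_p_multiple_if_pow_zero:
  assumes "a \<in> carrier A" "b \<in> carrier A" "a [^]\<^bsub>A\<^esub> p = \<zero>\<^bsub>A\<^esub>"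
  shows "\<exists>Y\<in>carrier lift. h (a, b) = [p] \<cdot>\<^bsub>lift\<^esub> Y"
proof -
  have \<gamma>: "\<gamma> a \<in> carrier A" using gamma_closed assms by simp
  have "\<gamma> a \<oplus>\<^bsub>A\<^esub> (b \<ominus>\<^bsub>A\<^esub> \<gamma> a) = b"
    using A.minus_eq_iff[of b "\<gamma> a" "b \<ominus>\<^bsub>A\<^esub> \<gamma> a"] \<gamma> assms by simp
  then have "h (a, b) = h (a, \<gamma> a) \<oplus>\<^bsub>lift\<^esub> h (\<zero>\<^bsub>A\<^esub>, b \<ominus>\<^bsub>A\<^esub> \<gamma> a)"
    using \<gamma> assms by (simp add: h_add A.cocycle_zero)
  also have "h (a, \<gamma> a) = \<zero>\<^bsub>lift\<^esub>" using h_zero_iff \<gamma> assms by simp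
  finally have "h (a, b) = h (\<zero>\<^bsub>A\<^esub>, b \<ominus>\<^bsub>A\<^esub> \<gamma> a)" using \<gamma> assms by simp
  then show ?thesis using h_p_multiple[of "b \<ominus>\<^bsub>A\<^esub> \<gamma> a"] \<gamma> assms by simp
qed

lemma lift_two_flat: "two_flat_ring lift p"
proof
  show "prime p" by (rule A.prime)
  have "[(p ^ 2)] \<cdot>\<^bsub>lift\<^esub> \<one>\<^bsub>lift\<^esub> = [p] \<cdot>\<^bsub>lift\<^esub> ([p] \<cdot>\<^bsub>lift\<^esub> h (\<one>\<^bsub>A\<^esub>, \<zero>\<^bsub>A\<^esub>))"
    using h.hom_one by (simp add: R.add.nat_pow_pow power2_eq_square A.witt_simps)
  also have "\<dots> = h \<zero>\<^bsub>witt p A\<^esub>" unfolding A.witt_simps by (simp add: h_smult_p A.nat_pow_zero)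
  finally show "[(p ^ 2)] \<cdot>\<^bsub>lift\<^esub> \<one>\<^bsub>lift\<^esub> = \<zero>\<^bsub>lift\<^esub>" by simp
next
  fix X assume X: "X \<in> carrier lift" "[p] \<cdot>\<^bsub>lift\<^esub> X = \<zero>\<^bsub>lift\<^esub>"
  then obtain a b where ab: "a \<in> carrier A" "b \<in> carrier A" "X = h (a, b)" using lift_cases by metis
  \<comment> \<open>\<open>p X\<close> is the image of \<open>(0, a^p)\<close>, which lies in the
    ideal only if \<open>a^p\<close> is the value of \<gamma> at zero, namely zero.\<close>
  then have "a [^]\<^bsub>A\<^esub> p = \<gamma> \<zero>\<^bsub>A\<^esub>" using X h_zero_iff[of "\<zero>\<^bsub>A\<^esub>" "a [^]\<^bsub>A\<^esub> p"] by (simp add: h_smult_p)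
  then show "\<exists>Y\<in>carrier lift. X = [p] \<cdot>\<^bsub>lift\<^esub> Y"
    using h_p_multiple_if_pow_zero ab by (simp add: gamma_zero)
next
  fix X assume "X \<in> carrier lift"
  then obtain a b where ab: "a \<in> carrier A" "b \<in> carrier A" "X = h (a, b)" using lift_cases by metis
  obtain u where u: "u \<in> carrier A" "u [^]\<^bsub>A\<^esub> p = a" using frob_surj ab by blast
  obtain Y where Y: "Y \<in> carrier lift" "h (\<zero>\<^bsub>A\<^esub>, b) = [p] \<cdot>\<^bsub>lift\<^esub> Y" using h_p_multiple ab by blast
  \<comment> \<open>Vectors with second component zero multiply in the first one, so
    \<open>(a, 0)\<close> is the p-th power of \<open>(u, 0)\<close>.\<close>
  have "X = h (u, \<zero>\<^bsub>A\<^esub>) [^]\<^bsub>lift\<^esub> p \<oplus>\<^bsub>lift\<^esub> [p] \<cdot>\<^bsub>lift\<^esub> Y"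
    using h_split[OF ab(1,2)] ab u Y(2) by (simp add: h_pow)
  then show "\<exists>u\<in>carrier lift. \<exists>v\<in>carrier lift. X = u [^]\<^bsub>lift\<^esub> p \<oplus>\<^bsub>lift\<^esub> [p] \<cdot>\<^bsub>lift\<^esub> v"
    using u Y(1) by (intro bexI[of _ "h (u, \<zero>\<^bsub>A\<^esub>)"] bexI[of _ Y]) auto
qed

sublocale F: two_flat_ring lift p by (rule lift_two_flat)

text \<open>The first component alone is not well defined on the quotient. Two choices of a Witt
  vector over \<open>X\<close> differ there by an element killed by Frobenius, so its p-th power
  is.\<close>

definition red :: "'b \<Rightarrow> 'a" where "red X = fst (inv_into (carrier (witt p A)) h X) [^]\<^bsub>A\<^esub> p"

lemma red_h:
  assumes "a \<in> carrier A" "b \<in> carrier A" shows "red (h (a, b)) = a [^]\<^bsub>A\<^esub> p"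
proof -
  define w where "w = inv_into (carrier (witt p A)) h (h (a, b))"
  have w: "w \<in> carrier (witt p A)" "h w = h (a, b)"
    using assms by (simp_all add: w_def inv_into_into f_inv_into_f)
  then have "w \<ominus>\<^bsub>witt p A\<^esub> (a, b) \<in> wrinkle_ideal p A \<gamma>" using h_eq_iff assms by simp
  then obtain x where x: "x \<in> frob_ker p A" "w \<ominus>\<^bsub>witt p A\<^esub> (a, b) = (x, \<gamma> x)" by (auto simp: wrinkle_ideal_def)
  then have xc: "x \<in> carrier A" "x [^]\<^bsub>A\<^esub> p = \<zero>\<^bsub>A\<^esub>" by (auto simp: A.frob_ker_iff)
  then have "w = (a, b) \<oplus>\<^bsub>witt p A\<^esub> (x, \<gamma> x)"
    using W.minus_eq_iff[of w "(a, b)" "(x, \<gamma> x)"] x w assms gamma_closed by simp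
  then have "fst w = a \<oplus>\<^bsub>A\<^esub> x" by (simp add: A.witt_simps)
  then show ?thesis using xc assms by (simp add: red_def w_def A.frob_add)
qed

lemma red_hom: "red \<in> ring_hom lift A"
proof (rule ring_hom_memI)
  fix X Y assume "X \<in> carrier lift" "Y \<in> carrier lift"
  then obtain a b c d where [simp]: "a \<in> carrier A" "b \<in> carrier A" "c \<in> carrier A" "d \<in> carrier A"
    and XY: "X = h (a, b)" "Y = h (c, d)" by (metis lift_cases)
  show "red X \<in> carrier A" by (simp add: XY red_h)
  show "red (X \<oplus>\<^bsub>lift\<^esub> Y) = red X \<oplus>\<^bsub>A\<^esub> red Y" by (simp add: XY h_add red_h A.frob_add)
  have "X \<otimes>\<^bsub>lift\<^esub> Y = h (a \<otimes>\<^bsub>A\<^esub> c, (a [^]\<^bsub>A\<^esub> p \<otimes>\<^bsub>A\<^esub> d) \<oplus>\<^bsub>A\<^esub> (c [^]\<^bsub>A\<^esub> p \<otimes>\<^bsub>A\<^esub> b))"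
    unfolding XY by (simp flip: h.hom_mult) (simp add: A.witt_simps)
  then show "red (X \<otimes>\<^bsub>lift\<^esub> Y) = red X \<otimes>\<^bsub>A\<^esub> red Y"
    by (simp add: XY red_h A.nat_pow_distrib)
next
  have "\<one>\<^bsub>lift\<^esub> = h (\<one>\<^bsub>A\<^esub>, \<zero>\<^bsub>A\<^esub>)" by (simp flip: h.hom_one add: A.witt_simps)
  then show "red \<one>\<^bsub>lift\<^esub> = \<one>\<^bsub>A\<^esub>" by (simp add: red_h)
qed

text \<open>The kernel of \<open>red\<close> consists of the multiples of p: if
  \<open>a^p = 0\<close> then \<open>h_p_multiple_if_pow_zero\<close> applies, and conversely p
  vanishes in \<open>A\<close>.\<close>

lemma red_eq_iff:
  assumes "X \<in> carrier lift" "Y \<in> carrier lift"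
  shows "red X = red Y \<longleftrightarrow> R.proj X = R.proj Y"
proof -
  interpret red: ring_hom_cring lift A red by unfold_locales (rule red_hom)
  have z: "red X = \<zero>\<^bsub>A\<^esub> \<longleftrightarrow> (\<exists>Y\<in>carrier lift. X = [p] \<cdot>\<^bsub>lift\<^esub> Y)" if X: "X \<in> carrier lift" for X
  proof -
    obtain a b where "a \<in> carrier A" "b \<in> carrier A" "X = h (a, b)" by (rule lift_cases[OF X])
    moreover have "red ([p] \<cdot>\<^bsub>lift\<^esub> Y) = \<zero>\<^bsub>A\<^esub>" if "Y \<in> carrier lift" for Y
      using that by (simp add: red.hom_nat_smult A.dvd_smult)
    ultimately show ?thesis using h_p_multiple_if_pow_zero[of a b] by (metis red_h)
  qed
  have "red X = red Y \<longleftrightarrow> red (X \<ominus>\<^bsub>lift\<^esub> Y) = \<zero>\<^bsub>A\<^esub>"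
    using assms by (simp add: a_minus_def red.hom_a_inv) (metis A.minus_eq A.r_right_minus_eq red.hom_closed)
  also have "\<dots> \<longleftrightarrow> (\<exists>Z\<in>carrier lift. X \<ominus>\<^bsub>lift\<^esub> Y = [p] \<cdot>\<^bsub>lift\<^esub> Z)" using assms by (intro z) auto
  also have "\<dots> \<longleftrightarrow> (\<exists>Z\<in>carrier lift. X = Y \<oplus>\<^bsub>lift\<^esub> [p] \<cdot>\<^bsub>lift\<^esub> Z)"
    using assms by (intro bex_cong refl) (rule R.minus_eq_iff, auto)
  finally show ?thesis using R.proj_eq_iff[OF assms] by simp
qed

definition red_iso :: "'b set \<Rightarrow> 'a" where "red_iso = (\<lambda>x\<in>carrier R.Q. red (F.lft x))"

lemma red_iso_proj: "X \<in> carrier lift \<Longrightarrow> red_iso (R.proj X) = red X"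
  using F.lft[of "R.proj X"] red_eq_iff[of "F.lft (R.proj X)" X] by (simp add: red_iso_def)

lemma red_iso_hom: "red_iso \<in> ring_hom R.Q A"
proof (rule ring_hom_memI)
  fix x y assume "x \<in> carrier R.Q" "y \<in> carrier R.Q"
  then obtain X Y where XY: "X \<in> carrier lift" "x = R.proj X" "Y \<in> carrier lift" "y = R.proj Y"
    unfolding R.carrier_Q by blast
  show "red_iso x \<in> carrier A" using XY ring_hom_closed[OF red_hom] by (simp add: red_iso_proj)
  show "red_iso (x \<otimes>\<^bsub>R.Q\<^esub> y) = red_iso x \<otimes>\<^bsub>A\<^esub> red_iso y"
    using XY red_iso_proj[of "X \<otimes>\<^bsub>lift\<^esub> Y"] by (simp add: ring_hom_mult[OF red_hom] red_iso_proj)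
  show "red_iso (x \<oplus>\<^bsub>R.Q\<^esub> y) = red_iso x \<oplus>\<^bsub>A\<^esub> red_iso y"
    using XY red_iso_proj[of "X \<oplus>\<^bsub>lift\<^esub> Y"] by (simp add: ring_hom_add[OF red_hom] red_iso_proj)
next
  show "red_iso \<one>\<^bsub>R.Q\<^esub> = \<one>\<^bsub>A\<^esub>"
    using red_iso_proj[of "\<one>\<^bsub>lift\<^esub>"] by (simp add: ring_hom_one[OF red_hom])
qed

lemma red_iso_bij: "bij_betw red_iso (carrier R.Q) (carrier A)"
  unfolding bij_betw_def
proof (intro conjI inj_onI)
  fix x y assume "x \<in> carrier R.Q" "y \<in> carrier R.Q" and eq: "red_iso x = red_iso y"
  then obtain X Y where XY: "X \<in> carrier lift" "x = R.proj X" "Y \<in> carrier lift" "y = R.proj Y"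
    unfolding R.carrier_Q by blast
  then show "x = y" using eq red_eq_iff by (simp add: red_iso_proj)
next
  have "a \<in> red_iso ` carrier R.Q" if a: "a \<in> carrier A" for a
  proof -
    obtain u where u: "u \<in> carrier A" "u [^]\<^bsub>A\<^esub> p = a" using frob_surj a by blast
    have "h (u, \<zero>\<^bsub>A\<^esub>) \<in> carrier lift" using u by simp
    then have "red_iso (R.proj (h (u, \<zero>\<^bsub>A\<^esub>))) = a" "R.proj (h (u, \<zero>\<^bsub>A\<^esub>)) \<in> carrier R.Q"
      using u by (simp_all add: red_iso_proj red_h)
    then show ?thesis by (metis imageI)
  qed
  then show "red_iso ` carrier R.Q = carrier A" using ring_hom_closed[OF red_iso_hom] by blast
qed

text \<open>For a p-th root \<open>u\<close> of the image \<open>a\<close> of \<open>x\<close>, the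
  class of \<open>(u, 0)\<close> lifts \<open>x\<close>, and its p-th power can be written as p
  times an element reducing to minus \<open>\<gamma> a\<close>. The sign in
  \<open>Psi_gamma_eq\<close> gives back \<open>\<gamma> a\<close>.\<close>

lemma red_iso_gamma:
  assumes x: "x \<in> frob_ker p R.Q"
  shows "\<gamma> (red_iso x) = red_iso (Psi_gamma p lift x)"
proof -
  have xc: "x \<in> carrier R.Q" and x0: "x [^]\<^bsub>R.Q\<^esub> p = \<zero>\<^bsub>R.Q\<^esub>" using x by (auto simp: F.Q.frob_ker_iff)
  interpret i: ring_hom_cring R.Q A red_iso by unfold_locales (rule red_iso_hom)
  define a where "a = red_iso x"
  have a: "a \<in> carrier A" "a [^]\<^bsub>A\<^esub> p = \<zero>\<^bsub>A\<^esub>"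
    using xc x0 by (simp_all add: a_def flip: i.ring.hom_nat_pow)
  obtain u where u: "u \<in> carrier A" "u [^]\<^bsub>A\<^esub> p = a" using frob_surj a by blast
  have \<gamma>: "\<gamma> a \<in> carrier A" using a gamma_closed by simp
  then obtain w where w: "w \<in> carrier A" "w [^]\<^bsub>A\<^esub> p = \<ominus>\<^bsub>A\<^esub> \<gamma> a" using frob_surj by (metis A.a_inv_closed)
  define X where "X = h (u, \<zero>\<^bsub>A\<^esub>)"
  define Y where "Y = h (w, \<zero>\<^bsub>A\<^esub>)"
  have XY: "X \<in> carrier lift" "Y \<in> carrier lift" using u w by (simp_all add: X_def Y_def)
  have "red_iso (R.proj X) = red_iso x" using u XY by (simp add: red_iso_proj X_def red_h a_def)
  then have xX: "x = R.proj X"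
    using red_iso_bij xc R.proj.hom_closed[OF XY(1)] unfolding bij_betw_def inj_on_def by metis
  \<comment> \<open>As \<open>(a, \<gamma> a)\<close> lies in the ideal, \<open>(a, 0)\<close> is
    congruent to \<open>(0, -\<gamma> a)\<close>; the root \<open>w\<close> exhibits the latter as p
    times \<open>(w, 0)\<close>.\<close>
  have "h (a, \<zero>\<^bsub>A\<^esub>) = h (a, \<gamma> a \<oplus>\<^bsub>A\<^esub> \<ominus>\<^bsub>A\<^esub> \<gamma> a)" using \<gamma> by (simp add: A.r_neg)
  also have "\<dots> = h (a, \<gamma> a) \<oplus>\<^bsub>lift\<^esub> h (\<zero>\<^bsub>A\<^esub>, \<ominus>\<^bsub>A\<^esub> \<gamma> a)" using a \<gamma> by (simp add: h_add A.cocycle_zero)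
  also have "h (a, \<gamma> a) = \<zero>\<^bsub>lift\<^esub>" using h_zero_iff a \<gamma> by simp
  finally have "h (a, \<zero>\<^bsub>A\<^esub>) = h (\<zero>\<^bsub>A\<^esub>, \<ominus>\<^bsub>A\<^esub> \<gamma> a)" using \<gamma> by simp
  then have "X [^]\<^bsub>lift\<^esub> p = [p] \<cdot>\<^bsub>lift\<^esub> Y" using u w by (simp add: X_def Y_def h_pow h_smult_p)
  then have "Psi_gamma p lift x = \<ominus>\<^bsub>R.Q\<^esub> R.proj Y" using F.Psi_gamma_eq XY xX by simp
  then have "red_iso (Psi_gamma p lift x) = \<ominus>\<^bsub>A\<^esub> red Y" using XY by (simp add: i.hom_a_inv red_iso_proj)
  also have "red Y = \<ominus>\<^bsub>A\<^esub> \<gamma> a" using w by (simp add: Y_def red_h)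
  finally show ?thesis using \<gamma> by (simp add: a_def)
qed

lemma is_lift_lift: "is_lift p (A, \<gamma>) lift red_iso"
proof -
  have "red_iso \<in> wrinkled_hom p (R.Q, Psi_gamma p lift) (A, \<gamma>)"
    unfolding mem_wrinkled_hom_iff using red_iso_hom red_iso_gamma by (simp add: red_iso_def)
  then have "red_iso \<in> wrinkled_iso p (Psi_obj p lift) (A, \<gamma>)"
    using wrinkled_isoI[OF A.prime _ wrinkled _ red_iso_bij] F.Psi_wrinkled by (simp add: Psi_obj_def)
  then show ?thesis using lift_two_flat by (simp add: is_lift_def two_flat_iff[OF A.prime])
qed

end

section \<open>Equivalence of categories\<close>

lemma is_categoryI:
  assumes "\<And>a. a \<in> objs C \<Longrightarrow> cid C a \<in> homs C a a"
    and "\<And>a b c f g. a \<in> objs C \<Longrightarrow> b \<in> objs C \<Longrightarrow> c \<in> objs C \<Longrightarrow> f \<in> homs C a b \<Longrightarrow> g \<in> homs C b c \<Longrightarrow>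
      ccomp C a b c g f \<in> homs C a c"
    and "\<And>a b f. a \<in> objs C \<Longrightarrow> b \<in> objs C \<Longrightarrow> f \<in> homs C a b \<Longrightarrow> ccomp C a a b f (cid C a) = f"
    and "\<And>a b f. a \<in> objs C \<Longrightarrow> b \<in> objs C \<Longrightarrow> f \<in> homs C a b \<Longrightarrow> ccomp C a b b (cid C b) f = f"
    and "\<And>a b c d f g h. a \<in> objs C \<Longrightarrow> b \<in> objs C \<Longrightarrow> c \<in> objs C \<Longrightarrow> d \<in> objs C \<Longrightarrow>
      f \<in> homs C a b \<Longrightarrow> g \<in> homs C b c \<Longrightarrow> h \<in> homs C c d \<Longrightarrow>
      ccomp C a c d h (ccomp C a b c g f) = ccomp C a b d (ccomp C b c d h g) f"
  shows "is_category C"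
  unfolding is_category_def using assms by (intro conjI ballI)

lemma is_functorI:
  assumes "\<And>a. a \<in> objs C \<Longrightarrow> fobj F a \<in> objs D"
    and "\<And>a b f. a \<in> objs C \<Longrightarrow> b \<in> objs C \<Longrightarrow> f \<in> homs C a b \<Longrightarrow> fmor F a b f \<in> homs D (fobj F a) (fobj F b)"
    and "\<And>a. a \<in> objs C \<Longrightarrow> fmor F a a (cid C a) = cid D (fobj F a)"
    and "\<And>a b c f g. a \<in> objs C \<Longrightarrow> b \<in> objs C \<Longrightarrow> c \<in> objs C \<Longrightarrow> f \<in> homs C a b \<Longrightarrow> g \<in> homs C b c \<Longrightarrow>
      fmor F a c (ccomp C a b c g f) = ccomp D (fobj F a) (fobj F b) (fobj F c) (fmor F b c g) (fmor F a b f)"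
  shows "is_functor C D F"
  unfolding is_functor_def using assms by (intro conjI ballI)

locale category =
  fixes C :: "('o, 'm) cat"
  assumes cat: "is_category C"
begin

lemma id_hom: "a \<in> objs C \<Longrightarrow> cid C a \<in> homs C a a"
  and comp_hom: "a \<in> objs C \<Longrightarrow> b \<in> objs C \<Longrightarrow> c \<in> objs C \<Longrightarrow> f \<in> homs C a b \<Longrightarrow> g \<in> homs C b c \<Longrightarrow>
    ccomp C a b c g f \<in> homs C a c"
  and comp_id_left: "a \<in> objs C \<Longrightarrow> b \<in> objs C \<Longrightarrow> f \<in> homs C a b \<Longrightarrow> ccomp C a b b (cid C b) f = f"
  and comp_assoc: "a \<in> objs C \<Longrightarrow> b \<in> objs C \<Longrightarrow> c \<in> objs C \<Longrightarrow> d \<in> objs C \<Longrightarrow>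
    f \<in> homs C a b \<Longrightarrow> g \<in> homs C b c \<Longrightarrow> h \<in> homs C c d \<Longrightarrow>
    ccomp C a b d (ccomp C b c d h g) f = ccomp C a c d h (ccomp C a b c g f)"
  using cat unfolding is_category_def by (blast, blast, blast, metis)

end

locale ff_functor = C: category C + D: category D
  for C :: "('o, 'm) cat" and D :: "('o2, 'm2) cat" +
  fixes F :: "('o, 'm, 'o2, 'm2) fctor"
  assumes is_functor: "is_functor C D F"
    and faithful: "a \<in> objs C \<Longrightarrow> b \<in> objs C \<Longrightarrow> f \<in> homs C a b \<Longrightarrow> g \<in> homs C a b \<Longrightarrow>
      fmor F a b f = fmor F a b g \<Longrightarrow> f = g"
    and full: "a \<in> objs C \<Longrightarrow> b \<in> objs C \<Longrightarrow> k \<in> homs D (fobj F a) (fobj F b) \<Longrightarrow>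
      \<exists>f\<in>homs C a b. fmor F a b f = k"
begin

lemma obj: "a \<in> objs C \<Longrightarrow> fobj F a \<in> objs D"
  and mor: "a \<in> objs C \<Longrightarrow> b \<in> objs C \<Longrightarrow> f \<in> homs C a b \<Longrightarrow> fmor F a b f \<in> homs D (fobj F a) (fobj F b)"
  and mor_id: "a \<in> objs C \<Longrightarrow> fmor F a a (cid C a) = cid D (fobj F a)"
  and mor_comp: "a \<in> objs C \<Longrightarrow> b \<in> objs C \<Longrightarrow> c \<in> objs C \<Longrightarrow> f \<in> homs C a b \<Longrightarrow> g \<in> homs C b c \<Longrightarrow>
     fmor F a c (ccomp C a b c g f) = ccomp D (fobj F a) (fobj F b) (fobj F c) (fmor F b c g) (fmor F a b f)"
  using is_functor unfolding is_functor_def by blast+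

text \<open>Fullness lifts the inverse, and faithfulness lifts the two identities that it
  satisfies.\<close>

lemma reflects_iso:
  assumes ab: "a \<in> objs C" "b \<in> objs C" and f: "f \<in> homs C a b"
    and iso: "is_iso D (fobj F a) (fobj F b) (fmor F a b f)"
  shows "is_iso C a b f"
proof -
  obtain g' where g': "g' \<in> homs D (fobj F b) (fobj F a)"
    "ccomp D (fobj F a) (fobj F b) (fobj F a) g' (fmor F a b f) = cid D (fobj F a)"
    "ccomp D (fobj F b) (fobj F a) (fobj F b) (fmor F a b f) g' = cid D (fobj F b)"
    using iso unfolding is_iso_def by blast
  obtain g where g: "g \<in> homs C b a" "fmor F b a g = g'" using full ab g'(1) by blast
  have "ccomp C a b a g f = cid C a"
    using g' g ab f by (intro faithful[of a a]) (simp_all add: mor_comp mor_id C.comp_hom C.id_hom)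
  moreover have "ccomp C b a b f g = cid C b"
    using g' g ab f by (intro faithful[of b b]) (simp_all add: mor_comp mor_id C.comp_hom C.id_hom)
  ultimately show ?thesis using g f unfolding is_iso_def by blast
qed

text \<open>A quasi-inverse is built from chosen objects \<open>G\<^sub>0 d\<close> and isomorphisms
  \<epsilon>. Every identity between morphisms of \<open>C\<close> is checked after applying
  \<open>F\<close>, where \<epsilon> can be cancelled.\<close>

lemma equivalence_if_ess_surj:
  assumes ess: "\<And>d. d \<in> objs D \<Longrightarrow> \<exists>c\<in>objs C. \<exists>e. is_iso D (fobj F c) d e"
  shows "is_equivalence C D F"
proof -
  obtain G\<^sub>0 \<epsilon> where G0: "\<And>d. d \<in> objs D \<Longrightarrow> G\<^sub>0 d \<in> objs C"
    and \<epsilon>: "\<And>d. d \<in> objs D \<Longrightarrow> is_iso D (fobj F (G\<^sub>0 d)) d (\<epsilon> d)"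
    using ess by metis
  let ?P = "\<lambda>d. fobj F (G\<^sub>0 d)"
  obtain \<epsilon>' where \<epsilon>': "\<And>d. d \<in> objs D \<Longrightarrow> \<epsilon>' d \<in> homs D d (?P d)"
    and inv1: "\<And>d. d \<in> objs D \<Longrightarrow> ccomp D (?P d) d (?P d) (\<epsilon>' d) (\<epsilon> d) = cid D (?P d)"
    and inv2: "\<And>d. d \<in> objs D \<Longrightarrow> ccomp D d (?P d) d (\<epsilon> d) (\<epsilon>' d) = cid D d"
    using \<epsilon> unfolding is_iso_def by metis
  have \<epsilon>h: "\<epsilon> d \<in> homs D (?P d) d" if "d \<in> objs D" for d using \<epsilon>[OF that] by (simp add: is_iso_def)
  have P: "?P d \<in> objs D" if "d \<in> objs D" for d using that G0 obj by blast
  \<comment> \<open>The transport of \<open>g\<close> along the chosen isomorphisms.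
    \<open>G\<close> sends \<open>g\<close> to a preimage of it under \<open>F\<close>, which is
    exactly what makes \<epsilon> natural.\<close>
  define conj where "conj d d' g = ccomp D (?P d) d' (?P d') (\<epsilon>' d') (ccomp D (?P d) d d' g (\<epsilon> d))" for d d' g
  have conj: "conj d d' g \<in> homs D (?P d) (?P d')" if "d \<in> objs D" "d' \<in> objs D" "g \<in> homs D d d'" for d d' g
    unfolding conj_def using that P \<epsilon>h \<epsilon>' by (intro D.comp_hom) auto
  have \<epsilon>_conj: "ccomp D (?P d) (?P d') d' (\<epsilon> d') (conj d d' g) = ccomp D (?P d) d d' g (\<epsilon> d)"
    if d: "d \<in> objs D" "d' \<in> objs D" "g \<in> homs D d d'" for d d' g
  proof -
    have k: "ccomp D (?P d) d d' g (\<epsilon> d) \<in> homs D (?P d) d'" using d P \<epsilon>h by (intro D.comp_hom) auto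
    have "ccomp D (?P d) (?P d') d' (\<epsilon> d') (conj d d' g)
        = ccomp D (?P d) d' d' (ccomp D d' (?P d') d' (\<epsilon> d') (\<epsilon>' d')) (ccomp D (?P d) d d' g (\<epsilon> d))"
      unfolding conj_def using d P \<epsilon>h \<epsilon>' k by (intro D.comp_assoc[symmetric]) auto
    then show ?thesis using d P k by (simp add: inv2 D.comp_id_left)
  qed
  have \<epsilon>_cancel: "u = v" if d: "c \<in> objs D" "d \<in> objs D" "u \<in> homs D c (?P d)" "v \<in> homs D c (?P d)"
    and eq: "ccomp D c (?P d) d (\<epsilon> d) u = ccomp D c (?P d) d (\<epsilon> d) v" for c d u v
  proof -
    have *: "ccomp D c d (?P d) (\<epsilon>' d) (ccomp D c (?P d) d (\<epsilon> d) w) = w" if w: "w \<in> homs D c (?P d)" for w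
    proof -
      have "ccomp D c (?P d) (?P d) (ccomp D (?P d) d (?P d) (\<epsilon>' d) (\<epsilon> d)) w
          = ccomp D c d (?P d) (\<epsilon>' d) (ccomp D c (?P d) d (\<epsilon> d) w)"
        by (rule D.comp_assoc) (use d w P \<epsilon>h \<epsilon>' in auto)
      then show ?thesis using d w P by (simp add: inv1 D.comp_id_left)
    qed
    show ?thesis
      using arg_cong[OF eq, of "ccomp D c d (?P d) (\<epsilon>' d)"] unfolding *[OF d(3)] *[OF d(4)] .
  qed
  define lft where "lft a b g = (SOME f. f \<in> homs C a b \<and> fmor F a b f = g)" for a b g
  have lft: "lft a b g \<in> homs C a b" "fmor F a b (lft a b g) = g"
    if "a \<in> objs C" "b \<in> objs C" "g \<in> homs D (fobj F a) (fobj F b)" for a b g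
    using someI_ex[of "\<lambda>f. f \<in> homs C a b \<and> fmor F a b f = g"] full[OF that] by (auto simp: lft_def)
  define G where "G = \<lparr>fobj = G\<^sub>0, fmor = (\<lambda>d d' g. lft (G\<^sub>0 d) (G\<^sub>0 d') (conj d d' g))\<rparr>"
  have Go: "fobj G d = G\<^sub>0 d" for d by (simp add: G_def)
  have Gm: "fmor G d d' g \<in> homs C (G\<^sub>0 d) (G\<^sub>0 d')" "fmor F (G\<^sub>0 d) (G\<^sub>0 d') (fmor G d d' g) = conj d d' g"
    if "d \<in> objs D" "d' \<in> objs D" "g \<in> homs D d d'" for d d' g
    using lft[OF G0 G0 conj] that by (simp_all add: G_def)
  have "is_functor D C G" unfolding is_functor_def Go
  proof (intro conjI ballI)
    fix d assume d: "d \<in> objs D"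
    show "G\<^sub>0 d \<in> objs C" using d by (rule G0)
    have "conj d d (cid D d) = cid D (?P d)"
      unfolding conj_def using d P \<epsilon>h by (simp add: D.comp_id_left inv1)
    then show "fmor G d d (cid D d) = cid C (G\<^sub>0 d)"
      using d Gm[OF d d D.id_hom[OF d]] G0 C.id_hom by (intro faithful[of "G\<^sub>0 d" "G\<^sub>0 d"]) (simp_all add: mor_id)
  next
    fix a b f assume "a \<in> objs D" "b \<in> objs D" "f \<in> homs D a b"
    then show "fmor G a b f \<in> homs C (G\<^sub>0 a) (G\<^sub>0 b)" by (rule Gm)
  next
    fix a b c f g assume o: "a \<in> objs D" "b \<in> objs D" "c \<in> objs D" and f: "f \<in> homs D a b" and g: "g \<in> homs D b c"
    have gf: "ccomp D a b c g f \<in> homs D a c" using o f g by (rule D.comp_hom)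
    let ?r = "ccomp D (?P a) (?P b) (?P c) (conj b c g) (conj a b f)"
    have r: "?r \<in> homs D (?P a) (?P c)" using o f g P conj by (intro D.comp_hom) auto
    have "ccomp D (?P a) (?P c) c (\<epsilon> c) ?r = ccomp D (?P a) (?P b) c (ccomp D (?P b) (?P c) c (\<epsilon> c) (conj b c g)) (conj a b f)"
      using o f g P conj \<epsilon>h by (intro D.comp_assoc[symmetric]) auto
    also have "\<dots> = ccomp D (?P a) (?P b) c (ccomp D (?P b) b c g (\<epsilon> b)) (conj a b f)"
      using o g by (simp add: \<epsilon>_conj)
    also have "\<dots> = ccomp D (?P a) b c g (ccomp D (?P a) (?P b) b (\<epsilon> b) (conj a b f))"
      using o f g P conj \<epsilon>h by (intro D.comp_assoc) auto
    also have "\<dots> = ccomp D (?P a) b c g (ccomp D (?P a) a b f (\<epsilon> a))"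
      using o f by (simp add: \<epsilon>_conj)
    also have "\<dots> = ccomp D (?P a) a c (ccomp D a b c g f) (\<epsilon> a)"
      using o f g P \<epsilon>h by (intro D.comp_assoc[symmetric]) auto
    also have "\<dots> = ccomp D (?P a) (?P c) c (\<epsilon> c) (conj a c (ccomp D a b c g f))"
      using o gf by (simp add: \<epsilon>_conj)
    finally have "?r = conj a c (ccomp D a b c g f)"
      by (rule \<epsilon>_cancel[OF P[OF o(1)] o(3) r conj[OF o(1,3) gf]])
    then show "fmor G a c (ccomp D a b c g f) = ccomp C (G\<^sub>0 a) (G\<^sub>0 b) (G\<^sub>0 c) (fmor G b c g) (fmor G a b f)"
      using o f g gf Gm G0 by (intro faithful[of "G\<^sub>0 a" "G\<^sub>0 c"]) (simp_all add: mor_comp C.comp_hom)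
  qed
  moreover have "naturally_isomorphic D D (comp_fctor F G) id_fctor"
    unfolding naturally_isomorphic_def
    by (rule exI[of _ \<epsilon>]) (use \<epsilon> Gm \<epsilon>_conj in \<open>auto simp: comp_fctor_def id_fctor_def Go\<close>)
  moreover have "naturally_isomorphic C C (comp_fctor G F) id_fctor"
  proof -
    \<comment> \<open>The unit is the preimage under \<open>F\<close> of \<epsilon> at
      \<open>fobj F c\<close>, so that its naturality follows from that of \<epsilon>.\<close>
    define \<eta> where "\<eta> c = lft (G\<^sub>0 (fobj F c)) c (\<epsilon> (fobj F c))" for c
    have \<eta>: "\<eta> c \<in> homs C (G\<^sub>0 (fobj F c)) c" "fmor F (G\<^sub>0 (fobj F c)) c (\<eta> c) = \<epsilon> (fobj F c)"
      if "c \<in> objs C" for c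
      unfolding \<eta>_def using that G0 obj \<epsilon>h by (auto intro!: lft)
    have "is_iso C (G\<^sub>0 (fobj F c)) c (\<eta> c)" if "c \<in> objs C" for c
      by (rule reflects_iso) (use that \<eta> \<epsilon> G0 obj in auto)
    moreover have "ccomp C (G\<^sub>0 (fobj F a)) (G\<^sub>0 (fobj F b)) b (\<eta> b) (fmor G (fobj F a) (fobj F b) (fmor F a b f))
        = ccomp C (G\<^sub>0 (fobj F a)) a b f (\<eta> a)"
      if o: "a \<in> objs C" "b \<in> objs C" and f: "f \<in> homs C a b" for a b f
    proof -
      note m = mor[OF o f]
      show ?thesis
      proof (rule faithful[of "G\<^sub>0 (fobj F a)" b])
        show "fmor F (G\<^sub>0 (fobj F a)) b (ccomp C (G\<^sub>0 (fobj F a)) (G\<^sub>0 (fobj F b)) b (\<eta> b) (fmor G (fobj F a) (fobj F b) (fmor F a b f)))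
          = fmor F (G\<^sub>0 (fobj F a)) b (ccomp C (G\<^sub>0 (fobj F a)) a b f (\<eta> a))"
          using o f m obj G0 Gm \<eta> by (simp add: mor_comp \<epsilon>_conj)
      qed (use o f m obj G0 Gm \<eta> in \<open>auto intro!: C.comp_hom\<close>)
    qed
    ultimately show ?thesis
      unfolding naturally_isomorphic_def
      by (intro exI[of _ \<eta>]) (auto simp: comp_fctor_def id_fctor_def Go)
  qed
  ultimately show ?thesis
    unfolding is_equivalence_def using C.cat D.cat is_functor by blast
qed

end

section \<open>The categories of wrinkled and flat rings\<close>

lemma wrinkled_hom_compose:
  assumes p: "prime p" and W: "two_wrinkled p W" "two_wrinkled p W'"
    and f: "f \<in> wrinkled_hom p W W'" and g: "g \<in> wrinkled_hom p W' W''"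
  shows "compose (carrier (fst W)) g f \<in> wrinkled_hom p W W''"
proof -
  obtain A \<gamma> A' \<gamma>' A'' \<gamma>'' where eq: "W = (A, \<gamma>)" "W' = (A', \<gamma>')" "W'' = (A'', \<gamma>'')"
    by (metis surj_pair)
  interpret A: fp_algebra A p using two_wrinkled_fp_algebra p W eq by blast
  interpret A': fp_algebra A' p using two_wrinkled_fp_algebra p W eq by blast
  have f': "f \<in> ring_hom A A'" "\<And>x. x \<in> frob_ker p A \<Longrightarrow> \<gamma>' (f x) = f (\<gamma> x)"
    and g': "g \<in> ring_hom A' A''" "\<And>x. x \<in> frob_ker p A' \<Longrightarrow> \<gamma>'' (g x) = g (\<gamma>' x)"
    using f g unfolding eq mem_wrinkled_hom_iff by auto
  interpret f: ring_hom_cring A A' f using f'(1) by unfold_locales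
  have "\<gamma>'' (compose (carrier A) g f x) = compose (carrier A) g f (\<gamma> x)" if x: "x \<in> frob_ker p A" for x
  proof -
    have xc: "x \<in> carrier A" "x [^]\<^bsub>A\<^esub> p = \<zero>\<^bsub>A\<^esub>" using x A.frob_ker_iff by auto
    have "\<gamma> x \<in> carrier A" using W(1) x by (auto simp: eq two_wrinkled_def)
    moreover have "f x \<in> frob_ker p A'"
      unfolding A'.frob_ker_iff using xc f.ring.hom_nat_pow[of x p] by simp
    ultimately show ?thesis using f'(2)[OF x] g'(2) xc by (simp add: compose_def)
  qed
  then show ?thesis unfolding eq mem_wrinkled_hom_iff
    using ring_hom_compose[OF f'(1) g'(1) A.ring_axioms] by simp
qed

lemma wrinkled_id_hom:
  assumes "two_wrinkled p W"
  shows "(\<lambda>x\<in>carrier (fst W). x) \<in> wrinkled_hom p W W"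
proof -
  obtain A \<gamma> where eq: "W = (A, \<gamma>)" by fastforce
  have "zmod_algebra p A" using assms by (simp add: eq two_wrinkled_def)
  then have "cring A" unfolding zmod_algebra_def algebra_def cring_int_scalars by blast
  then interpret cring A .
  have "(\<lambda>x\<in>carrier A. x) \<in> ring_hom A A" by (rule ring_hom_memI) auto
  moreover have "x \<in> carrier A" "\<gamma> x \<in> carrier A" if "x \<in> frob_ker p A" for x
    using assms that by (auto simp: eq two_wrinkled_def frob_ker_def a_kernel_def')
  ultimately show ?thesis by (simp add: eq mem_wrinkled_hom_iff)
qed

lemma wrinkled_hom_mem:
  "f \<in> wrinkled_hom p W W' \<Longrightarrow> x \<in> carrier (fst W) \<Longrightarrow> f x \<in> carrier (fst W')"
  by (cases W; cases W') (auto simp: mem_wrinkled_hom_iff ring_hom_closed)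

lemma wrinkled_hom_extensional: "f \<in> wrinkled_hom p W W' \<Longrightarrow> f \<in> extensional (carrier (fst W))"
  by (cases W; cases W') (auto simp: mem_wrinkled_hom_iff)

lemma compose_id_right: "f \<in> extensional A \<Longrightarrow> compose A f (\<lambda>x\<in>A. x) = f"
  by (rule extensionalityI[of _ A]) (auto simp: compose_def)

lemma compose_id_left: "f \<in> extensional A \<Longrightarrow> f \<in> A \<rightarrow> B \<Longrightarrow> compose A (\<lambda>x\<in>B. x) f = f"
  by (rule extensionalityI[of _ A]) (auto simp: compose_def)

lemma compose_compose:
  "f \<in> A \<rightarrow> B \<Longrightarrow> compose A h (compose A g f) = compose A (compose B h g) f"
  by (rule extensionalityI[of _ A]) (auto simp: compose_def)

lemma wrinkled_cat_simps:
  "W \<in> objs (wrinkled_cat U p) \<longleftrightarrow> two_wrinkled p W \<and> carrier (fst W) \<lesssim> U"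
  "homs (wrinkled_cat U p) W W' = wrinkled_hom p W W'"
  "cid (wrinkled_cat U p) W = (\<lambda>x\<in>carrier (fst W). x)"
  "ccomp (wrinkled_cat U p) W W' W'' g f = compose (carrier (fst W)) g f"
  by (simp_all add: wrinkled_cat_def)

lemma flat_cat_simps:
  "R \<in> objs (flat_cat U p) \<longleftrightarrow> two_flat p R \<and> carrier R \<lesssim> U"
  "homs (flat_cat U p) R S = flat_hom R S"
  "cid (flat_cat U p) R = (\<lambda>x\<in>carrier R. x)"
  "ccomp (flat_cat U p) R S T g f = compose (carrier R) g f"
  by (simp_all add: flat_cat_def)

lemma wrinkled_category:
  assumes "prime p" shows "is_category (wrinkled_cat U p)"
proof (rule is_categoryI; unfold wrinkled_cat_simps)
  fix W W' f assume f: "f \<in> wrinkled_hom p W W'"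
  show "compose (carrier (fst W)) f (\<lambda>x\<in>carrier (fst W). x) = f"
    by (rule compose_id_right[OF wrinkled_hom_extensional[OF f]])
  show "compose (carrier (fst W)) (\<lambda>x\<in>carrier (fst W'). x) f = f"
    by (rule compose_id_left[OF wrinkled_hom_extensional[OF f]]) (use wrinkled_hom_mem[OF f] in blast)
next
  fix V W X Y f g h assume f: "f \<in> wrinkled_hom p V W"
  show "compose (carrier (fst V)) h (compose (carrier (fst V)) g f) =
      compose (carrier (fst V)) (compose (carrier (fst W)) h g) f"
    by (rule compose_compose) (use wrinkled_hom_mem[OF f] in blast)
qed (auto intro: wrinkled_id_hom wrinkled_hom_compose[OF assms])

lemma flat_hom_mem: "f \<in> flat_hom R S \<Longrightarrow> x \<in> carrier R \<Longrightarrow> f x \<in> carrier S"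
  by (auto simp: flat_hom_def ring_hom_closed)

lemma flat_hom_compose:
  "cring R \<Longrightarrow> f \<in> flat_hom R S \<Longrightarrow> g \<in> flat_hom S T \<Longrightarrow> compose (carrier R) g f \<in> flat_hom R T"
  using ring_hom_compose[of f R S g T] by (auto simp: flat_hom_def cring_def)

lemma two_flat_cring: "two_flat p R \<Longrightarrow> cring R"
  unfolding two_flat_def zmod_algebra_def algebra_def cring_int_scalars by blast

lemma flat_id_hom: assumes "cring R" shows "(\<lambda>x\<in>carrier R. x) \<in> flat_hom R R"
proof -
  interpret cring R by fact
  show ?thesis unfolding flat_hom_def by (auto intro!: ring_hom_memI)
qed

lemma flat_category: "is_category (flat_cat U p)"
proof (rule is_categoryI; unfold flat_cat_simps)
  fix R S f assume f: "f \<in> flat_hom R S"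
  have ext: "f \<in> extensional (carrier R)" using f by (simp add: flat_hom_def)
  show "compose (carrier R) f (\<lambda>x\<in>carrier R. x) = f" by (rule compose_id_right[OF ext])
  show "compose (carrier R) (\<lambda>x\<in>carrier S. x) f = f"
    by (rule compose_id_left[OF ext]) (use flat_hom_mem[OF f] in blast)
next
  fix R S T V f g h assume f: "f \<in> flat_hom R S"
  show "compose (carrier R) h (compose (carrier R) g f) = compose (carrier R) (compose (carrier S) h g) f"
    by (rule compose_compose) (use flat_hom_mem[OF f] in blast)
qed (auto intro: flat_id_hom two_flat_cring flat_hom_compose)

lemma Psi_functor:
  assumes "prime p" shows "is_functor (flat_cat U p) (wrinkled_cat U p) (Psi p)"
proof (rule is_functorI; unfold flat_cat_simps wrinkled_cat_simps two_flat_iff[OF assms] Psi_def fctor.simps)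
  fix R assume R: "two_flat_ring R p \<and> carrier R \<lesssim> U"
  then interpret two_flat_ring R p by blast
  \<comment> \<open>The cosets lie in a larger type, but the projection bounds their number by that
    of the elements of \<open>R\<close>.\<close>
  have "carrier Q \<lesssim> carrier R" unfolding carrier_Q by (rule image_lepoll)
  then have "carrier Q \<lesssim> U" using R lepoll_trans by blast
  then show "two_wrinkled p (Psi_obj p R) \<and> carrier (fst (Psi_obj p R)) \<lesssim> U"
    using Psi_wrinkled by (simp add: Psi_obj_def)
  show "Psi_mor p R R (\<lambda>x\<in>carrier R. x) = (\<lambda>x\<in>carrier (fst (Psi_obj p R)). x)"
    using Psi_mor_id[OF two_flat_ring_axioms] by (simp add: Psi_obj_def)
next
  fix R S f assume "two_flat_ring R p \<and> carrier R \<lesssim> U" "two_flat_ring S p \<and> carrier S \<lesssim> U" "f \<in> flat_hom R S"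
  then show "Psi_mor p R S f \<in> wrinkled_hom p (Psi_obj p R) (Psi_obj p S)"
    by (intro two_flat_pair.Psi_mor_wrinkled_hom) (auto simp: two_flat_pair_def flat_hom_def)
next
  fix R S T f g assume "two_flat_ring R p \<and> carrier R \<lesssim> U" "two_flat_ring S p \<and> carrier S \<lesssim> U"
    "two_flat_ring T p \<and> carrier T \<lesssim> U" "f \<in> flat_hom R S" "g \<in> flat_hom S T"
  then show "Psi_mor p R T (compose (carrier R) g f) =
      compose (carrier (fst (Psi_obj p R))) (Psi_mor p S T g) (Psi_mor p R S f)"
    by (auto simp: Psi_obj_def flat_hom_def intro!: Psi_mor_compose)
qed

lemma Psi_ff:
  assumes p: "prime p" and R: "two_flat p R" "two_flat p S"
  shows "f \<in> flat_hom R S \<Longrightarrow> g \<in> flat_hom R S \<Longrightarrow> Psi_mor p R S f = Psi_mor p R S g \<Longrightarrow> f = g"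
    and "\<phi> \<in> wrinkled_hom p (Psi_obj p R) (Psi_obj p S) \<Longrightarrow> \<exists>f\<in>flat_hom R S. Psi_mor p R S f = \<phi>"
proof -
  interpret two_flat_pair R S p using R by (simp add: two_flat_pair_def two_flat_iff[OF p])
  show "f \<in> flat_hom R S \<Longrightarrow> g \<in> flat_hom R S \<Longrightarrow> Psi_mor p R S f = Psi_mor p R S g \<Longrightarrow> f = g"
    by (rule Psi_mor_inj)
  show "\<phi> \<in> wrinkled_hom p (Psi_obj p R) (Psi_obj p S) \<Longrightarrow> \<exists>f\<in>flat_hom R S. Psi_mor p R S f = \<phi>"
    by (rule Psi_mor_surj)
qed

lemma wrinkled_iso_is_iso:
  assumes "\<phi> \<in> wrinkled_iso p W W'"
  shows "is_iso (wrinkled_cat U p) W W' \<phi>"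
proof -
  obtain \<psi> where \<psi>: "\<psi> \<in> wrinkled_hom p W' W" "\<And>x. x \<in> carrier (fst W) \<Longrightarrow> \<psi> (\<phi> x) = x"
    "\<And>y. y \<in> carrier (fst W') \<Longrightarrow> \<phi> (\<psi> y) = y" and \<phi>: "\<phi> \<in> wrinkled_hom p W W'"
    using assms by (auto simp: wrinkled_iso_def)
  have "compose (carrier (fst W)) \<psi> \<phi> = (\<lambda>x\<in>carrier (fst W). x)"
    "compose (carrier (fst W')) \<phi> \<psi> = (\<lambda>x\<in>carrier (fst W'). x)"
    using \<psi> by (auto simp: compose_def)
  then show ?thesis using \<psi>(1) \<phi> by (auto simp: is_iso_def wrinkled_cat_simps)
qed

text \<open>The map \<open>j\<close> transports the lift from \<open>'a \<times> 'a\<close> to any type that is large enough.\<close>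

lemma ex_lift:
  assumes p: "prime p" and W: "two_wrinkled p (A, \<gamma>)" and j: "inj_on j (carrier A \<times> carrier A)"
  shows "\<exists>R \<alpha>. is_lift p (A, \<gamma>) R \<alpha> \<and> carrier R \<subseteq> j ` (carrier A \<times> carrier A)"
proof -
  interpret A: fp_algebra A p using two_wrinkled_fp_algebra[OF p W] .
  interpret W: cring "witt p A" by (rule A.witt_cring)
  have "zmod_algebra p A" using W by (simp add: two_wrinkled_def)
  then have "ideal (wrinkle_ideal p A \<gamma>) (witt p A)" using A.two_wrinkled_iff W by blast
  from W.ideal_representatives[OF this] obtain h\<^sub>0 where
    h0: "h\<^sub>0 ` carrier (witt p A) \<subseteq> carrier (witt p A)" and
    eq: "\<And>a b. a \<in> carrier (witt p A) \<Longrightarrow> b \<in> carrier (witt p A) \<Longrightarrow>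
       h\<^sub>0 a = h\<^sub>0 b \<longleftrightarrow> a \<ominus>\<^bsub>witt p A\<^esub> b \<in> wrinkle_ideal p A \<gamma>" by metis
  have j': "inj_on j (carrier (witt p A))" using j by (simp add: A.witt_simps)
  have "j (h\<^sub>0 u) = j (h\<^sub>0 v) \<longleftrightarrow> h\<^sub>0 u = h\<^sub>0 v" if "u \<in> carrier (witt p A)" "v \<in> carrier (witt p A)" for u v
    by (rule inj_on_eq_iff[OF j']) (use h0 that in auto)
  then interpret witt_quotient A p \<gamma> "j \<circ> h\<^sub>0"
    by unfold_locales (use W eq in auto)
  have "carrier lift \<subseteq> j ` carrier (witt p A)"
    unfolding lift_carrier image_comp[symmetric] using h0 by (rule image_mono)
  then show ?thesis using is_lift_lift by (auto simp: A.witt_simps)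
qed

text \<open>The lift has at most as many elements as \<open>A \<times> A\<close>, and this must stay
  within the size bound. A finite bound would not do: the field with p elements lifts to
  \<open>Z/p^2\<close>.\<close>

lemma Times_lepoll_infinite:
  assumes "infinite U" "A \<lesssim> U" shows "A \<times> A \<lesssim> U"
proof -
  obtain f where f: "inj_on f A" "f ` A \<subseteq> U" using assms(2) by (auto simp: lepoll_def)
  have "inj_on (map_prod f f) (A \<times> A)" using f(1) by (rule map_prod_inj_on[OF _ f(1)])
  then have "A \<times> A \<lesssim> U \<times> U" using f(2) by (auto simp: lepoll_def)
  moreover obtain g where "bij_betw g (U \<times> U) U"
    using card_of_Times_same_infinite[OF assms(1)] card_of_ordIso by blast
  then have "U \<times> U \<lesssim> U" by (auto simp: lepoll_def bij_betw_def)
  ultimately show ?thesis by (rule lepoll_trans)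
qed

theorem Psi_equivalence:
  fixes U :: "'u set"
  assumes p: "prime p" and U: "infinite U"
  shows "is_equivalence (flat_cat U p :: ('u ring, 'u \<Rightarrow> 'u) cat)
                       (wrinkled_cat U p :: ('u set wrinkled, 'u set \<Rightarrow> 'u set) cat) (Psi p)"
proof -
  interpret ff_functor "flat_cat U p :: ('u ring, 'u \<Rightarrow> 'u) cat" "wrinkled_cat U p" "Psi p"
  proof
    show "is_category (flat_cat U p :: ('u ring, 'u \<Rightarrow> 'u) cat)" by (rule flat_category)
    show "is_category (wrinkled_cat U p :: ('u set wrinkled, 'u set \<Rightarrow> 'u set) cat)"
      using p by (rule wrinkled_category)
    show "is_functor (flat_cat U p :: ('u ring, 'u \<Rightarrow> 'u) cat) (wrinkled_cat U p) (Psi p)"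
      using p by (rule Psi_functor)
  qed (use Psi_ff[OF p] in \<open>auto simp: flat_cat_simps wrinkled_cat_simps Psi_def\<close>)
  show ?thesis
  proof (rule equivalence_if_ess_surj)
    fix W :: "'u set wrinkled" assume "W \<in> objs (wrinkled_cat U p)"
    then have W: "two_wrinkled p W" "carrier (fst W) \<lesssim> U" by (auto simp: wrinkled_cat_simps)
    obtain A \<gamma> where eq: "W = (A, \<gamma>)" by fastforce
    \<comment> \<open>\<open>U\<close> consists of elements of the type that carries flat rings, so
      an embedding into \<open>U\<close> places the lift on that type and within the bound at
      once.\<close>
    obtain j where j: "inj_on j (carrier A \<times> carrier A)" "j ` (carrier A \<times> carrier A) \<subseteq> U"
      using Times_lepoll_infinite[OF U W(2)] by (auto simp: lepoll_def eq)
    obtain R \<alpha> where "is_lift p W R \<alpha>" "carrier R \<subseteq> j ` (carrier A \<times> carrier A)"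
      using ex_lift[OF p W(1)[unfolded eq] j(1)] unfolding eq by blast
    then have R: "is_lift p W R \<alpha>" "carrier R \<subseteq> U" using j(2) by blast+
    then have "R \<in> objs (flat_cat U p)" by (auto simp: flat_cat_simps is_lift_def subset_imp_lepoll)
    moreover have "is_iso (wrinkled_cat U p) (fobj (Psi p) R) W \<alpha>"
      using R by (auto simp: is_lift_def Psi_def intro: wrinkled_iso_is_iso)
    ultimately show "\<exists>c\<in>objs (flat_cat U p). \<exists>e. is_iso (wrinkled_cat U p) (fobj (Psi p) c) W e"
      by blast
  qed
qed

section \<open>Uniqueness of lifts up to unique isomorphism\<close>

text \<open>The required reduction is the inverse of \<beta> after \<alpha>, and fullness lifts
  it.\<close>

lemma ex_flat_hom_over:
  assumes p: "prime p" and W: "two_wrinkled p W" and R: "is_lift p W R \<alpha>" and S: "is_lift p W S \<beta>"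
  shows "\<exists>f. f \<in> flat_hom R S \<and> compose (carrier (mod_p p R)) \<beta> (Psi_mor p R S f) = \<alpha>"
proof -
  let ?A = "carrier (mod_p p R)"
  have fst: "carrier (fst (Psi_obj p R)) = ?A" by (simp add: Psi_obj_def)
  interpret R: two_flat_ring R p using R by (simp add: is_lift_def two_flat_iff[OF p])
  obtain \<beta>' where \<beta>': "\<beta>' \<in> wrinkled_hom p W (Psi_obj p S)" "\<And>y. y \<in> carrier (fst W) \<Longrightarrow> \<beta> (\<beta>' y) = y"
    using S by (auto simp: is_lift_def wrinkled_iso_def)
  have \<alpha>: "\<alpha> \<in> wrinkled_hom p (Psi_obj p R) W" using R by (auto simp: is_lift_def wrinkled_iso_def)
  have "compose ?A \<beta>' \<alpha> \<in> wrinkled_hom p (Psi_obj p R) (Psi_obj p S)"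
    using wrinkled_hom_compose[OF p R.Psi_wrinkled W \<alpha> \<beta>'(1)] by (simp add: fst)
  then obtain f where f: "f \<in> flat_hom R S" "Psi_mor p R S f = compose ?A \<beta>' \<alpha>"
    using Psi_ff(2)[OF p] R S unfolding is_lift_def by blast
  have "compose ?A \<beta> (Psi_mor p R S f) = \<alpha>"
  proof (rule extensionalityI[of _ ?A])
    show "\<alpha> \<in> extensional ?A" using wrinkled_hom_extensional[OF \<alpha>] by (simp add: fst)
    fix x assume "x \<in> ?A"
    then show "compose ?A \<beta> (Psi_mor p R S f) x = \<alpha> x"
      using \<beta>'(2) wrinkled_hom_mem[OF \<alpha>] by (simp add: f compose_def fst)
  qed simp
  then show ?thesis using f by blast
qed

text \<open>\<beta> has a left inverse and can be cancelled, after which faithfulness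
  applies.\<close>

lemma flat_hom_over_unique:
  assumes p: "prime p" and R: "two_flat p R" and S: "is_lift p W S \<beta>"
    and f: "f \<in> flat_hom R S" and g: "g \<in> flat_hom R S"
    and eq: "compose (carrier (mod_p p R)) \<beta> (Psi_mor p R S f) = compose (carrier (mod_p p R)) \<beta> (Psi_mor p R S g)"
  shows "f = g"
proof -
  let ?A = "carrier (mod_p p R)"
  interpret two_flat_pair R S p using R S by (simp add: two_flat_pair_def is_lift_def two_flat_iff[OF p])
  obtain \<beta>' where \<beta>': "\<And>x. x \<in> carrier (mod_p p S) \<Longrightarrow> \<beta>' (\<beta> x) = x"
    using S by (auto simp: is_lift_def wrinkled_iso_def Psi_obj_def)
  have hom: "Psi_mor p R S k x \<in> carrier (mod_p p S)" if "x \<in> ?A" "k \<in> flat_hom R S" for x k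
    using Psi_mor_ring_hom[of k] that by (auto simp: flat_hom_def ring_hom_closed)
  have "Psi_mor p R S f = Psi_mor p R S g"
  proof (rule extensionalityI[of _ ?A])
    fix x assume x: "x \<in> ?A"
    then have "\<beta> (Psi_mor p R S f x) = \<beta> (Psi_mor p R S g x)"
      using eq by (metis compose_eq)
    then show "Psi_mor p R S f x = Psi_mor p R S g x" using \<beta>' hom x f g by metis
  qed (auto simp: Psi_mor_def)
  then show ?thesis using Psi_mor_inj f g by blast
qed

text \<open>The composite and the identity of \<open>R\<close> both lie over \<alpha>, so they agree
  by \<open>flat_hom_over_unique\<close>. Exchanging the two lifts gives the other
  composite.\<close>

lemma lift_hom_inverse:
  assumes p: "prime p" and R: "is_lift p W R \<alpha>" and S: "two_flat p S"
    and f: "f \<in> flat_hom R S" "compose (carrier (mod_p p R)) \<beta> (Psi_mor p R S f) = \<alpha>"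
    and g: "g \<in> flat_hom S R" "compose (carrier (mod_p p S)) \<alpha> (Psi_mor p S R g) = \<beta>"
  shows "compose (carrier R) g f = (\<lambda>x\<in>carrier R. x)"
proof -
  have tf: "two_flat_ring R p" "two_flat_ring S p"
    using R S by (simp_all add: is_lift_def two_flat_iff[OF p])
  have cr: "cring R" using R two_flat_cring by (auto simp: is_lift_def)
  let ?A = "carrier (mod_p p R)"
  interpret RS: two_flat_pair R S p using tf by (simp add: two_flat_pair_def)
  have fh: "f \<in> ring_hom R S" and gh: "g \<in> ring_hom S R" using f g by (auto simp: flat_hom_def)
  have m: "Psi_mor p R S f \<in> ?A \<rightarrow> carrier (mod_p p S)"
    using RS.Psi_mor_ring_hom[OF fh] by (auto simp: ring_hom_closed)
  have ext: "\<alpha> \<in> extensional ?A"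
    using R wrinkled_hom_extensional[of \<alpha> p "Psi_obj p R" W] by (simp add: is_lift_def wrinkled_iso_def Psi_obj_def)
  have "compose ?A \<alpha> (Psi_mor p R R (compose (carrier R) g f)) =
      compose ?A (compose (carrier (mod_p p S)) \<alpha> (Psi_mor p S R g)) (Psi_mor p R S f)"
    unfolding Psi_mor_compose[OF tf tf(1) fh gh] by (rule compose_compose[OF m])
  also have "\<dots> = compose ?A \<alpha> (Psi_mor p R R (\<lambda>x\<in>carrier R. x))"
    unfolding g(2) f(2) Psi_mor_id[OF tf(1)] using ext by (simp add: compose_id_right)
  finally show ?thesis
    using R flat_hom_compose[OF cr f(1) g(1)] flat_id_hom[OF cr]
    by (intro flat_hom_over_unique[OF p _ R]) (auto simp: is_lift_def)
qed

lemma lift_unique: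
  assumes p: "prime p" and W: "two_wrinkled p W" and R: "is_lift p W R \<alpha>" and S: "is_lift p W S \<beta>"
  shows "\<exists>!f. f \<in> ring_iso R S \<inter> extensional (carrier R) \<and>
      compose (carrier (mod_p p R)) \<beta> (Psi_mor p R S f) = \<alpha>"
proof -
  have flat: "two_flat p R" "two_flat p S" using R S by (auto simp: is_lift_def)
  obtain f where f: "f \<in> flat_hom R S" "compose (carrier (mod_p p R)) \<beta> (Psi_mor p R S f) = \<alpha>"
    using ex_flat_hom_over[OF assms] by blast
  obtain g where g: "g \<in> flat_hom S R" "compose (carrier (mod_p p S)) \<alpha> (Psi_mor p S R g) = \<beta>"
    using ex_flat_hom_over[OF p W S R] by blast
  have "g (f x) = x" if "x \<in> carrier R" for x
    using lift_hom_inverse[OF p R flat(2) f g] that by (metis compose_eq restrict_apply')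
  moreover have "f (g y) = y" if "y \<in> carrier S" for y
    using lift_hom_inverse[OF p S flat(1) g f] that by (metis compose_eq restrict_apply')
  ultimately have "bij_betw f (carrier R) (carrier S)"
    using flat_hom_mem[OF f(1)] flat_hom_mem[OF g(1)] by (intro bij_betwI[of f _ _ g]) auto
  then have "f \<in> ring_iso R S \<inter> extensional (carrier R)" using f(1) by (auto simp: flat_hom_def ring_iso_def)
  then show ?thesis
  proof (intro ex1I[of _ f] conjI)
    fix k assume "k \<in> ring_iso R S \<inter> extensional (carrier R) \<and>
      compose (carrier (mod_p p R)) \<beta> (Psi_mor p R S k) = \<alpha>"
    then show "k = f" using flat_hom_over_unique[OF p flat(1) S _ f(1), of k] f(2)
      by (auto simp: flat_hom_def ring_iso_def)
  qed (use f(2) in auto)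
qed

text \<open>The clauses on lifts carry no size bound and allow three unrelated types, so they are
  drawn from the construction and from full faithfulness directly and not from the
  equivalence.\<close>

theorem proposition17p9:
  fixes p :: nat
  assumes "prime p"
  shows
    "(\<forall>U :: 'u set. infinite U \<longrightarrow>
        is_equivalence (flat_cat U p :: ('u ring, 'u \<Rightarrow> 'u) cat)
                       (wrinkled_cat U p :: ('u set wrinkled, 'u set \<Rightarrow> 'u set) cat)
                       (Psi p)) \<and>
     (\<forall>W :: 'a wrinkled. two_wrinkled p W \<longrightarrow>
        (\<exists>(R :: ('a \<times> 'a) ring) \<alpha>. is_lift p W R \<alpha>) \<and>
        (\<forall>(R :: 'b ring) \<alpha> (S :: 'c ring) \<beta>. is_lift p W R \<alpha> \<and> is_lift p W S \<beta> \<longrightarrow>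
           (\<exists>!f. f \<in> ring_iso R S \<inter> extensional (carrier R) \<and>
                 compose (carrier (mod_p p R)) \<beta> (Psi_mor p R S f) = \<alpha>)))"
proof (intro conjI allI impI)
  fix U :: "'u set" assume "infinite U"
  then show "is_equivalence (flat_cat U p :: ('u ring, 'u \<Rightarrow> 'u) cat)
      (wrinkled_cat U p :: ('u set wrinkled, 'u set \<Rightarrow> 'u set) cat) (Psi p)"
    using assms by (intro Psi_equivalence)
next
  fix W :: "'a wrinkled" assume W: "two_wrinkled p W"
  obtain A \<gamma> where eq: "W = (A, \<gamma>)" by fastforce
  \<comment> \<open>With the identity as embedding, the lift stays on pairs of elements of
    \<open>A\<close>.\<close>
  show "\<exists>(R :: ('a \<times> 'a) ring) \<alpha>. is_lift p W R \<alpha>"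
    using ex_lift[OF assms, of A \<gamma> id] W unfolding eq by auto
next
  fix W :: "'a wrinkled" and R :: "'b ring" and \<alpha> and S :: "'c ring" and \<beta>
  assume W: "two_wrinkled p W" and "is_lift p W R \<alpha> \<and> is_lift p W S \<beta>"
  then show "\<exists>!f. f \<in> ring_iso R S \<inter> extensional (carrier R) \<and>
      compose (carrier (mod_p p R)) \<beta> (Psi_mor p R S f) = \<alpha>"
    by (intro lift_unique[OF assms W]) auto
qed

end
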